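(* Let $d>2$ be an integer and let $c$ be a legal coloring of the $d$-regular tree. Suppose that $F\leq F'\leq\widehat{F}\leq\mathrm{Sym}(d)$ are such that $F$ does not act freely on $[d]=\{1,\dots,d\}$. Then the following are equivalent: (i) $F'$ is transitive and generated by its point stabilizers; (ii) $G_c(F,F')$ is virtually in $\mathcal{S}$; (iii) $G_c(F,F')$ is in $\mathcal{R}$.
   Context: Let $T$ be the $d$-regular tree with $d$ finite, with vertex set $VT$ and set $ET$ of directed edges; each edge $e$ has an initial vertex $o(e)$ and a reverse edge $\overline{e}$, and $E(v)=\{e\in ET\mid o(e)=v\}$. A coloring of $T$ is a map $c\colon ET\to[d]$ such that, for each $v\in VT$, the restriction $c_v:=c|_{E(v)}\colon E(v)\to[d]$ is a bijection. It is legal if $c(e)=c(\overline{e})$ for every edge $e$. The local action of $g\in\mathrm{Aut}(T)$ at $v$ is $\sigma_c(g,v):=c_{g(v)}\circ g\circ c_v^{-1}\in\mathrm{Sym}(d)$. The Burger--Mozes group is $U_c(F)=\{g\in\mathrm{Aut}(T)\mid \sigma_c(g,v)\in F\ \text{for all } v\in VT\}$, a closed subgroup of $\mathrm{Aut}(T)$ with the subspace topology. For $F\leq F'\leq\mathrm{Sym}(d)$, the restricted Burger--Mozes group is $$G_c(F,F')=\{g\in\mathrm{Aut}(T)\mid \sigma_c(g,v)\in F' \text{ for all } v\in VT,\text{ and } \sigma_c(g,v)\in F\text{ for all but finitely many } v\in VT\},$$ equipped with the totally disconnected locally compact group topology for which the inclusion $U_c(F)\to G_c(F,F')$ is continuous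 and open. $\widehat{F}$ is the set of all $\sigma\in\mathrm{Sym}(d)$ that setwise preserve each orbit of $F$ on $[d]$. A permutation group acts freely if all its point stabilizers are trivial. t.d.l.c. means totally disconnected locally compact (Hausdorff). $\mathcal{S}$ is the class of non-discrete, compactly generated, topologically simple t.d.l.c. groups; a group is virtually in $\mathcal{S}$ if it has a closed subgroup of finite index belonging to $\mathcal{S}$. A t.d.l.c. group $G$ is regionally expansive if some compactly generated open subgroup $O\leq G$ has a compact open subgroup $U$ with $\bigcap_{g\in O}gUg^{-1}=\{1\}$. A locally compact group is monolithic if the intersection of all its non-trivial closed normal subgroups (the monolith) is non-trivial. $\mathcal{R}$ is the class of robustly monolithic groups: monolithic t.d.l.c. groups whose monolith is non-discrete, regionally expansive and topologically simple. *)

theory Defs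
  imports "HOL-Analysis.Analysis" "HOL-Algebra.Sym_Groups" "HOL-Algebra.Group_Action"
begin

section \<open>Topological groups on a carrier set\<close>

definition topological_group :: "('a, 'b) monoid_scheme \<Rightarrow> 'a topology \<Rightarrow> bool" where
  "topological_group G \<tau> \<longleftrightarrow>
     group G \<and> topspace \<tau> = carrier G \<and>
     continuous_map (prod_topology \<tau> \<tau>) \<tau> (\<lambda>(x, y). x \<otimes>\<^bsub>G\<^esub> y) \<and>
     continuous_map \<tau> \<tau> (\<lambda>x. inv\<^bsub>G\<^esub> x)"

definition totally_disconnected_space :: "'a topology \<Rightarrow> bool" where
  "totally_disconnected_space \<tau> \<longleftrightarrow>
     (\<forall>x \<in> topspace \<tau>. connected_component_of_set \<tau> x = {x})"

definition tdlc_group :: "('a, 'b) monoid_scheme \<Rightarrow> 'a topology \<Rightarrow> bool" where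
  "tdlc_group G \<tau> \<longleftrightarrow>
     topological_group G \<tau> \<and> Hausdorff_space \<tau> \<and>
     locally_compact_space \<tau> \<and> totally_disconnected_space \<tau>"

definition discrete_space :: "'a topology \<Rightarrow> bool" where
  "discrete_space \<tau> \<longleftrightarrow> \<tau> = discrete_topology (topspace \<tau>)"

definition compactly_generated :: "('a, 'b) monoid_scheme \<Rightarrow> 'a topology \<Rightarrow> bool" where
  "compactly_generated G \<tau> \<longleftrightarrow> (\<exists>K. compactin \<tau> K \<and> generate G K = carrier G)"

definition topologically_simple :: "('a, 'b) monoid_scheme \<Rightarrow> 'a topology \<Rightarrow> bool" where
  "topologically_simple G \<tau> \<longleftrightarrow>
     carrier G \<noteq> {\<one>\<^bsub>G\<^esub>} \<and>
     (\<forall>N. N \<lhd> G \<and> closedin \<tau> N \<longrightarrow> N = {\<one>\<^bsub>G\<^esub>} \<or> N = carrier G)"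

definition class_S :: "('a, 'b) monoid_scheme \<Rightarrow> 'a topology \<Rightarrow> bool" where
  "class_S G \<tau> \<longleftrightarrow>
     tdlc_group G \<tau> \<and> \<not> discrete_space \<tau> \<and>
     compactly_generated G \<tau> \<and> topologically_simple G \<tau>"

definition virtually_class_S :: "('a, 'b) monoid_scheme \<Rightarrow> 'a topology \<Rightarrow> bool" where
  "virtually_class_S G \<tau> \<longleftrightarrow>
     (\<exists>H. subgroup H G \<and> closedin \<tau> H \<and> finite (rcosets\<^bsub>G\<^esub> H) \<and>
          class_S (G\<lparr>carrier := H\<rparr>) (subtopology \<tau> H))"

definition regionally_expansive :: "('a, 'b) monoid_scheme \<Rightarrow> 'a topology \<Rightarrow> bool" where
  "regionally_expansive G \<tau> \<longleftrightarrow>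
     tdlc_group G \<tau> \<and>
     (\<exists>H. subgroup H G \<and> openin \<tau> H \<and>
          compactly_generated (G\<lparr>carrier := H\<rparr>) (subtopology \<tau> H) \<and>
          (\<exists>U. subgroup U (G\<lparr>carrier := H\<rparr>) \<and>
               openin (subtopology \<tau> H) U \<and> compactin (subtopology \<tau> H) U \<and>
               (\<Inter>g \<in> H. g <#\<^bsub>G\<^esub> U #>\<^bsub>G\<^esub> inv\<^bsub>G\<^esub> g) = {\<one>\<^bsub>G\<^esub>}))"

text \<open>The intersection with the carrier only matters for the trivial group, where the family
  of non-trivial closed normal subgroups is empty; its intersection is then the whole
  (trivial) group.\<close>

definition monolith :: "('a, 'b) monoid_scheme \<Rightarrow> 'a topology \<Rightarrow> 'a set" where
  "monolith G \<tau> =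
     carrier G \<inter> \<Inter>{N. N \<lhd> G \<and> closedin \<tau> N \<and> N \<noteq> {\<one>\<^bsub>G\<^esub>}}"

definition monolithic :: "('a, 'b) monoid_scheme \<Rightarrow> 'a topology \<Rightarrow> bool" where
  "monolithic G \<tau> \<longleftrightarrow> monolith G \<tau> \<noteq> {\<one>\<^bsub>G\<^esub>}"

definition class_R :: "('a, 'b) monoid_scheme \<Rightarrow> 'a topology \<Rightarrow> bool" where
  "class_R G \<tau> \<longleftrightarrow>
     tdlc_group G \<tau> \<and> monolithic G \<tau> \<and>
     (let M = monolith G \<tau>; GM = G\<lparr>carrier := M\<rparr>; \<tau>M = subtopology \<tau> M
      in \<not> discrete_space \<tau>M \<and> regionally_expansive GM \<tau>M \<and> topologically_simple GM \<tau>M)"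


section \<open>Regular trees and colorings\<close>

text \<open>Trees have no multiple edges, so a directed edge is encoded as the pair of its endpoints:
  the initial vertex of \<open>e\<close> is \<open>fst e\<close>, its reverse is \<open>prod.swap e\<close>, and each
  undirected edge contributes two elements to \<open>E\<close>. An automorphism is determined by its
  action on vertices and acts on edges by \<open>map_prod g g\<close>.\<close>

definition tree :: "'v set \<Rightarrow> ('v \<times> 'v) set \<Rightarrow> bool" where
  "tree V E \<longleftrightarrow>
     V \<noteq> {} \<and> E \<subseteq> V \<times> V \<and> sym E \<and> irrefl E \<and>
     (\<forall>u \<in> V. \<forall>v \<in> V. (u, v) \<in> E\<^sup>*) \<and>
     \<not> (\<exists>p. length p \<ge> 3 \<and> distinct p \<and>
            successively (\<lambda>u v. (u, v) \<in> E) p \<and> (last p, hd p) \<in> E)"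

definition out_edges :: "('v \<times> 'v) set \<Rightarrow> 'v \<Rightarrow> ('v \<times> 'v) set" where
  "out_edges E v = {e \<in> E. fst e = v}"

definition regular_tree :: "nat \<Rightarrow> 'v set \<Rightarrow> ('v \<times> 'v) set \<Rightarrow> bool" where
  "regular_tree d V E \<longleftrightarrow>
     tree V E \<and> (\<forall>v \<in> V. finite (out_edges E v) \<and> card (out_edges E v) = d)"

definition coloring :: "nat \<Rightarrow> 'v set \<Rightarrow> ('v \<times> 'v) set \<Rightarrow> ('v \<times> 'v \<Rightarrow> nat) \<Rightarrow> bool" where
  "coloring d V E c \<longleftrightarrow> (\<forall>v \<in> V. bij_betw c (out_edges E v) {1..d})"

definition legal_coloring :: "nat \<Rightarrow> 'v set \<Rightarrow> ('v \<times> 'v) set \<Rightarrow> ('v \<times> 'v \<Rightarrow> nat) \<Rightarrow> bool" where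
  "legal_coloring d V E c \<longleftrightarrow> coloring d V E c \<and> (\<forall>e \<in> E. c e = c (prod.swap e))"

definition tree_aut :: "'v set \<Rightarrow> ('v \<times> 'v) set \<Rightarrow> ('v \<Rightarrow> 'v) set" where
  "tree_aut V E =
     {g. g permutes V \<and> (\<forall>u \<in> V. \<forall>v \<in> V. (g u, g v) \<in> E \<longleftrightarrow> (u, v) \<in> E)}"

definition tree_aut_group :: "'v set \<Rightarrow> ('v \<times> 'v) set \<Rightarrow> ('v \<Rightarrow> 'v) monoid" where
  "tree_aut_group V E = \<lparr>carrier = tree_aut V E, mult = (\<circ>), one = id\<rparr>"

text \<open>The permutation topology, i.e. pointwise convergence for the discrete topology on the
  vertices. Coordinates outside \<open>V\<close> are constant on \<open>tree_aut V E\<close>.\<close>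

definition tree_aut_topology :: "'v set \<Rightarrow> ('v \<times> 'v) set \<Rightarrow> ('v \<Rightarrow> 'v) topology" where
  "tree_aut_topology V E =
     subtopology (product_topology (\<lambda>_. discrete_topology UNIV) UNIV) (tree_aut V E)"


section \<open>Permutation groups of degree \<open>d\<close>\<close>

abbreviation perm_group :: "nat \<Rightarrow> (nat \<Rightarrow> nat) set \<Rightarrow> (nat \<Rightarrow> nat) monoid" where
  "perm_group d F \<equiv> (sym_group d)\<lparr>carrier := F\<rparr>"

definition point_stabilizer :: "nat \<Rightarrow> (nat \<Rightarrow> nat) set \<Rightarrow> nat \<Rightarrow> (nat \<Rightarrow> nat) set" where
  "point_stabilizer d F x = stabilizer (perm_group d F) (\<lambda>\<sigma>. \<sigma>) x"

definition acts_freely :: "nat \<Rightarrow> (nat \<Rightarrow> nat) set \<Rightarrow> bool" where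
  "acts_freely d F \<longleftrightarrow> (\<forall>x \<in> {1..d}. point_stabilizer d F x = {id})"

definition acts_transitively :: "nat \<Rightarrow> (nat \<Rightarrow> nat) set \<Rightarrow> bool" where
  "acts_transitively d F \<longleftrightarrow> (\<forall>x \<in> {1..d}. \<forall>y \<in> {1..d}. \<exists>\<sigma> \<in> F. \<sigma> x = y)"

definition generated_by_point_stabilizers :: "nat \<Rightarrow> (nat \<Rightarrow> nat) set \<Rightarrow> bool" where
  "generated_by_point_stabilizers d F \<longleftrightarrow>
     generate (sym_group d) (\<Union>x \<in> {1..d}. point_stabilizer d F x) = F"

definition orbit_preserving :: "nat \<Rightarrow> (nat \<Rightarrow> nat) set \<Rightarrow> (nat \<Rightarrow> nat) set" where
  "orbit_preserving d F =
     {\<sigma> \<in> carrier (sym_group d). \<forall>B \<in> orbits (perm_group d F) {1..d} (\<lambda>\<sigma>. \<sigma>). \<sigma> ` B = B}"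


section \<open>Burger--Mozes groups\<close>

text \<open>\<open>c\<^bsub>g(v)\<^esub> \<circ> g \<circ> c\<^bsub>v\<^esub>\<^sup>-\<^sup>1\<close>, extended by the identity outside \<open>{1..d}\<close>
  to match the carrier of \<open>sym_group d\<close>.\<close>

definition local_action ::
  "nat \<Rightarrow> ('v \<times> 'v) set \<Rightarrow> ('v \<times> 'v \<Rightarrow> nat) \<Rightarrow> ('v \<Rightarrow> 'v) \<Rightarrow> 'v \<Rightarrow> nat \<Rightarrow> nat" where
  "local_action d E c g v i =
     (if i \<in> {1..d} then c (map_prod g g (inv_into (out_edges E v) c i)) else i)"

definition BM_set ::
  "nat \<Rightarrow> 'v set \<Rightarrow> ('v \<times> 'v) set \<Rightarrow> ('v \<times> 'v \<Rightarrow> nat) \<Rightarrow> (nat \<Rightarrow> nat) set \<Rightarrow> ('v \<Rightarrow> 'v) set"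
  where
  "BM_set d V E c F = {g \<in> tree_aut V E. \<forall>v \<in> V. local_action d E c g v \<in> F}"

definition BM_topology ::
  "nat \<Rightarrow> 'v set \<Rightarrow> ('v \<times> 'v) set \<Rightarrow> ('v \<times> 'v \<Rightarrow> nat) \<Rightarrow> (nat \<Rightarrow> nat) set \<Rightarrow> ('v \<Rightarrow> 'v) topology"
  where
  "BM_topology d V E c F = subtopology (tree_aut_topology V E) (BM_set d V E c F)"

definition restricted_BM_set ::
  "nat \<Rightarrow> 'v set \<Rightarrow> ('v \<times> 'v) set \<Rightarrow> ('v \<times> 'v \<Rightarrow> nat) \<Rightarrow> (nat \<Rightarrow> nat) set \<Rightarrow> (nat \<Rightarrow> nat) set \<Rightarrow>
   ('v \<Rightarrow> 'v) set"
  where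
  "restricted_BM_set d V E c F F' =
     {g \<in> tree_aut V E. (\<forall>v \<in> V. local_action d E c g v \<in> F') \<and>
                         finite {v \<in> V. local_action d E c g v \<notin> F}}"

definition restricted_BM_group ::
  "nat \<Rightarrow> 'v set \<Rightarrow> ('v \<times> 'v) set \<Rightarrow> ('v \<times> 'v \<Rightarrow> nat) \<Rightarrow> (nat \<Rightarrow> nat) set \<Rightarrow> (nat \<Rightarrow> nat) set \<Rightarrow>
   ('v \<Rightarrow> 'v) monoid"
  where
  "restricted_BM_group d V E c F F' =
     (tree_aut_group V E)\<lparr>carrier := restricted_BM_set d V E c F F'\<rparr>"

text \<open>In general this is strictly finer than the subspace topology from \<open>tree_aut_topology\<close>.
  It is unique because an open subgroup with its subspace topology determines a group topology;
  it exists because every element of \<open>restricted_BM_set\<close> commensurates the open compact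
  subgroups of \<open>BM_set\<close>.\<close>

definition restricted_BM_topology ::
  "nat \<Rightarrow> 'v set \<Rightarrow> ('v \<times> 'v) set \<Rightarrow> ('v \<times> 'v \<Rightarrow> nat) \<Rightarrow> (nat \<Rightarrow> nat) set \<Rightarrow> (nat \<Rightarrow> nat) set \<Rightarrow>
   ('v \<Rightarrow> 'v) topology"
  where
  "restricted_BM_topology d V E c F F' =
     (THE \<tau>. tdlc_group (restricted_BM_group d V E c F F') \<tau> \<and>
             continuous_map (BM_topology d V E c F) \<tau> (\<lambda>g. g) \<and>
             open_map (BM_topology d V E c F) \<tau> (\<lambda>g. g))"

end

theory Submission
  imports Defs
begin

text \<open>
  Write \<open>U = U(F)\<close> and \<open>G = G(F, F')\<close>. A legal colouring identifies the vertices with the reduced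
  words in the colours, so automorphisms can be built outwards from one vertex by choosing local
  actions that agree along edges (\<open>extension\<close>), and they can be glued. In particular an element of \<open>G\<close>
  that fixes an edge is a product of two elements of \<open>G\<close>, each supported on one of the half-trees at
  that edge (\<open>edge_split\<close>). As \<open>F\<close> does not act freely, some element of \<open>F\<close> fixes one colour and moves
  another; performed at a suitable vertex it yields, for every half-tree, an element of \<open>U\<close> supported
  on a half-tree that maps the complement of the given half-tree into it (\<open>movers_complement_into\<close>).

  \<^bold>\<open>Simplicity.\<close> Let \<open>N\<close> be a non-trivial subgroup of \<open>G\<close> normalised by the elements of \<open>U\<close> supported on
  half-trees. An element \<open>n\<close> of \<open>N\<close> displaces some half-tree, and the commutators \<open>[[n, a], b]\<close> with \<open>a\<close>, \<open>b\<close>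
  supported there are non-trivial elements of \<open>N \<inter> U\<close>. Conjugating one of them gives elements of
  \<open>N \<inter> U\<close> that move the complement of any half-tree into it, and two of these compose to a
  translation \<open>t\<close> past any prescribed half-tree \<open>H\<close>. By Tits' argument each \<open>k\<close> in \<open>U\<close> supported on \<open>H\<close> is
  a commutator \<open>x t x\<^sup>-\<^sup>1 t\<^sup>-\<^sup>1\<close>, where \<open>x\<close> is an infinite product of conjugates of \<open>k\<close>. Such products
  exist in \<open>U\<close> but not in \<open>G\<close>, where singularities would accumulate; this is why \<open>t\<close> is sought in \<open>U\<close>.
  So \<open>N\<close> contains everything in \<open>U\<close> supported on a half-tree (\<open>movers_in_normalised_subgroup\<close>). The normal
  closure of these elements in \<open>G\<close>, called the core below, is therefore simple, open, and contained
  in every non-trivial normal subgroup: it is the monolith (\<open>core_simple\<close>, \<open>monolith_eq_core\<close>). It can be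
  smaller than the group generated by all edge stabilisers: if \<open>d > 3\<close>, \<open>F\<close> is alternating and \<open>F'\<close>
  symmetric, then the parity of the number of singularities is a homomorphism on \<open>G\<close> that vanishes on
  the core.

  \<^bold>\<open>From \<open>\<S>\<close> to \<open>\<R>\<close>.\<close> A subgroup of finite index contains a non-trivial normal subgroup of \<open>G\<close>, hence the
  core, and if it is in \<open>\<S>\<close> it equals the core. A compactly generated core is regionally expansive,
  since by simplicity the conjugates of a small compact open subgroup intersect trivially.

  \<^bold>\<open>From \<open>\<R>\<close> to the local condition.\<close> An element of \<open>G\<close> fixing an edge has all its local actions in the
  subgroup of \<open>F'\<close> generated by point stabilisers. If this subgroup is intransitive, its orbits split
  the colours into two invariant classes, and the tree maps to a line, the Cayley graph of the
  infinite dihedral group, in such a way that the core preserves the resulting height function. A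
  compactly generated subgroup of the core then stays in a bounded range of heights, and some
  element of \<open>U\<close> supported on a half-tree far away has all its conjugates close to the identity
  (\<open>core_not_regionally_expansive\<close>). A transitive subgroup containing the point stabilisers is all of \<open>F'\<close>.

  \<^bold>\<open>From the local condition to \<open>\<S>\<close>.\<close> Modulo the core, elements supported on half-trees commute, because the
  core moves half-trees apart. If \<open>F'\<close> is generated by point stabilisers, all vertex stabilisers are
  generated by such elements. If moreover \<open>F'\<close> is transitive, \<open>G\<close> is generated by an edge inversion and the
  compact group of elements fixing a vertex \<open>v\<close> without singularities elsewhere, whose image modulo
  the core is finite. Hence the core has finite index (\<open>core_finite_index\<close>) and is compactly generated.

  In the topology of \<open>G\<close> the fixators in \<open>U\<close> of finite sets of vertices form a neighbourhood basis of the
  identity. This defines a group topology because every element of \<open>G\<close> has only finitely many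
  singularities (\<open>conjugate_fixator\<close>), and an open subgroup with its topology leaves no other choice
  (\<open>group_topology_unique\<close>).
\<close>

section \<open>Topological groups\<close>

lemma topological_groupD:
  assumes "topological_group G \<tau>"
  shows "group G" "topspace \<tau> = carrier G"
    "continuous_map (prod_topology \<tau> \<tau>) \<tau> (\<lambda>(x, y). x \<otimes>\<^bsub>G\<^esub> y)"
    "continuous_map \<tau> \<tau> (\<lambda>x. inv\<^bsub>G\<^esub> x)"
  using assms by (auto simp: topological_group_def)

lemma continuous_left_translation:
  assumes "topological_group G \<tau>" "a \<in> carrier G"
  shows "continuous_map \<tau> \<tau> (\<lambda>x. a \<otimes>\<^bsub>G\<^esub> x)"
proof -
  have "continuous_map \<tau> (prod_topology \<tau> \<tau>) (\<lambda>x. (a, x))"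
    using assms topological_groupD(2)[OF assms(1)] by (intro continuous_map_pairedI) auto
  from continuous_map_compose[OF this topological_groupD(3)[OF assms(1)]] show ?thesis by (simp add: o_def)
qed

lemma continuous_right_translation:
  assumes "topological_group G \<tau>" "a \<in> carrier G"
  shows "continuous_map \<tau> \<tau> (\<lambda>x. x \<otimes>\<^bsub>G\<^esub> a)"
proof -
  have "continuous_map \<tau> (prod_topology \<tau> \<tau>) (\<lambda>x. (x, a))"
    using assms topological_groupD(2)[OF assms(1)] by (intro continuous_map_pairedI) auto
  from continuous_map_compose[OF this topological_groupD(3)[OF assms(1)]] show ?thesis by (simp add: o_def)
qed

lemma open_left_preimage:
  assumes "topological_group G \<tau>" "a \<in> carrier G" "openin \<tau> W"
  shows "openin \<tau> {x \<in> carrier G. a \<otimes>\<^bsub>G\<^esub> x \<in> W}"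
  using openin_continuous_map_preimage[OF continuous_left_translation[OF assms(1,2)] assms(3)]
  by (simp add: topological_groupD(2)[OF assms(1)])

text \<open>A group topology is determined by the neighbourhoods of the identity, hence by any open
  neighbourhood of the identity with its subspace topology.\<close>

lemma open_transfer:
  assumes G: "topological_group G \<tau>" "topological_group G \<tau>'"
    and X: "continuous_map X \<tau> (\<lambda>x. x)" "open_map X \<tau>' (\<lambda>x. x)" "\<one>\<^bsub>G\<^esub> \<in> topspace X"
    and W: "openin \<tau> W"
  shows "openin \<tau>' W"
proof (subst openin_subopen, intro ballI)
  interpret group G using G(1) by (rule topological_groupD)
  fix g assume g: "g \<in> W"
  then have gG: "g \<in> carrier G" using W openin_subset topological_groupD(2)[OF G(1)] by blast
  define P where "P = {x \<in> topspace X. x \<in> {x \<in> carrier G. g \<otimes>\<^bsub>G\<^esub> x \<in> W}}"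
  have "openin X P"
    using openin_continuous_map_preimage[OF X(1) open_left_preimage[OF G(1) gG W]] by (simp add: P_def)
  then have P: "openin \<tau>' P" using X(2) by (simp add: open_map_def)
  define Q where "Q = {x \<in> carrier G. inv\<^bsub>G\<^esub> g \<otimes>\<^bsub>G\<^esub> x \<in> P}"
  have "openin \<tau>' Q" unfolding Q_def using open_left_preimage[OF G(2) _ P] gG by simp
  moreover have "g \<in> Q" using X(3) g gG by (simp add: Q_def P_def)
  moreover have "Q \<subseteq> W"
  proof
    fix x assume x: "x \<in> Q"
    then have "g \<otimes>\<^bsub>G\<^esub> (inv\<^bsub>G\<^esub> g \<otimes>\<^bsub>G\<^esub> x) \<in> W" "x \<in> carrier G" by (auto simp: Q_def P_def)
    then show "x \<in> W" using gG by (simp add: m_assoc[symmetric])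
  qed
  ultimately show "\<exists>T. openin \<tau>' T \<and> g \<in> T \<and> T \<subseteq> W" by blast
qed

lemma group_topology_unique:
  assumes "topological_group G \<tau>" "continuous_map X \<tau> (\<lambda>x. x)" "open_map X \<tau> (\<lambda>x. x)"
    and "topological_group G \<tau>'" "continuous_map X \<tau>' (\<lambda>x. x)" "open_map X \<tau>' (\<lambda>x. x)"
    and "\<one>\<^bsub>G\<^esub> \<in> topspace X"
  shows "\<tau> = \<tau>'"
  unfolding topology_eq using open_transfer assms by metis

lemma totally_disconnected_subtopology:
  assumes "totally_disconnected_space \<tau>"
  shows "totally_disconnected_space (subtopology \<tau> S)"
  unfolding totally_disconnected_space_def
proof
  fix x assume x: "x \<in> topspace (subtopology \<tau> S)"
  have "connected_component_of_set (subtopology \<tau> S) x \<subseteq> connected_component_of_set \<tau> x"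
    by (auto simp: connected_component_of_def connectedin_subtopology)
  also have "\<dots> = {x}" using assms x by (simp add: totally_disconnected_space_def)
  finally show "connected_component_of_set (subtopology \<tau> S) x = {x}"
    using x connected_component_of_refl[of "subtopology \<tau> S" x] by blast
qed

lemma tdlc_closed_subgroup:
  assumes G: "tdlc_group G \<tau>" and H: "subgroup H G" "closedin \<tau> H"
  shows "tdlc_group (G\<lparr>carrier := H\<rparr>) (subtopology \<tau> H)"
proof -
  have top: "topological_group G \<tau>" using G by (simp add: tdlc_group_def)
  interpret group G using top by (rule topological_groupD)
  interpret H: subgroup H G by fact
  have sp: "topspace (subtopology \<tau> H) = H"
    using topological_groupD(2)[OF top] H.subset by auto
  have "continuous_map (prod_topology (subtopology \<tau> H) (subtopology \<tau> H)) \<tau> (\<lambda>(x, y). x \<otimes>\<^bsub>G\<^esub> y)"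
    unfolding subtopology_Times[symmetric]
    using topological_groupD(3)[OF top] by (rule continuous_map_from_subtopology)
  then have mult: "continuous_map (prod_topology (subtopology \<tau> H) (subtopology \<tau> H)) (subtopology \<tau> H) (\<lambda>(x, y). x \<otimes>\<^bsub>G\<^esub> y)"
    by (rule continuous_map_into_subtopology) (auto simp: sp)
  have "continuous_map (subtopology \<tau> H) \<tau> (\<lambda>x. inv\<^bsub>G\<^esub> x)"
    using topological_groupD(4)[OF top] by (rule continuous_map_from_subtopology)
  then have "continuous_map (subtopology \<tau> H) (subtopology \<tau> H) (\<lambda>x. inv\<^bsub>G\<^esub> x)"
    by (rule continuous_map_into_subtopology) (auto simp: sp)
  then have "continuous_map (subtopology \<tau> H) (subtopology \<tau> H) (\<lambda>x. inv\<^bsub>G\<lparr>carrier := H\<rparr>\<^esub> x)"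
    by (rule continuous_map_eq) (auto simp: sp H(1))
  then have "topological_group (G\<lparr>carrier := H\<rparr>) (subtopology \<tau> H)"
    using mult sp H.subgroup_is_group[OF is_group] by (simp add: topological_group_def)
  then show ?thesis
    using G H(2) by (simp add: tdlc_group_def Hausdorff_space_subtopology locally_compact_space_closed_subset
        totally_disconnected_subtopology)
qed

section \<open>Compact generation passes to finite index subgroups\<close>

lemma (in group) generate_subset_of_right_invariant:
  assumes W: "W \<subseteq> carrier G" "\<one> \<in> W" and K: "K \<subseteq> carrier G"
    and inv: "\<And>w k. w \<in> W \<Longrightarrow> k \<in> K \<Longrightarrow> w \<otimes> k \<in> W" "\<And>w k. w \<in> W \<Longrightarrow> k \<in> K \<Longrightarrow> w \<otimes> inv k \<in> W"
  shows "generate G K \<subseteq> W"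
proof
  fix g assume g: "g \<in> generate G K"
  have "\<forall>w \<in> W. w \<otimes> g \<in> W"
    using g
  proof (induction g rule: generate.induct)
    case one
    then show ?case using W by (auto simp: subsetD)
  next
    case (incl h)
    then show ?case using inv(1) by blast
  next
    case (inv h)
    then show ?case using assms(5) by blast
  next
    case (eng h1 h2)
    show ?case
    proof
      fix w assume w: "w \<in> W"
      have "h1 \<in> carrier G" "h2 \<in> carrier G" using eng(1,2) generate_in_carrier[OF K] by blast+
      then have "w \<otimes> (h1 \<otimes> h2) = (w \<otimes> h1) \<otimes> h2" using w W by (simp add: m_assoc subsetD)
      then show "w \<otimes> (h1 \<otimes> h2) \<in> W" using eng(3,4) w by simp
    qed
  qed
  then have "\<one> \<otimes> g \<in> W" using W by blast
  then show "g \<in> W" using generate_in_carrier[OF K g] by simp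
qed

text \<open>Schreier's argument: if every element is \<open>h t\<close> with \<open>h\<close> in the subgroup and \<open>t\<close> in a finite set \<open>T\<close>,
  the subgroup is generated by its elements in \<open>T\<close> and in \<open>T K T\<^sup>-\<^sup>1\<close>.\<close>

lemma compactly_generated_finite_index:
  assumes top: "topological_group G \<tau>" and cg: "compactly_generated G \<tau>"
    and H: "subgroup H G" "closedin \<tau> H" "finite (rcosets\<^bsub>G\<^esub> H)"
  shows "compactly_generated (G\<lparr>carrier := H\<rparr>) (subtopology \<tau> H)"
proof -
  interpret group G using top by (rule topological_groupD)
  interpret H: subgroup H G by fact
  have sp: "topspace \<tau> = carrier G" by (rule topological_groupD(2)[OF top])
  obtain K0 where K0: "compactin \<tau> K0" "generate G K0 = carrier G" using cg by (auto simp: compactly_generated_def)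
  define K where "K = K0 \<union> (\<lambda>x. inv\<^bsub>G\<^esub> x) ` K0"
  have K0c: "K0 \<subseteq> carrier G" using compactin_subset_topspace[OF K0(1)] sp by simp
  then have Kc: "K \<subseteq> carrier G" by (auto simp: K_def)
  have Kcomp: "compactin \<tau> K"
    unfolding K_def by (intro compactin_Un K0(1) image_compactin[OF K0(1) topological_groupD(4)[OF top]])
  define rep where "rep R = (SOME x. x \<in> R)" for R :: "'a set"
  define T where "T = insert \<one>\<^bsub>G\<^esub> (rep ` (rcosets\<^bsub>G\<^esub> H))"
  have finT: "finite T" using H(3) by (simp add: T_def)
  have rep: "\<exists>h \<in> H. \<exists>t \<in> T. g = h \<otimes>\<^bsub>G\<^esub> t" if g: "g \<in> carrier G" for g
  proof -
    have "g \<in> H #>\<^bsub>G\<^esub> g" by (rule rcos_self[OF g H(1)])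
    then have "rep (H #>\<^bsub>G\<^esub> g) \<in> H #>\<^bsub>G\<^esub> g" unfolding rep_def by (rule someI)
    then obtain h where h: "h \<in> H" "rep (H #>\<^bsub>G\<^esub> g) = h \<otimes>\<^bsub>G\<^esub> g" by (auto simp: r_coset_def)
    have "rep (H #>\<^bsub>G\<^esub> g) \<in> T" using rcosetsI[OF H.subset g] by (simp add: T_def)
    moreover have "g = inv\<^bsub>G\<^esub> h \<otimes>\<^bsub>G\<^esub> rep (H #>\<^bsub>G\<^esub> g)" using h g H.subset by (simp add: m_assoc[symmetric])
    ultimately show ?thesis using h(1) by (intro bexI[of _ "inv\<^bsub>G\<^esub> h"] bexI[of _ "rep (H #>\<^bsub>G\<^esub> g)"]) auto
  qed
  have Tc: "t \<in> carrier G" if t: "t \<in> T" for t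
  proof (cases "t = \<one>\<^bsub>G\<^esub>")
    case False
    then obtain g where g: "g \<in> carrier G" "t = rep (H #>\<^bsub>G\<^esub> g)" using t by (auto simp: T_def RCOSETS_def)
    have "g \<in> H #>\<^bsub>G\<^esub> g" by (rule rcos_self[OF g(1) H(1)])
    then have "t \<in> H #>\<^bsub>G\<^esub> g" unfolding g(2) rep_def by (rule someI)
    then show ?thesis using g H.subset by (auto simp: r_coset_def)
  qed simp
  define f where "f t t' x = (t \<otimes>\<^bsub>G\<^esub> x) \<otimes>\<^bsub>G\<^esub> inv\<^bsub>G\<^esub> t'" for t t' x
  have f_cont: "continuous_map \<tau> \<tau> (f t t')" if "t \<in> T" "t' \<in> T" for t t'
  proof -
    have "continuous_map \<tau> \<tau> ((\<lambda>x. x \<otimes>\<^bsub>G\<^esub> inv\<^bsub>G\<^esub> t') \<circ> (\<lambda>x. t \<otimes>\<^bsub>G\<^esub> x))"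
      by (rule continuous_map_compose[OF continuous_left_translation[OF top] continuous_right_translation[OF top]])
        (simp_all add: Tc that)
    moreover have "f t t' = (\<lambda>x. x \<otimes>\<^bsub>G\<^esub> inv\<^bsub>G\<^esub> t') \<circ> (\<lambda>x. t \<otimes>\<^bsub>G\<^esub> x)" by (simp add: f_def fun_eq_iff)
    ultimately show ?thesis by simp
  qed
  \<comment> \<open>The representatives themselves are included for the last factor that remains after all
      generators have been rewritten.\<close>
  define M where "M = (\<Union>p \<in> T \<times> T. f (fst p) (snd p) ` K) \<union> T"
  have "compactin \<tau> (\<Union>p \<in> T \<times> T. f (fst p) (snd p) ` K)"
    by (rule compactin_Union) (use finT image_compactin[OF Kcomp f_cont] in auto)
  moreover have "compactin \<tau> T" using finT Tc sp by (intro finite_imp_compactin) auto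
  ultimately have "compactin \<tau> M" unfolding M_def by (rule compactin_Un)
  then have S: "compactin \<tau> (H \<inter> M)" using closed_Int_compactin[OF H(2)] by blast
  define S where "S = H \<inter> M"
  have SH: "S \<subseteq> H" by (simp add: S_def)
  have gen_sub: "subgroup (generate G S) G" by (rule generate_is_subgroup) (use SH H.subset in blast)
  have gen_H: "generate G S \<subseteq> H" by (rule generate_subgroup_incl[OF SH H(1)])
  define W where "W = {h \<otimes>\<^bsub>G\<^esub> t | h t. h \<in> generate G S \<and> t \<in> T}"
  have move: "w \<otimes>\<^bsub>G\<^esub> k \<in> W" if w: "w \<in> W" and k: "k \<in> K" for w k
  proof -
    obtain h t where ht: "w = h \<otimes>\<^bsub>G\<^esub> t" "h \<in> generate G S" "t \<in> T" using w by (auto simp: W_def)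
    have c: "h \<in> carrier G" "t \<in> carrier G" "k \<in> carrier G" using ht Tc k Kc gen_H H.subset by auto
    obtain h' t' where h': "h' \<in> H" "t' \<in> T" "t \<otimes>\<^bsub>G\<^esub> k = h' \<otimes>\<^bsub>G\<^esub> t'" using rep[of "t \<otimes>\<^bsub>G\<^esub> k"] c by auto
    have c': "h' \<in> carrier G" "t' \<in> carrier G" using h' Tc H.subset by auto
    have "f t t' k = h'" using h' c c' by (simp add: f_def m_assoc)
    then have "h' \<in> M" using ht(3) h'(2) k by (auto simp: M_def)
    then have "h' \<in> generate G S" using h'(1) generate.incl[of h' S G] by (simp add: S_def)
    then have "h \<otimes>\<^bsub>G\<^esub> h' \<in> generate G S" using ht(2) generate.eng by metis
    moreover have "w \<otimes>\<^bsub>G\<^esub> k = (h \<otimes>\<^bsub>G\<^esub> h') \<otimes>\<^bsub>G\<^esub> t'" using ht(1) h'(3) c c' by (simp add: m_assoc)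
    ultimately show ?thesis using h'(2) by (auto simp: W_def)
  qed
  have "generate G K0 \<subseteq> W"
  proof (rule generate_subset_of_right_invariant)
    show "W \<subseteq> carrier G" using gen_H H.subset Tc by (auto simp: W_def)
    show "\<one>\<^bsub>G\<^esub> \<in> W"
      unfolding W_def T_def using generate.one[of G S]
      by (intro CollectI exI[of _ "\<one>\<^bsub>G\<^esub>"]) simp
    show "w \<otimes>\<^bsub>G\<^esub> k \<in> W" if "w \<in> W" "k \<in> K0" for w k using move that by (simp add: K_def)
    show "w \<otimes>\<^bsub>G\<^esub> inv\<^bsub>G\<^esub> k \<in> W" if "w \<in> W" "k \<in> K0" for w k using move that by (simp add: K_def)
  qed (rule K0c)
  have "H \<subseteq> generate G S"
  proof
    fix g assume g: "g \<in> H"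
    then have "g \<in> generate G K0" using K0(2) H.subset by blast
    then have "g \<in> W" using \<open>generate G K0 \<subseteq> W\<close> by blast
    then obtain h t where ht: "g = h \<otimes>\<^bsub>G\<^esub> t" "h \<in> generate G S" "t \<in> T" by (auto simp: W_def)
    have hH: "h \<in> H" using ht gen_H by blast
    have "t = inv\<^bsub>G\<^esub> h \<otimes>\<^bsub>G\<^esub> g" using ht(1) hH H.subset Tc[OF ht(3)] by (simp add: m_assoc[symmetric] subsetD)
    then have "t \<in> H" using hH g by simp
    then have "t \<in> generate G S" using ht(3) generate.incl[of t S G] by (simp add: S_def M_def)
    then show "g \<in> generate G S" using ht generate.eng by metis
  qed
  then have "generate (G\<lparr>carrier := H\<rparr>) S = H" using generate_consistent[OF SH H(1)] gen_H by auto
  moreover have "compactin (subtopology \<tau> H) S" using S by (simp add: compactin_subtopology S_def)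
  ultimately show ?thesis by (auto simp: compactly_generated_def)
qed

section \<open>Legally coloured trees as groups of reduced words\<close>

locale coloured_tree =
  fixes d :: nat and V :: "'v set" and E :: "('v \<times> 'v) set" and c :: "'v \<times> 'v \<Rightarrow> nat"
  assumes d_gt_2: "d > 2"
    and regular: "regular_tree d V E"
    and legal: "legal_coloring d V E c"
begin

definition colours :: "nat set" where
  "colours = {1..d}"

text \<open>The neighbour of \<open>v\<close> across the edge of colour \<open>i\<close>.\<close>

definition nb :: "'v \<Rightarrow> nat \<Rightarrow> 'v" where
  "nb v i = snd (inv_into (out_edges E v) c i)"

text \<open>By legality \<open>\<lambda>v. nb v i\<close> is an involution on \<open>V\<close> for each colour \<open>i\<close>, so colour sequences act on the vertices
  through the free product of \<open>d\<close> groups of order two. In a tree this action is simply transitive, and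
  reduced words serve as coordinates.\<close>

definition reduced :: "nat list \<Rightarrow> bool" where
  "reduced w \<longleftrightarrow> set w \<subseteq> colours \<and> distinct_adj w"

abbreviation walk :: "'v \<Rightarrow> nat list \<Rightarrow> 'v" where
  "walk \<equiv> foldl nb"

lemma tree: "tree V E"
  using regular by (simp add: regular_tree_def)

lemma vertices_nonempty: "V \<noteq> {}"
  using tree by (simp add: tree_def)

lemma colour_bij: "v \<in> V \<Longrightarrow> bij_betw c (out_edges E v) colours"
  using legal by (simp add: legal_coloring_def coloring_def colours_def)

lemma finite_colours [simp]: "finite colours" and card_colours: "card colours = d"
  by (simp_all add: colours_def)

lemma another_colour:
  assumes "card A \<le> 2" "finite A"
  obtains k where "k \<in> colours" "k \<notin> A"
proof -
  have "\<not> colours \<subseteq> A"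
    using card_mono[OF assms(2), of colours] assms(1) card_colours d_gt_2 by linarith
  then show ?thesis using that by blast
qed

lemma third_colour:
  obtains k where "k \<in> colours" "k \<noteq> i" "k \<noteq> j"
  using another_colour[of "{i, j}"] card_insert_le_m1[of 2 "{j}" i] by (auto simp: card_insert_if)

lemma
  assumes "v \<in> V" "i \<in> colours"
  shows nb_in_V [simp]: "nb v i \<in> V"
    and nb_edge: "(v, nb v i) \<in> E"
    and colour_nb: "c (v, nb v i) = i"
    and inv_into_colour: "inv_into (out_edges E v) c i = (v, nb v i)"
proof -
  let ?e = "inv_into (out_edges E v) c i"
  have img: "c ` out_edges E v = colours" using colour_bij[OF assms(1)] by (simp add: bij_betw_def)
  have e: "?e \<in> out_edges E v" "c ?e = i"
    using inv_into_into[of i c "out_edges E v"] f_inv_into_f[of i c "out_edges E v"] img assms(2) by auto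
  show eq: "?e = (v, nb v i)" using e(1) by (auto simp: out_edges_def nb_def prod_eq_iff)
  show "(v, nb v i) \<in> E" using e(1) eq by (auto simp: out_edges_def)
  then show "nb v i \<in> V" using tree by (auto simp: tree_def)
  show "c (v, nb v i) = i" using e(2) eq by simp
qed

lemma
  assumes "(v, w) \<in> E"
  shows edge_in_V: "v \<in> V" "w \<in> V" and colour_in: "c (v, w) \<in> colours" and nb_colour: "nb v (c (v, w)) = w"
proof -
  show v: "v \<in> V" and "w \<in> V" using assms tree by (auto simp: tree_def)
  have e: "(v, w) \<in> out_edges E v" using assms by (simp add: out_edges_def)
  show "c (v, w) \<in> colours" using colour_bij[OF v] e by (auto simp: bij_betw_def)
  show "nb v (c (v, w)) = w"
    using inv_into_f_f[of c "out_edges E v" "(v, w)"] colour_bij[OF v] e by (simp add: bij_betw_def nb_def)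
qed

lemma nb_inj:
  assumes "v \<in> V" "i \<in> colours" "j \<in> colours" "nb v i = nb v j"
  shows "i = j"
  using colour_nb assms by metis

lemma nb_nb [simp]:
  assumes "v \<in> V" "i \<in> colours"
  shows "nb (nb v i) i = v"
proof -
  have E: "(v, nb v i) \<in> E" using nb_edge assms by blast
  have E': "(nb v i, v) \<in> E" using E tree by (auto simp: tree_def dest: symD)
  have "c (v, nb v i) = c (nb v i, v)" using legal E by (auto simp: legal_coloring_def)
  then show ?thesis using nb_colour[OF E'] colour_nb[OF assms] by simp
qed

lemma nb_neq: "v \<in> V \<Longrightarrow> i \<in> colours \<Longrightarrow> nb v i \<noteq> v"
  using nb_edge tree by (metis tree_def irrefl_def)

lemma walk_in_V: "v \<in> V \<Longrightarrow> set w \<subseteq> colours \<Longrightarrow> walk v w \<in> V"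
  by (induction w arbitrary: v) auto

lemma walk_rev: "v \<in> V \<Longrightarrow> set w \<subseteq> colours \<Longrightarrow> walk (walk v w) (rev w) = v"
  by (induction w arbitrary: v) auto

text \<open>Connectedness of the tree as an induction principle.\<close>

lemma vertex_induct [consumes 2, case_names base step]:
  assumes "u \<in> V" "v \<in> V" "P v" and step: "\<And>x i. x \<in> V \<Longrightarrow> i \<in> colours \<Longrightarrow> P x \<Longrightarrow> P (nb x i)"
  shows "P u"
proof -
  have "(v, u) \<in> E\<^sup>*" using tree assms by (simp add: tree_def)
  then have "u \<in> V \<and> P u"
  proof (induction rule: rtrancl_induct)
    case (step y z)
    have "nb y (c (y, z)) = z" "c (y, z) \<in> colours" using step nb_colour colour_in by auto
    then show ?case using step assms(4)[of y "c (y, z)"] nb_in_V by metis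
  qed (use assms in auto)
  then show ?thesis by simp
qed

text \<open>A shortest closed reduced walk would visit distinct vertices, hence be a cycle.\<close>

lemma reduced_closed_walk_trivial:
  assumes "v \<in> V" "reduced w" "walk v w = v"
  shows "w = []"
  using assms
proof (induction "length w" arbitrary: v w rule: less_induct)
  case less
  show ?case
  proof (rule ccontr)
    assume ne: "w \<noteq> []"
    define n where "n = length w"
    define x where "x k = walk v (take k w)" for k
    have wc: "set w \<subseteq> colours" and da: "distinct_adj w" using less.prems by (auto simp: reduced_def)
    have xV: "x k \<in> V" for k
      unfolding x_def using less.prems(1) wc by (intro walk_in_V) (auto dest: in_set_takeD)
    have xS: "x (Suc k) = nb (x k) (w ! k)" if "k < n" for k
      using that by (simp add: x_def n_def take_Suc_conv_app_nth)
    have wk: "w ! k \<in> colours" if "k < n" for k using that wc by (auto simp: n_def)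
    have inj: "x a \<noteq> x b" if "a < b" "b < n" for a b
    proof
      assume eq: "x a = x b"
      let ?u = "drop a (take b w)"
      have "take b w = take a w @ ?u" using that by (metis append_take_drop_id less_imp_le_nat min.absorb1 take_take)
      then have "walk (x a) ?u = x a" using eq by (metis foldl_append x_def)
      moreover have "reduced ?u"
      proof -
        have "w = take a w @ ?u @ drop b w"
          using \<open>take b w = take a w @ ?u\<close> by (metis append.assoc append_take_drop_id)
        then have "distinct_adj ?u" using da by (metis distinct_adj_append_iff)
        moreover have "set ?u \<subseteq> colours" using wc by (meson dual_order.trans set_drop_subset set_take_subset)
        ultimately show ?thesis by (simp add: reduced_def)
      qed
      moreover have "length ?u < length w" "?u \<noteq> []" using that by (auto simp: n_def)
      ultimately show False using less.hyps xV by blast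
    qed
    have n1: "n \<noteq> 1"
    proof
      assume "n = 1"
      then obtain i where "w = [i]" by (auto simp: n_def length_Suc_conv)
      then show False using less.prems wc nb_neq by auto
    qed
    have n2: "n \<noteq> 2"
    proof
      assume "n = 2"
      then obtain i j where w: "w = [i, j]" by (auto simp: n_def length_Suc_conv numeral_2_eq_2)
      have "nb (nb v i) j = nb (nb v i) i" using less.prems wc w by auto
      then show False using nb_inj[of "nb v i" j i] w wc less.prems(1) da by auto
    qed
    have n3: "n \<ge> 3" using n1 n2 ne by (cases n; cases "n - 1"; auto simp: n_def)
    define p where "p = map x [0..<n]"
    have "distinct p"
      unfolding p_def distinct_map using inj by (auto simp: inj_on_def) (metis linorder_neqE_nat)
    moreover have "successively (\<lambda>u v. (u, v) \<in> E) p"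
      unfolding p_def successively_conv_nth using nb_edge[OF xV wk] xS by auto
    moreover have "(last p, hd p) \<in> E"
    proof -
      have "last p = x (n - 1)" "hd p = x 0" using n3 by (auto simp: p_def last_map hd_map)
      moreover have "x n = v" using less.prems by (simp add: x_def n_def)
      moreover have "x n = nb (x (n - 1)) (w ! (n - 1))" using xS[of "n - 1"] n3 by simp
      moreover have "x 0 = v" by (simp add: x_def)
      ultimately show ?thesis using nb_edge[OF xV wk, of "n - 1" "n - 1"] n3 by simp
    qed
    moreover have "length p \<ge> 3" using n3 by (simp add: p_def)
    ultimately show False using tree by (auto simp: tree_def)
  qed
qed

lemma reduced_Cons: "reduced (i # w) \<longleftrightarrow> i \<in> colours \<and> reduced w \<and> (w = [] \<or> hd w \<noteq> i)"
  by (cases w) (auto simp: reduced_def)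

lemma reduced_snoc: "reduced (w @ [i]) \<longleftrightarrow> i \<in> colours \<and> reduced w \<and> (w = [] \<or> last w \<noteq> i)"
  by (auto simp: reduced_def distinct_adj_append_iff)

lemma reduced_Nil [simp]: "reduced []"
  by (simp add: reduced_def)

lemma reduced_colours: "reduced w \<Longrightarrow> set w \<subseteq> colours"
  by (simp add: reduced_def)

lemma reduced_walk_unique:
  assumes "v \<in> V" "reduced w" "reduced w'" "walk v w = walk v w'"
  shows "w = w'"
  using assms
proof (induction w arbitrary: v w')
  case Nil
  then show ?case using reduced_closed_walk_trivial[of v w'] by simp
next
  case (Cons i w)
  show ?case
  proof (cases "\<exists>w''. w' = i # w''")
    case True
    then obtain w'' where w': "w' = i # w''" by blast
    have "w = w''"
      using Cons.IH[of "nb v i" w''] Cons.prems w' by (simp add: reduced_Cons)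
    then show ?thesis using w' by simp
  next
    case False
    \<comment> \<open>The two walks leave \<open>v\<close> along different edges, so they concatenate to a reduced
        closed walk.\<close>
    let ?z = "rev w' @ (i # w)"
    have "reduced ?z"
    proof (cases w')
      case (Cons j w'')
      then have "j \<noteq> i" using False by auto
      then show ?thesis
        using \<open>reduced (i # w)\<close> \<open>reduced w'\<close> Cons
        by (cases w'') (auto simp: reduced_def distinct_adj_append_iff distinct_adj_Cons last_rev)
    qed (use Cons.prems in simp)
    moreover have "walk (walk v w') ?z = walk v w'"
      using Cons.prems walk_rev[of v w'] by (simp add: reduced_def)
    ultimately show ?thesis
      using reduced_closed_walk_trivial[of "walk v w'" ?z] walk_in_V Cons.prems by (simp add: reduced_def)
  qed
qed

lemma reduced_walk_exists:
  assumes "v \<in> V" "u \<in> V"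
  obtains w where "reduced w" "walk v w = u"
proof -
  have "\<exists>w. reduced w \<and> walk v w = u"
    using assms(2) assms(1)
  proof (induction u rule: vertex_induct)
    case base
    show ?case by (rule exI[of _ "[]"]) simp
  next
    case (step x i)
    then obtain w where w: "reduced w" "walk v w = x" by blast
    show ?case
    proof (cases "w \<noteq> [] \<and> last w = i")
      case True
      then obtain w0 where w0: "w = w0 @ [i]" by (metis append_butlast_last_id)
      have "reduced w0" using w w0 by (simp add: reduced_snoc)
      moreover have "walk v w0 = nb x i"
        using w w0 walk_in_V[of v w0] assms(1) by (auto simp: reduced_snoc reduced_def)
      ultimately show ?thesis by blast
    next
      case False
      then show ?thesis using w step by (intro exI[of _ "w @ [i]"]) (auto simp: reduced_snoc)
    qed
  qed
  then show ?thesis using that by blast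
qed

definition word :: "'v \<Rightarrow> 'v \<Rightarrow> nat list" where
  "word v u = (THE w. reduced w \<and> walk v w = u)"

lemma
  assumes "v \<in> V" "u \<in> V"
  shows reduced_word: "reduced (word v u)" and walk_word [simp]: "walk v (word v u) = u"
proof -
  obtain w where "reduced w" "walk v w = u" using reduced_walk_exists assms by blast
  then have "\<exists>!w. reduced w \<and> walk v w = u" using reduced_walk_unique assms(1) by blast
  from theI'[OF this] show "reduced (word v u)" "walk v (word v u) = u" by (auto simp: word_def)
qed

lemma word_walk: "v \<in> V \<Longrightarrow> reduced w \<Longrightarrow> word v (walk v w) = w"
  using reduced_walk_unique reduced_word walk_word walk_in_V reduced_colours by metis

lemma word_self [simp]: "v \<in> V \<Longrightarrow> word v v = []"
  using word_walk[of v "[]"] by simp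

text \<open>Functions on the vertices can be defined by recursion on reduced words: every edge appends one
  letter in one of its two directions.\<close>

lemma word_nb:
  assumes "v \<in> V" "u \<in> V" "i \<in> colours"
  shows "word v (nb u i) = word v u @ [i] \<or> word v u = word v (nb u i) @ [i]"
proof (cases "word v u \<noteq> [] \<and> last (word v u) = i")
  case True
  then obtain w where w: "word v u = w @ [i]" by (metis append_butlast_last_id)
  have r: "reduced w" using reduced_word[OF assms(1,2)] w by (simp add: reduced_snoc)
  have "u = nb (walk v w) i" using walk_word[OF assms(1,2)] w by simp
  then have "walk v w = nb u i" using walk_in_V[of v w] r assms by (auto simp: reduced_def)
  then show ?thesis using word_walk[OF assms(1) r] w by simp
next
  case False
  then have "reduced (word v u @ [i])" using reduced_word assms by (auto simp: reduced_snoc)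
  from word_walk[OF assms(1) this] show ?thesis using assms by simp
qed

lemma word_nb_start:
  assumes "v \<in> V" "u \<in> V" "i \<in> colours"
  shows "word (nb v i) u = (if word v u \<noteq> [] \<and> hd (word v u) = i then tl (word v u) else i # word v u)"
proof (cases "word v u \<noteq> [] \<and> hd (word v u) = i")
  case True
  then obtain w where w: "word v u = i # w" by (metis list.collapse)
  have "walk (nb v i) w = u" using walk_word[OF assms(1,2)] w by simp
  moreover have "reduced w" using reduced_word[OF assms(1,2)] w by (simp add: reduced_Cons)
  ultimately have "word (nb v i) u = w" using word_walk[of "nb v i" w] assms by auto
  then show ?thesis using w by simp
next
  case False
  then have "reduced (i # word v u)" using reduced_word assms by (auto simp: reduced_Cons)
  moreover have "walk (nb v i) (i # word v u) = u" using assms by simp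
  ultimately have "word (nb v i) u = i # word v u" using word_walk[of "nb v i" "i # word v u"] assms by auto
  then show ?thesis using False by auto
qed

subsection \<open>Half-trees\<close>

text \<open>The component of \<open>nb v i\<close> after removal of its edge to \<open>v\<close>.\<close>

definition half :: "'v \<Rightarrow> nat \<Rightarrow> 'v set" where
  "half v i = {u \<in> V. word v u \<noteq> [] \<and> hd (word v u) = i}"

lemma half_subset: "half v i \<subseteq> V"
  by (auto simp: half_def)

lemma base_notin_half [simp]: "v \<in> V \<Longrightarrow> v \<notin> half v i"
  by (simp add: half_def)

lemma nb_in_half [simp]: "v \<in> V \<Longrightarrow> i \<in> colours \<Longrightarrow> nb v i \<in> half v i"
  using word_walk[of v "[i]"] by (simp add: half_def reduced_Cons)

lemma half_disjoint: "i \<noteq> j \<Longrightarrow> half v i \<inter> half v j = {}"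
  by (auto simp: half_def)

lemma halves_cover:
  assumes "v \<in> V" "u \<in> V" "u \<noteq> v"
  obtains i where "i \<in> colours" "u \<in> half v i"
proof -
  have "word v u \<noteq> []"
  proof
    assume "word v u = []"
    then show False using assms walk_word[OF assms(1,2)] by simp
  qed
  moreover have "hd (word v u) \<in> colours"
    using calculation reduced_word[OF assms(1,2)] by (auto simp: reduced_def)
  ultimately show ?thesis using that assms by (simp add: half_def)
qed

lemma half_complement:
  assumes "v \<in> V" "i \<in> colours"
  shows "half (nb v i) i = V - half v i"
proof -
  have "(word (nb v i) u \<noteq> [] \<and> hd (word (nb v i) u) = i) \<longleftrightarrow> \<not> (word v u \<noteq> [] \<and> hd (word v u) = i)"
    if u: "u \<in> V" for u
  proof (cases "word v u \<noteq> [] \<and> hd (word v u) = i")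
    case True
    then obtain w where w: "word v u = i # w" by (metis list.collapse)
    then have "reduced (i # w)" using reduced_word[OF assms(1) u] by simp
    then show ?thesis using w word_nb_start[OF assms(1) u assms(2)] by (auto simp: reduced_Cons)
  next
    case False
    then show ?thesis using word_nb_start[OF assms(1) u assms(2)] by auto
  qed
  then show ?thesis by (auto simp: half_def)
qed

lemma half_nested:
  assumes "v \<in> V" "i \<in> colours" "j \<in> colours" "i \<noteq> j"
  shows "half (nb v i) j \<subseteq> half v i"
proof -
  have "half (nb v i) j \<inter> half (nb v i) i = {}" using half_disjoint assms by metis
  then show ?thesis using half_complement assms half_subset by blast
qed

lemma half_exit:
  assumes "v \<in> V" "i \<in> colours" "u \<in> half v i" "j \<in> colours" "nb u j \<notin> half v i"
  shows "u = nb v i \<and> j = i \<and> nb u j = v"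
proof -
  have uV: "u \<in> V" using assms(3) half_subset by blast
  have w: "word v u \<noteq> []" "hd (word v u) = i" using assms(3) by (auto simp: half_def)
  have "word v (nb u j) = [] \<or> hd (word v (nb u j)) \<noteq> i" using assms uV by (auto simp: half_def)
  then have e: "word v (nb u j) = []" "word v u = [j]"
    using word_nb[OF assms(1) uV assms(4)] w by (auto simp: hd_append split: if_splits)
  have "nb u j = v" using walk_word[of v "nb u j"] e(1) assms uV by auto
  moreover have "u = nb v j" using walk_word[OF assms(1) uV] e by simp
  ultimately show ?thesis using w e by auto
qed

lemma half_enter:
  assumes "v \<in> V" "i \<in> colours" "u \<in> V" "u \<notin> half v i" "j \<in> colours" "nb u j \<in> half v i"
  shows "u = v \<and> j = i"
proof -
  have "nb (nb u j) j \<notin> half v i" using assms by simp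
  from half_exit[OF assms(1,2,6,5) this] show ?thesis using assms by auto
qed

definition halves :: "'v set set" where
  "halves = {half v i | v i. v \<in> V \<and> i \<in> colours}"

lemma halves_subset: "D \<in> halves \<Longrightarrow> D \<subseteq> V"
  using half_subset by (auto simp: halves_def)

lemma halves_complement: "D \<in> halves \<Longrightarrow> V - D \<in> halves"
  using half_complement nb_in_V unfolding halves_def by blast

lemma half_in_halves: "v \<in> V \<Longrightarrow> i \<in> colours \<Longrightarrow> half v i \<in> halves"
  by (auto simp: halves_def)

text \<open>A path inside a half-tree that avoids the vertex \<open>u\<close> cannot cross an edge at \<open>u\<close>, so it stays on one
  side of that edge.\<close>

lemma half_dichotomy:
  assumes vu: "v \<in> V" "i \<in> colours" "u \<in> V" "j \<in> colours" "u \<notin> half v i"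
  shows "half v i \<subseteq> half u j \<or> half v i \<inter> half u j = {}"
proof -
  have enter: "x \<in> half v i \<longrightarrow> (x \<in> half u j \<longleftrightarrow> nb v i \<in> half u j)" if x: "x \<in> V" for x
    using x nb_in_V[OF \<open>v \<in> V\<close> \<open>i \<in> colours\<close>]
  proof (induction x rule: vertex_induct)
    case base
    show ?case by simp
  next
    case (step x k)
    show ?case
    proof (intro impI)
      assume h: "nb x k \<in> half v i"
      show "nb x k \<in> half u j \<longleftrightarrow> nb v i \<in> half u j"
      proof (cases "x \<in> half v i")
        case True
        have "x \<in> half u j \<longleftrightarrow> nb x k \<in> half u j"
          using half_exit[OF vu(3,4), of x k] half_enter[OF vu(3,4) step(1) _ step(2)] vu(5) h True step by metis
        then show ?thesis using step True by simp
      next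
        case False
        then show ?thesis using half_enter[OF vu(1,2) step(1) False step(2) h] by simp
      qed
    qed
  qed
  show ?thesis using enter half_subset by blast
qed

lemma half_separated:
  assumes "v \<in> V" "i \<in> colours" "u \<in> V" "j \<in> colours" "u \<notin> half v i" "v \<notin> half u j" "u \<noteq> v"
  shows "half v i \<inter> half u j = {}"
proof (rule ccontr)
  assume "half v i \<inter> half u j \<noteq> {}"
  then have "half v i \<subseteq> half u j" using half_dichotomy assms by blast
  then have "nb v i \<in> half u j" using assms by auto
  from half_exit[OF assms(3,4) this assms(2)] show False using assms by simp
qed

text \<open>Removing two edges leaves three pieces, so some half-tree at one edge avoids some half-tree at the
  other; taking complements gives the remaining configurations.\<close>

lemma halves_comparable:
  assumes "D \<in> halves" "D' \<in> halves"
  shows "D \<subseteq> D' \<or> D' \<subseteq> D \<or> D \<inter> D' = {} \<or> D \<union> D' = V"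
proof -
  obtain v i where D: "D = half v i" "v \<in> V" "i \<in> colours" using assms by (auto simp: halves_def)
  obtain u j where D': "D' = half u j" "u \<in> V" "j \<in> colours" using assms by (auto simp: halves_def)
  show ?thesis
  proof (cases "u \<in> D")
    case False
    then show ?thesis using half_dichotomy[of v i u j] D D' by auto
  next
    case True
    then have "u \<notin> half (nb v i) i" using D half_complement by auto
    then have "V - D \<subseteq> D' \<or> (V - D) \<inter> D' = {}"
      using half_dichotomy[of "nb v i" i u j] half_complement[of v i] D D' by auto
    then show ?thesis using halves_subset assms by blast
  qed
qed

text \<open>Every half-tree contains two disjoint half-trees, so one further vertex can always be avoided.\<close>

lemma halves_avoid_finite:
  assumes "finite A"
  obtains D where "D \<in> halves" "D \<inter> A = {}"
proof -
  have "\<exists>D \<in> halves. D \<inter> A = {}"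
    using assms
  proof induction
    case empty
    obtain v where "v \<in> V" using vertices_nonempty by blast
    moreover obtain i where "i \<in> colours" using third_colour by blast
    ultimately show ?case using half_in_halves by blast
  next
    case (insert a A)
    then obtain v i where D: "v \<in> V" "i \<in> colours" "half v i \<inter> A = {}" by (auto simp: halves_def)
    obtain j where j: "j \<in> colours" "j \<noteq> i" using third_colour by blast
    obtain k where k: "k \<in> colours" "k \<noteq> i" "k \<noteq> j" using third_colour by blast
    have "half (nb v i) j \<subseteq> half v i" "half (nb v i) k \<subseteq> half v i"
      using half_nested D j k by auto
    moreover have "a \<notin> half (nb v i) j \<or> a \<notin> half (nb v i) k" using half_disjoint[of j k "nb v i"] k by blast
    moreover have "half (nb v i) j \<in> halves" "half (nb v i) k \<in> halves" using half_in_halves D j k by auto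
    ultimately show ?case using D by blast
  qed
  then show ?thesis using that by blast
qed

section \<open>Automorphisms and their local actions\<close>

abbreviation aut :: "('v \<Rightarrow> 'v) set" where
  "aut \<equiv> tree_aut V E"

abbreviation la :: "('v \<Rightarrow> 'v) \<Rightarrow> 'v \<Rightarrow> nat \<Rightarrow> nat" where
  "la \<equiv> local_action d E c"

lemma la_eq: "v \<in> V \<Longrightarrow> i \<in> colours \<Longrightarrow> la g v i = c (g v, g (nb v i))"
  using inv_into_colour[of v i] by (simp add: local_action_def colours_def)

lemma la_off: "i \<notin> colours \<Longrightarrow> la g v i = i"
  unfolding local_action_def colours_def by (rule if_not_P)

lemma aut_permutes: "g \<in> aut \<Longrightarrow> g permutes V"
  by (simp add: tree_aut_def)

lemma aut_in_V [simp]: "g \<in> aut \<Longrightarrow> g v \<in> V \<longleftrightarrow> v \<in> V"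
  by (rule permutes_in_image[OF aut_permutes])

lemma aut_off: "g \<in> aut \<Longrightarrow> v \<notin> V \<Longrightarrow> g v = v"
  by (rule permutes_not_in[OF aut_permutes])

lemma aut_bij: "g \<in> aut \<Longrightarrow> bij g"
  by (rule permutes_bij[OF aut_permutes])

lemma aut_eq_iff [simp]: "g \<in> aut \<Longrightarrow> g u = g v \<longleftrightarrow> u = v"
  using aut_bij bij_is_inj inj_eq by metis

lemma aut_inv_simps [simp]:
  assumes "g \<in> aut"
  shows "g (inv' g u) = u" "inv' g (g u) = u" "g \<circ> inv' g = id" "inv' g \<circ> g = id"
  using aut_bij[OF assms] by (auto simp: bij_is_surj surj_f_inv_f bij_is_inj fun_eq_iff)

lemma aut_id [simp]: "id \<in> aut"
  by (simp add: tree_aut_def permutes_id)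

lemma aut_comp [simp]: "g \<in> aut \<Longrightarrow> h \<in> aut \<Longrightarrow> g \<circ> h \<in> aut"
  by (auto simp: tree_aut_def permutes_compose permutes_in_image)

lemma aut_inv [simp]:
  assumes "g \<in> aut" shows "inv' g \<in> aut"
proof -
  have p: "inv' g permutes V" using assms permutes_inv aut_permutes by blast
  have "(inv' g u, inv' g v) \<in> E \<longleftrightarrow> (u, v) \<in> E" if "u \<in> V" "v \<in> V" for u v
  proof -
    have "inv' g u \<in> V" "inv' g v \<in> V" using that permutes_in_image[OF p] by auto
    then have "(g (inv' g u), g (inv' g v)) \<in> E \<longleftrightarrow> (inv' g u, inv' g v) \<in> E"
      using assms unfolding tree_aut_def by blast
    then show ?thesis using assms by simp
  qed
  then show ?thesis using p by (simp add: tree_aut_def)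
qed

lemma aut_inv_inv [simp]: "g \<in> aut \<Longrightarrow> inv' (inv' g) = g"
  using inv_inv_eq aut_bij by blast

lemma aut_inv_comp: "g \<in> aut \<Longrightarrow> h \<in> aut \<Longrightarrow> inv' (g \<circ> h) = inv' h \<circ> inv' g"
  using o_inv_distrib aut_bij by blast

lemma
  assumes "g \<in> aut" "v \<in> V" "i \<in> colours"
  shows la_in_colours [simp]: "la g v i \<in> colours" and aut_nb: "g (nb v i) = nb (g v) (la g v i)"
proof -
  have "(g v, g (nb v i)) \<in> E"
    using assms nb_edge[OF assms(2,3)] nb_in_V[OF assms(2,3)] by (auto simp: tree_aut_def)
  then show "la g v i \<in> colours" "g (nb v i) = nb (g v) (la g v i)"
    using colour_in nb_colour assms la_eq by auto
qed

lemma la_permutes: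
  assumes "g \<in> aut" "v \<in> V"
  shows "la g v permutes colours"
proof -
  have "inj_on (la g v) colours"
    using aut_nb[OF assms] nb_inj[OF assms(2)] assms(1) unfolding inj_on_def by (metis aut_eq_iff)
  then have "bij_betw (la g v) colours colours"
    using endo_inj_surj[of colours "la g v"] assms by (simp add: bij_betw_def image_subset_iff)
  then show ?thesis using bij_imp_permutes la_off by blast
qed

lemma la_unique:
  assumes "g \<in> aut" "v \<in> V" "\<sigma> permutes colours" "\<And>i. i \<in> colours \<Longrightarrow> g (nb v i) = nb (g v) (\<sigma> i)"
  shows "la g v = \<sigma>"
proof
  fix i
  show "la g v i = \<sigma> i"
  proof (cases "i \<in> colours")
    case True
    then show ?thesis
      using assms(4)[OF True] aut_nb[OF assms(1,2) True] nb_inj[of "g v"] assms(1,2,3) permutes_in_image[OF assms(3)]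
      by (metis aut_in_V la_in_colours)
  next
    case False
    then show ?thesis using la_off assms(3) permutes_not_in by metis
  qed
qed

lemma la_id [simp]: "v \<in> V \<Longrightarrow> la id v = id"
  by (rule la_unique) (auto simp: permutes_id)

lemma la_comp:
  assumes "g \<in> aut" "h \<in> aut" "v \<in> V"
  shows "la (g \<circ> h) v = la g (h v) \<circ> la h v"
  using assms by (intro la_unique permutes_compose la_permutes) (auto simp: aut_nb)

lemma la_inv:
  assumes "g \<in> aut" "v \<in> V"
  shows "la (inv' g) v = inv' (la g (inv' g v))"
proof -
  have "la (inv' g) v \<circ> la g (inv' g v) = id"
    using la_comp[of "inv' g" g "inv' g v"] assms by simp
  then show ?thesis
    using inv_unique_comp[of "la g (inv' g v)" "la (inv' g) v"]  la_comp[of g "inv' g" v] assms by simp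
qed

text \<open>By legality an image edge has the same colour from both ends.\<close>

lemma la_nb_same:
  assumes "g \<in> aut" "v \<in> V" "i \<in> colours"
  shows "la g (nb v i) i = la g v i"
proof -
  have "nb (g (nb v i)) (la g (nb v i) i) = g v" using aut_nb[of g "nb v i" i] assms by simp
  also have "\<dots> = nb (g (nb v i)) (la g v i)" using aut_nb[OF assms] assms by simp
  finally show ?thesis using nb_inj[of "g (nb v i)"] assms by simp
qed

text \<open>A map that is locally an isomorphism sends reduced walks to reduced walks. As there are no
  reduced closed walks in a tree, such a map is an automorphism.\<close>

lemma locally_bijective_walk:
  assumes x: "\<And>u. u \<in> V \<Longrightarrow> x u \<in> V"
    and \<sigma>: "\<And>u. u \<in> V \<Longrightarrow> \<sigma> u permutes colours"
    and loc: "\<And>u i. u \<in> V \<Longrightarrow> i \<in> colours \<Longrightarrow> x (nb u i) = nb (x u) (\<sigma> u i)"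
    and "v \<in> V" "reduced w"
  shows "\<exists>w'. reduced w' \<and> length w' = length w \<and> x (walk v w) = walk (x v) w' \<and>
    (w \<noteq> [] \<longrightarrow> hd w' = \<sigma> v (hd w))"
  using assms(4,5)
proof (induction w arbitrary: v)
  case Nil
  then show ?case by simp
next
  case (Cons i w)
  have i: "i \<in> colours" and r: "reduced w" "w = [] \<or> hd w \<noteq> i" using Cons.prems by (auto simp: reduced_Cons)
  have v: "v \<in> V" by fact
  have turn: "\<sigma> (nb v i) i = \<sigma> v i"
  proof -
    have "nb (x (nb v i)) (\<sigma> (nb v i) i) = x v" using loc[of "nb v i" i] v i by simp
    also have "\<dots> = nb (x (nb v i)) (\<sigma> v i)"
      using loc[OF v i] x v i permutes_in_image[OF \<sigma>[OF v], of i] by simp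
    finally show ?thesis
      using nb_inj[of "x (nb v i)"] x \<sigma> v i permutes_in_image by (metis nb_in_V)
  qed
  obtain w' where w': "reduced w'" "length w' = length w" "x (walk (nb v i) w) = walk (x (nb v i)) w'"
    "w \<noteq> [] \<longrightarrow> hd w' = \<sigma> (nb v i) (hd w)"
    using Cons.IH[of "nb v i"] v i r by auto
  have "w' = [] \<or> hd w' \<noteq> \<sigma> v i"
  proof (cases "w = []")
    case False
    then have "hd w' = \<sigma> (nb v i) (hd w)" "hd w \<noteq> i" using w' r by auto
    then show ?thesis using turn permutes_inj[OF \<sigma>[OF nb_in_V[OF v i]]] by (metis injD)
  qed (use w' in simp)
  then have "reduced (\<sigma> v i # w')" using w' permutes_in_image[OF \<sigma>[OF v], of i] i by (simp add: reduced_Cons)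
  moreover have "x (walk v (i # w)) = walk (x v) (\<sigma> v i # w')" using w' loc[OF v i] by simp
  ultimately show ?case using w' by (intro exI[of _ "\<sigma> v i # w'"]) simp
qed

lemma aut_of_locally_bijective:
  assumes off: "\<And>u. u \<notin> V \<Longrightarrow> x u = u"
    and x: "\<And>u. u \<in> V \<Longrightarrow> x u \<in> V"
    and \<sigma>: "\<And>u. u \<in> V \<Longrightarrow> \<sigma> u permutes colours"
    and loc: "\<And>u i. u \<in> V \<Longrightarrow> i \<in> colours \<Longrightarrow> x (nb u i) = nb (x u) (\<sigma> u i)"
  shows "x \<in> aut" and "\<And>u. u \<in> V \<Longrightarrow> la x u = \<sigma> u"
proof -
  have inj: "inj_on x V"
  proof (rule inj_onI)
    fix u u' assume u: "u \<in> V" "u' \<in> V" "x u = x u'"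
    let ?w = "word u u'"
    obtain w' where w': "reduced w'" "length w' = length ?w" "x (walk u ?w) = walk (x u) w'"
      using locally_bijective_walk[OF x \<sigma> loc, of u ?w] reduced_word u by blast
    then have "walk (x u) w' = x u" using u by simp
    then have "?w = []" using reduced_closed_walk_trivial[of "x u" w'] w' x u by simp
    then show "u = u'" using walk_word[of u u'] u by simp
  qed
  have surj: "V \<subseteq> x ` V"
  proof
    fix y assume y: "y \<in> V"
    obtain v where v: "v \<in> V" using vertices_nonempty by blast
    show "y \<in> x ` V" using y x[OF v]
    proof (induction y rule: vertex_induct)
      case base
      then show ?case using v by blast
    next
      case (step y i)
      then obtain u where u: "u \<in> V" "y = x u" by blast
      then obtain j where "\<sigma> u j = i" "j \<in> colours" using \<sigma>[OF u(1)] step permutes_in_image permutes_surj by (metis surjD)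
      then have "nb y i = x (nb u j)" using loc u by simp
      then show ?case using u \<open>j \<in> colours\<close> nb_in_V by blast
    qed
  qed
  have "x permutes V" using inj surj x off by (intro bij_imp_permutes) (auto simp: bij_betw_def)
  moreover have "(x u, x v) \<in> E \<longleftrightarrow> (u, v) \<in> E" if u: "u \<in> V" and v: "v \<in> V" for u v
  proof
    assume e: "(u, v) \<in> E"
    then have "x v = nb (x u) (\<sigma> u (c (u, v)))" using loc[of u "c (u, v)"] u colour_in nb_colour by metis
    then show "(x u, x v) \<in> E"
      using nb_edge[OF x[OF u], of "\<sigma> u (c (u, v))"] e permutes_in_image[OF \<sigma>[OF u]] colour_in by simp
  next
    assume e: "(x u, x v) \<in> E"
    let ?j = "c (x u, x v)"
    obtain i where i: "\<sigma> u i = ?j" "i \<in> colours"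
      using \<sigma>[OF u] colour_in[OF e] permutes_in_image permutes_surj by (metis surjD)
    then have "x (nb u i) = x v" using loc[OF u] nb_colour[OF e] by simp
    then have "nb u i = v" using inj u v i by (auto dest: inj_onD)
    then show "(u, v) \<in> E" using nb_edge u i by blast
  qed
  ultimately show "x \<in> aut" by (simp add: tree_aut_def)
  then show "la x u = \<sigma> u" if "u \<in> V" for u using la_unique \<sigma> loc that by blast
qed

text \<open>Automorphisms can be glued: being an automorphism is a condition on balls of radius one.\<close>

lemma glue:
  assumes "\<And>u. u \<notin> V \<Longrightarrow> x u = u"
    and loc: "\<And>u. u \<in> V \<Longrightarrow> \<exists>g \<in> aut. P u (la g u) \<and> x u = g u \<and> (\<forall>i \<in> colours. x (nb u i) = g (nb u i))"
  shows "x \<in> aut" and "\<And>u. u \<in> V \<Longrightarrow> P u (la x u)"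
proof -
  obtain \<gamma> where \<gamma>: "\<And>u. u \<in> V \<Longrightarrow> \<gamma> u \<in> aut \<and> P u (la (\<gamma> u) u) \<and> x u = \<gamma> u u \<and>
      (\<forall>i \<in> colours. x (nb u i) = \<gamma> u (nb u i))"
    using loc by metis
  have "x u \<in> V" if "u \<in> V" for u using \<gamma>[OF that] that by simp
  moreover have "la (\<gamma> u) u permutes colours" if "u \<in> V" for u using \<gamma>[OF that] that la_permutes by blast
  moreover have "x (nb u i) = nb (x u) (la (\<gamma> u) u i)" if "u \<in> V" "i \<in> colours" for u i
    using \<gamma>[OF that(1)] that aut_nb by metis
  ultimately have "x \<in> aut" "\<And>u. u \<in> V \<Longrightarrow> la x u = la (\<gamma> u) u"
    using aut_of_locally_bijective[of x "\<lambda>u. la (\<gamma> u) u"] assms(1) by blast+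
  then show "x \<in> aut" "\<And>u. u \<in> V \<Longrightarrow> P u (la x u)" using \<gamma> by auto
qed

text \<open>One inclusion follows from the action on reduced words, the other one from the same inclusion for
  the complementary half-tree.\<close>

lemma aut_half:
  assumes "g \<in> aut" "v \<in> V" "i \<in> colours"
  shows "g ` half v i = half (g v) (la g v i)"
proof -
  have sub: "g ` half v i \<subseteq> half (g v) (la g v i)" if vi: "v \<in> V" "i \<in> colours" for v i
  proof
    fix y assume "y \<in> g ` half v i"
    then obtain u where u: "y = g u" "u \<in> V" "word v u \<noteq> []" "hd (word v u) = i" by (auto simp: half_def)
    obtain w' where w': "reduced w'" "length w' = length (word v u)" "g (walk v (word v u)) = walk (g v) w'"
        "hd w' = la g v (hd (word v u))"
      using locally_bijective_walk[of g "la g" v "word v u", OF _ la_permutes aut_nb vi(1) reduced_word]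
        u(2,3) vi(1) assms(1) by auto
    then have "word (g v) y = w'" using word_walk[of "g v" w'] u vi assms by simp
    then show "y \<in> half (g v) (la g v i)" using u w' assms by (auto simp: half_def)
  qed
  have "V - g ` half v i = g ` (V - half v i)"
    using permutes_image[OF aut_permutes[OF assms(1)]] aut_bij[OF assms(1)] bij_is_inj image_set_diff by metis
  also have "\<dots> \<subseteq> half (g (nb v i)) (la g v i)"
    using sub[of "nb v i" i] half_complement[of v i] la_nb_same[of g v i] assms by auto
  also have "\<dots> = V - half (g v) (la g v i)" using half_complement[of "g v" "la g v i"] aut_nb[of g v i] assms by simp
  finally have "half (g v) (la g v i) \<subseteq> g ` half v i" using half_subset by blast
  then show ?thesis using sub assms by blast
qed

lemma aut_halves: "g \<in> aut \<Longrightarrow> D \<in> halves \<Longrightarrow> g ` D \<in> halves"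
  unfolding halves_def using aut_half[of g] aut_in_V[of g] la_in_colours[of g] by fastforce

lemma aut_image_inv: "g \<in> aut \<Longrightarrow> u \<in> g ` D \<longleftrightarrow> inv' g u \<in> D"
  by (metis aut_inv_simps(1,2) image_iff)

subsection \<open>Rigid stabilisers\<close>

definition rist :: "('v \<Rightarrow> 'v) set \<Rightarrow> 'v set \<Rightarrow> ('v \<Rightarrow> 'v) set" where
  "rist X D = {g \<in> X. \<forall>u. u \<notin> D \<longrightarrow> g u = u}"

lemma rist_in: "g \<in> rist X D \<Longrightarrow> g \<in> X"
  by (simp add: rist_def)

lemma rist_off: "g \<in> rist X D \<Longrightarrow> u \<notin> D \<Longrightarrow> g u = u"
  by (simp add: rist_def)

lemma rist_mono: "D \<subseteq> D' \<Longrightarrow> rist X D \<subseteq> rist X D'"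
  by (auto simp: rist_def)

lemma rist_preserves:
  assumes "g \<in> rist aut D"
  shows "g u \<in> D \<longleftrightarrow> u \<in> D"
  using assms by (metis (mono_tags, lifting) aut_eq_iff mem_Collect_eq rist_def)

lemma rist_commute:
  assumes "g \<in> rist aut D" "h \<in> rist aut D'" "D \<inter> D' = {}"
  shows "g \<circ> h = h \<circ> g"
proof
  fix u
  show "(g \<circ> h) u = (h \<circ> g) u"
    using rist_preserves[OF assms(1)] rist_preserves[OF assms(2)] rist_off[OF assms(1)] rist_off[OF assms(2)] assms(3)
    by (cases "u \<in> D"; cases "u \<in> D'") (auto, (metis disjoint_iff)+)
qed

text \<open>At \<open>v\<close> all colours but \<open>i\<close> are fixed, hence so is \<open>i\<close>.\<close>

lemma rist_fixes_root:
  assumes "g \<in> rist aut (half v i)" "v \<in> V" "i \<in> colours"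
  shows "g (nb v i) = nb v i"
proof -
  have g: "g \<in> aut" "g v = v" using assms by (auto simp: rist_def)
  have fixed: "la g v j = j" if "j \<in> colours" "j \<noteq> i" for j
  proof -
    have "nb v j \<notin> half v i" using half_disjoint[of i j v] that nb_in_half[of v j] assms by auto
    then have "nb v (la g v j) = nb v j" using rist_off[OF assms(1)] aut_nb[of g v j] g that assms by simp
    then show ?thesis using nb_inj[of v "la g v j" j] g that assms by simp
  qed
  have "la g v i = i"
  proof (rule ccontr)
    assume ne: "la g v i \<noteq> i"
    then have "la g v (la g v i) = la g v i" using fixed g assms by simp
    then show False using ne permutes_inj[OF la_permutes[of g v]] g assms by (simp add: inj_eq)
  qed
  then show ?thesis using aut_nb[of g v i] g assms by simp
qed

lemma rist_la_off:
  assumes "g \<in> rist aut D" "D \<in> halves" "u \<in> V" "u \<notin> D"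
  shows "la g u = id"
proof -
  have "g (nb u j) = nb u j" if "j \<in> colours" for j
  proof (cases "nb u j \<in> D")
    case True
    obtain v i where "D = half v i" "v \<in> V" "i \<in> colours" using assms by (auto simp: halves_def)
    then show ?thesis using half_enter[of v i u j] rist_fixes_root[of g v i] assms True that by auto
  qed (use assms rist_off in auto)
  then show ?thesis
    using assms rist_off[OF assms(1,4)] by (intro la_unique) (auto simp: rist_def permutes_id)
qed

lemma rist_conj:
  assumes "h \<in> rist aut D" "g \<in> aut"
  shows "g \<circ> h \<circ> inv' g \<in> rist aut (g ` D)"
  using assms by (auto simp: rist_def aut_image_inv)

lemma rist_comp: "g \<in> rist aut D \<Longrightarrow> h \<in> rist aut D \<Longrightarrow> g \<circ> h \<in> rist aut D"
  by (auto simp: rist_def)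

lemma rist_inv: "g \<in> rist aut D \<Longrightarrow> inv' g \<in> rist aut D"
  unfolding rist_def by (auto, metis aut_inv_simps(2))

text \<open>Tits' independence property for edges: an automorphism fixing both ends of an edge can be switched
  off on one side, because the two sides touch only along this edge.\<close>

lemma restrict_to_half:
  assumes "g \<in> aut" "v \<in> V" "i \<in> colours" "g v = v" "g (nb v i) = nb v i"
  defines "x \<equiv> \<lambda>u. if u \<in> half v i then g u else u"
  shows "x \<in> rist aut (half v i)"
    and "\<And>u. u \<in> V \<Longrightarrow> la x u = (if u \<in> half v i then la g u else id)"
proof -
  let ?P = "\<lambda>u \<sigma>. \<sigma> = (if u \<in> half v i then la g u else id)"
  have loc: "\<exists>h \<in> aut. ?P u (la h u) \<and> x u = h u \<and> (\<forall>j \<in> colours. x (nb u j) = h (nb u j))"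
    if u: "u \<in> V" for u
  proof (cases "u \<in> half v i")
    case True
    have "x (nb u j) = g (nb u j)" if "j \<in> colours" for j
      using half_exit[OF assms(2,3) True that] assms(4) by (cases "nb u j \<in> half v i") (auto simp: x_def)
    then show ?thesis using True assms by (intro bexI[of _ g]) (auto simp: x_def)
  next
    case False
    have "x (nb u j) = nb u j" if "j \<in> colours" for j
      using half_enter[OF assms(2,3) u False that] assms(5) by (cases "nb u j \<in> half v i") (auto simp: x_def)
    then show ?thesis using False u by (intro bexI[of _ id]) (auto simp: x_def)
  qed
  have off: "x u = u" if "u \<notin> V" for u using that half_subset by (auto simp: x_def)
  from glue(1)[of x ?P, OF off loc] show "x \<in> rist aut (half v i)" by (simp add: rist_def x_def)
  from glue(2)[of x ?P, OF off loc] show "\<And>u. u \<in> V \<Longrightarrow> la x u = (if u \<in> half v i then la g u else id)" by blast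
qed

end

section \<open>The groups \<open>U(F)\<close> and \<open>G(F, F')\<close>\<close>

locale BM_pair = coloured_tree d V E c
  for d :: nat and V :: "'v set" and E :: "('v \<times> 'v) set" and c :: "'v \<times> 'v \<Rightarrow> nat" +
  fixes F F' :: "(nat \<Rightarrow> nat) set"
  assumes F_subgroup: "subgroup F (sym_group d)"
    and F'_subgroup: "subgroup F' (sym_group d)"
    and F_le_F': "F \<subseteq> F'"
    and F'_orbits: "F' \<subseteq> orbit_preserving d F"
    and not_free: "\<not> acts_freely d F"
begin

abbreviation UF :: "('v \<Rightarrow> 'v) set" where
  "UF \<equiv> BM_set d V E c F"

abbreviation GG :: "('v \<Rightarrow> 'v) set" where
  "GG \<equiv> restricted_BM_set d V E c F F'"

definition sing :: "('v \<Rightarrow> 'v) \<Rightarrow> 'v set" where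
  "sing g = {v \<in> V. la g v \<notin> F}"

lemma sym_subgroup_closed:
  assumes "subgroup S (sym_group d)"
  shows "id \<in> S" "\<sigma> \<in> S \<Longrightarrow> \<tau> \<in> S \<Longrightarrow> \<sigma> \<circ> \<tau> \<in> S" "\<sigma> \<in> S \<Longrightarrow> inv' \<sigma> \<in> S" "\<sigma> \<in> S \<Longrightarrow> \<sigma> permutes colours"
proof -
  interpret subgroup S "sym_group d" by fact
  show "id \<in> S" using one_closed by (simp add: sym_group_one)
  show "\<sigma> \<in> S \<Longrightarrow> \<tau> \<in> S \<Longrightarrow> \<sigma> \<circ> \<tau> \<in> S" using m_closed[of \<sigma> \<tau>] by (simp add: sym_group_mult)
  show "\<sigma> \<in> S \<Longrightarrow> inv' \<sigma> \<in> S" using m_inv_closed[of \<sigma>] sym_group_inv_equality mem_carrier by metis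
  show "\<sigma> \<in> S \<Longrightarrow> \<sigma> permutes colours" using mem_carrier[of \<sigma>] sym_group_carrier by (simp add: colours_def)
qed

lemmas F_closed [simp] = sym_subgroup_closed(1-3)[OF F_subgroup]
lemmas F'_closed [simp] = sym_subgroup_closed(1-3)[OF F'_subgroup]
lemmas F_permutes = sym_subgroup_closed(4)[OF F_subgroup]
lemmas F'_permutes = sym_subgroup_closed(4)[OF F'_subgroup]

lemma F_in_F' [simp]: "\<sigma> \<in> F \<Longrightarrow> \<sigma> \<in> F'"
  using F_le_F' by blast

lemma finite_F': "finite F'"
  using finite_subset[of F' "{p. p permutes colours}"] F'_permutes finite_permutations[of colours] by auto

lemma F_interpolates:
  assumes "\<tau> \<in> F'" "i \<in> colours"
  shows "\<exists>\<phi> \<in> F. \<phi> i = \<tau> i"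
proof -
  let ?B = "orbit (perm_group d F) (\<lambda>\<sigma>. \<sigma>) i"
  have "?B \<in> orbits (perm_group d F) {1..d} (\<lambda>\<sigma>. \<sigma>)" using assms by (auto simp: orbits_def colours_def)
  then have "\<tau> ` ?B = ?B" using assms F'_orbits by (auto simp: orbit_preserving_def)
  moreover have "i \<in> ?B" unfolding orbit_def using F_closed(1) by (auto intro!: exI[of _ id])
  ultimately have "\<tau> i \<in> ?B" by blast
  then show ?thesis by (auto simp: orbit_def)
qed

lemma nonfree_witness:
  obtains \<sigma> j p q where "\<sigma> \<in> F" "j \<in> colours" "p \<in> colours" "q \<in> colours" "\<sigma> j = j" "\<sigma> p = q" "p \<noteq> q" "p \<noteq> j" "q \<noteq> j"
proof -
  obtain j where j: "j \<in> colours" "point_stabilizer d F j \<noteq> {id}"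
    using not_free unfolding acts_freely_def colours_def by blast
  have "point_stabilizer d F j = {\<sigma> \<in> F. \<sigma> j = j}" by (simp add: point_stabilizer_def stabilizer_def)
  then obtain \<sigma> where \<sigma>: "\<sigma> \<in> F" "\<sigma> j = j" "\<sigma> \<noteq> id" using j F_closed(1) by auto
  then obtain p where p: "\<sigma> p \<noteq> p" by (auto simp: fun_eq_iff)
  have perm: "\<sigma> permutes colours" using F_permutes \<sigma> by blast
  have "p \<in> colours" "\<sigma> p \<in> colours" using p perm permutes_not_in permutes_in_image by metis+
  moreover have "\<sigma> p \<noteq> j" "p \<noteq> j" using \<sigma> p permutes_inj[OF perm] by (metis injD)+
  ultimately show ?thesis using that[of \<sigma> j p "\<sigma> p"] \<sigma> j p by metis
qed

lemma UF_iff: "g \<in> UF \<longleftrightarrow> g \<in> aut \<and> (\<forall>v \<in> V. la g v \<in> F)"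
  by (simp add: BM_set_def)

lemma GG_iff: "g \<in> GG \<longleftrightarrow> g \<in> aut \<and> (\<forall>v \<in> V. la g v \<in> F') \<and> finite (sing g)"
  by (simp add: restricted_BM_set_def sing_def)

lemma UF_aut: "g \<in> UF \<Longrightarrow> g \<in> aut"
  by (simp add: UF_iff)

lemma GG_aut: "g \<in> GG \<Longrightarrow> g \<in> aut"
  by (simp add: GG_iff)

lemma UF_iff_sing: "g \<in> UF \<longleftrightarrow> g \<in> GG \<and> sing g = {}"
proof -
  have "sing g = {} \<longleftrightarrow> (\<forall>v \<in> V. la g v \<in> F)" by (auto simp: sing_def)
  then show ?thesis by (auto simp: UF_iff GG_iff)
qed

lemma UF_GG: "g \<in> UF \<Longrightarrow> g \<in> GG"
  by (simp add: UF_iff_sing)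

lemma sing_comp:
  assumes "g \<in> aut" "h \<in> aut"
  shows "sing (g \<circ> h) \<subseteq> sing h \<union> inv' h ` sing g"
proof
  fix v assume v: "v \<in> sing (g \<circ> h)"
  then have vV: "v \<in> V" by (simp add: sing_def)
  show "v \<in> sing h \<union> inv' h ` sing g"
  proof (cases "v \<in> sing h")
    case False
    then have "la g (h v) \<notin> F" using v vV la_comp[OF assms vV] F_closed(2) by (auto simp: sing_def)
    then have "h v \<in> sing g" using vV assms by (simp add: sing_def)
    then show ?thesis using assms by (metis UnI2 aut_inv_simps(2) imageI)
  qed simp
qed

lemma sing_inv:
  assumes "g \<in> aut"
  shows "sing (inv' g) \<subseteq> g ` sing g"
proof
  fix v assume v: "v \<in> sing (inv' g)"
  then have vV: "v \<in> V" by (simp add: sing_def)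
  then have "la g (inv' g v) \<notin> F" using v la_inv[OF assms vV] F_closed(3) by (auto simp: sing_def)
  then have "inv' g v \<in> sing g" using vV assms by (simp add: sing_def)
  then show "v \<in> g ` sing g" using assms by (metis aut_inv_simps(1) imageI)
qed

lemma UF_id [simp]: "id \<in> UF" by (simp add: UF_iff)
lemma UF_comp [simp]: "g \<in> UF \<Longrightarrow> h \<in> UF \<Longrightarrow> g \<circ> h \<in> UF" by (simp add: UF_iff la_comp)
lemma UF_inv [simp]: "g \<in> UF \<Longrightarrow> inv' g \<in> UF" by (simp add: UF_iff la_inv)

lemma GG_id [simp]: "id \<in> GG" by (simp add: UF_GG)

lemma GG_comp [simp]:
  assumes "g \<in> GG" "h \<in> GG" shows "g \<circ> h \<in> GG"
  using assms sing_comp[of g h] finite_subset[of "sing (g \<circ> h)" "sing h \<union> inv' h ` sing g"]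
  by (simp add: GG_iff la_comp)

lemma GG_inv [simp]:
  assumes "g \<in> GG" shows "inv' g \<in> GG"
  using assms sing_inv[of g] finite_subset[of "sing (inv' g)" "g ` sing g"] by (simp add: GG_iff la_inv)

text \<open>Prescribing the value at one vertex and the local action there: walking outwards, each
  further local action only has to agree with the previous one on a single colour, and \<open>F\<close> can
  achieve this because \<open>F'\<close> preserves its orbits.\<close>

lemma extension:
  assumes "v \<in> V" "v' \<in> V" "\<sigma> \<in> F'"
  obtains g where "g \<in> GG" "g v = v'" "la g v = \<sigma>" "sing g \<subseteq> {v}"
proof -
  obtain ch where ch: "\<And>\<tau> i. \<tau> \<in> F' \<Longrightarrow> i \<in> colours \<Longrightarrow> ch \<tau> i \<in> F \<and> ch \<tau> i i = \<tau> i"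
    using F_interpolates by metis
  \<comment> \<open>The image of the last vertex of a walk from \<open>v\<close> together with the local action there;
      the walk is read backwards.\<close>
  define st where "st = rec_list (v', \<sigma>) (\<lambda>i _ p. (nb (fst p) (snd p i), ch (snd p) i))"
  have st_simps: "st [] = (v', \<sigma>)" "st (i # r) = (nb (fst (st r)) (snd (st r) i), ch (snd (st r)) i)" for i r
    by (simp_all add: st_def)
  have st: "fst (st r) \<in> V \<and> snd (st r) \<in> F' \<and> (r \<noteq> [] \<longrightarrow> snd (st r) \<in> F)" if "set r \<subseteq> colours" for r
    using that
  proof (induction r)
    case (Cons i r)
    then show ?case using ch[of "snd (st r)" i] permutes_in_image[OF F'_permutes, of "snd (st r)" i]
      by (auto simp: st_simps)
  qed (simp add: st_simps assms)
  define S where "S u = st (rev (word v u))" for u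
  have wc: "set (rev (word v u)) \<subseteq> colours" if "u \<in> V" for u
    using reduced_colours[OF reduced_word[OF assms(1) that]] by simp
  define x where "x u = (if u \<in> V then fst (S u) else u)" for u
  have xV: "x u \<in> V" if "u \<in> V" for u using st[OF wc[OF that]] that by (simp add: x_def S_def)
  have sF': "snd (S u) \<in> F'" if "u \<in> V" for u using st[OF wc[OF that]] by (simp add: S_def)
  have loc: "x (nb u i) = nb (x u) (snd (S u) i)" if ui: "u \<in> V" "i \<in> colours" for u i
  proof (cases "word v (nb u i) = word v u @ [i]")
    case True
    then show ?thesis using ui by (simp add: x_def S_def st_simps)
  next
    case False
    let ?r = "rev (word v (nb u i))"
    have r: "rev (word v u) = i # ?r" using word_nb[OF assms(1) ui] False by simp
    have rc: "set ?r \<subseteq> colours" using wc[of "nb u i"] ui by simp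
    have img: "snd (st ?r) i \<in> colours" using permutes_in_image[OF F'_permutes, of "snd (st ?r)" i] st[OF rc] ui by simp
    have "nb (nb (fst (st ?r)) (snd (st ?r) i)) (ch (snd (st ?r)) i i) = fst (st ?r)"
      using ch[of "snd (st ?r)" i] st[OF rc] img ui by simp
    then show ?thesis using ui r by (simp add: x_def S_def st_simps)
  qed
  have xoff: "x u = u" if "u \<notin> V" for u using that by (simp add: x_def)
  note A = aut_of_locally_bijective[of x "\<lambda>u. snd (S u)", OF xoff xV F'_permutes[OF sF'] loc]
  have xaut: "x \<in> aut" and la: "\<And>u. u \<in> V \<Longrightarrow> la x u = snd (S u)" using A by blast+
  have xv: "x v = v'" "la x v = \<sigma>" using assms la by (auto simp: x_def S_def st_simps)
  have "la x u \<in> F" if "u \<in> V" "u \<noteq> v" for u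
  proof -
    have "word v u \<noteq> []"
    proof
      assume "word v u = []"
      then show False using walk_word[OF assms(1) that(1)] that(2) by simp
    qed
    then show ?thesis using st[OF wc[OF that(1)]] la[OF that(1)] by (simp add: S_def)
  qed
  then have "sing x \<subseteq> {v}" by (auto simp: sing_def)
  moreover have "x \<in> GG" using xaut la sF' finite_subset[OF \<open>sing x \<subseteq> {v}\<close>] by (simp add: GG_iff)
  ultimately show ?thesis using that xv by blast
qed

lemma UF_transitive:
  assumes "v \<in> V" "v' \<in> V" "\<sigma> \<in> F"
  obtains g where "g \<in> UF" "g v = v'" "la g v = \<sigma>"
proof -
  obtain g where g: "g \<in> GG" "g v = v'" "la g v = \<sigma>" "sing g \<subseteq> {v}"
    using extension[of v v' \<sigma>] assms by auto
  then have "sing g = {}" using assms by (auto simp: sing_def)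
  then show ?thesis using that g by (simp add: UF_iff_sing)
qed

lemma restrict_to_half_GG:
  assumes "g \<in> GG" "v \<in> V" "i \<in> colours" "g v = v" "g (nb v i) = nb v i"
  defines "x \<equiv> \<lambda>u. if u \<in> half v i then g u else u"
  shows "x \<in> rist GG (half v i)" "sing x \<subseteq> sing g"
    "\<And>u. u \<in> V \<Longrightarrow> la x u = (if u \<in> half v i then la g u else id)"
proof -
  note R = restrict_to_half[OF GG_aut[OF assms(1)] assms(2-5), folded x_def]
  show la: "la x u = (if u \<in> half v i then la g u else id)" if "u \<in> V" for u using R(2) that by blast
  then show s: "sing x \<subseteq> sing g" by (auto simp: sing_def split: if_splits)
  have "x \<in> aut" using R(1) rist_in by blast
  moreover have "\<forall>v\<in>V. la x v \<in> F'" using la assms(1) by (auto simp: GG_iff)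
  ultimately have "x \<in> GG" using assms(1) finite_subset[OF s] by (simp add: GG_iff)
  then show "x \<in> rist GG (half v i)" using R(1) by (simp add: rist_def)
qed

lemma rist_UF: "g \<in> rist UF D \<longleftrightarrow> g \<in> UF \<and> g \<in> rist aut D"
  by (auto simp: rist_def UF_iff)

lemma rist_GG: "g \<in> rist GG D \<longleftrightarrow> g \<in> GG \<and> g \<in> rist aut D"
  by (auto simp: rist_def GG_iff)

lemma half_extension:
  assumes "v \<in> V" "i \<in> colours" "\<sigma> \<in> F'" "\<sigma> i = i"
  obtains g where "g \<in> rist GG (V - half v i)" "g v = v" "la g v = \<sigma>" "sing g \<subseteq> {v}"
proof -
  obtain g where g: "g \<in> GG" "g v = v" "la g v = \<sigma>" "sing g \<subseteq> {v}"
    using extension[of v v \<sigma>] assms by auto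
  have fix_nb: "g (nb v i) = nb v i" using aut_nb[of g v i] g assms GG_aut by simp
  define x where "x = (\<lambda>u. if u \<in> half (nb v i) i then g u else u)"
  have eq: "half (nb v i) i = V - half v i" using half_complement assms by blast
  have A: "x \<in> rist GG (half (nb v i) i)" "sing x \<subseteq> sing g"
      "\<And>u. u \<in> V \<Longrightarrow> la x u = (if u \<in> half (nb v i) i then la g u else id)"
    unfolding x_def using restrict_to_half_GG[OF g(1), of "nb v i" i] g fix_nb assms by simp_all
  have "x v = v" "la x v = \<sigma>" using A(3)[of v] g assms eq by (auto simp: x_def)
  then show ?thesis using that[of x] A g eq by auto
qed

lemma half_extension_UF:
  assumes "v \<in> V" "i \<in> colours" "\<sigma> \<in> F" "\<sigma> i = i"
  obtains g where "g \<in> rist UF (V - half v i)" "g v = v" "la g v = \<sigma>"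
proof -
  obtain g where g: "g \<in> rist GG (V - half v i)" "g v = v" "la g v = \<sigma>" "sing g \<subseteq> {v}"
    using half_extension[of v i \<sigma>] assms by auto
  then have "sing g = {}" using assms by (auto simp: sing_def)
  then show ?thesis using that g by (auto simp: UF_iff_sing rist_def)
qed

section \<open>Half-trees are moved freely by rigid stabilisers\<close>

text \<open>A non-trivial element of \<open>F\<close> is only given together with a colour \<open>j\<close> that it fixes. Acting with it at
  \<open>z\<close> leaves the branch of colour \<open>j\<close> alone, so \<open>z\<close> has to be placed with this branch pointing out of the
  given half-tree; this takes at most one extra step.\<close>

lemma half_tree_with_root_colour:
  assumes "D \<in> halves" "j \<in> colours"
  obtains z where "z \<in> D" "z \<in> V" "V - half z j \<subseteq> D"
proof -
  obtain v i where D: "D = half v i" "v \<in> V" "i \<in> colours" using assms by (auto simp: halves_def)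
  have *: "V - half (nb u k) k = half u k" if "u \<in> V" "k \<in> colours" for u k
    using half_complement[OF that] half_subset[of u k] by auto
  show ?thesis
  proof (cases "i = j")
    case True
    then show ?thesis using that[of "nb v i"] *[of v i] D by auto
  next
    case False
    have sub: "half (nb v i) j \<subseteq> D" using half_nested[of v i j] D False assms by auto
    have "nb (nb v i) j \<in> D" using nb_in_half[of "nb v i" j] sub D assms by auto
    then show ?thesis using that[of "nb (nb v i) j"] *[of "nb v i" j] sub D assms by simp
  qed
qed

definition movers :: "('v \<Rightarrow> 'v) set" where
  "movers = (\<Union>D \<in> halves. rist UF D)"

lemma movers_UF: "a \<in> movers \<Longrightarrow> a \<in> UF"
  by (auto simp: movers_def rist_def)

lemma id_movers [simp]: "id \<in> movers"
  using halves_avoid_finite[of "{}"] by (auto simp: movers_def rist_def)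

text \<open>Let \<open>\<sigma>\<close> in \<open>F\<close> fix a colour and map \<open>p\<close> to \<open>q \<noteq> p\<close>. At a vertex \<open>z\<close> of \<open>D\<close> whose branch of colour \<open>p\<close>
  contains the complement of \<open>D\<close>, it moves this branch to the one of colour \<open>q\<close>, which lies inside \<open>D\<close>.\<close>

lemma movers_complement_into:
  assumes "D \<in> halves"
  obtains u where "u \<in> movers" "u ` (V - D) \<subseteq> D"
proof -
  obtain \<sigma> j p q where w: "\<sigma> \<in> F" "j \<in> colours" "p \<in> colours" "q \<in> colours" "\<sigma> j = j" "\<sigma> p = q" "p \<noteq> q"
    using nonfree_witness by metis
  obtain z where z: "z \<in> V" "V - half z p \<subseteq> D" using half_tree_with_root_colour[OF assms w(3)] by blast
  obtain u where u: "u \<in> rist UF (V - half z j)" "u z = z" "la u z = \<sigma>"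
    using half_extension_UF[OF z(1) w(2,1,5)] by blast
  have "u ` (V - D) \<subseteq> u ` half z p" using z by blast
  also have "\<dots> = half z q" using aut_half[of u z p] u w z by (simp add: rist_UF UF_aut)
  also have "\<dots> \<subseteq> V - half z p" using half_disjoint[of p q z] half_subset w(7) by blast
  finally have "u ` (V - D) \<subseteq> D" using z by blast
  moreover have "u \<in> movers"
    using u half_in_halves[OF z(1) w(2)] halves_complement unfolding movers_def by blast
  ultimately show ?thesis using that by blast
qed

text \<open>By comparability of half-trees at most two pushes into the complementary side are needed.\<close>

lemma movers_half_into_half:
  assumes "D0 \<in> halves" "D \<in> halves"
  obtains u u' where "u \<in> movers" "u' \<in> movers" "(u \<circ> u') ` (V - D0) \<subseteq> D"
proof -
  obtain u where u: "u \<in> movers" "u ` (V - D) \<subseteq> D" using movers_complement_into assms by blast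
  obtain u0 where u0: "u0 \<in> movers" "u0 ` (V - D0) \<subseteq> D0" using movers_complement_into assms by blast
  from halves_comparable[OF assms(2,1)]
  consider "D \<subseteq> D0" | "D0 \<subseteq> D" | "D \<inter> D0 = {}" | "D \<union> D0 = V" by blast
  then show ?thesis
  proof cases
    case 1
    then have "(u \<circ> id) ` (V - D0) \<subseteq> D" using u by auto
    then show ?thesis using that u id_movers by blast
  next
    case 2
    then have "(u0 \<circ> id) ` (V - D0) \<subseteq> D" using u0 by auto
    then show ?thesis using that u0 id_movers by blast
  next
    case 3
    have "D0 \<subseteq> V - D" using 3 halves_subset[OF assms(1)] by blast
    then have "u ` (u0 ` (V - D0)) \<subseteq> D" using u(2) u0(2) by blast
    then show ?thesis using that u u0 by (metis image_comp)
  next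
    case 4
    then have "(id \<circ> id) ` (V - D0) \<subseteq> D" by auto
    then show ?thesis using that id_movers by blast
  qed
qed

text \<open>The element \<open>b\<close> moves a half-tree off itself and \<open>a\<close> is a non-trivial element supported on that half-tree.\<close>

lemma rist_UF_noncommuting:
  assumes "D \<in> halves"
  obtains a b where "a \<in> rist UF D" "b \<in> rist UF D" "a \<circ> b \<noteq> b \<circ> a"
proof -
  obtain \<sigma> j p q where w: "\<sigma> \<in> F" "j \<in> colours" "p \<in> colours" "q \<in> colours" "\<sigma> j = j" "\<sigma> p = q" "p \<noteq> q" "p \<noteq> j" "q \<noteq> j"
    using nonfree_witness by metis
  obtain z where z: "z \<in> V" "V - half z j \<subseteq> D" using half_tree_with_root_colour[OF assms w(2)] by blast
  obtain b where b: "b \<in> rist UF (V - half z j)" "b z = z" "la b z = \<sigma>"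
    using half_extension_UF[OF z(1) w(2,1,5)] by blast
  have H: "half z p \<in> halves" using half_in_halves z w by blast
  have Hs: "half z p \<subseteq> V - half z j" using half_disjoint[of p j z] half_subset w(8) by blast
  obtain z1 where z1: "z1 \<in> V" "V - half z1 j \<subseteq> half z p" using half_tree_with_root_colour[OF H w(2)] by blast
  obtain a where a: "a \<in> rist UF (V - half z1 j)" "a z1 = z1" "la a z1 = \<sigma>"
    using half_extension_UF[OF z1(1) w(2,1,5)] by blast
  let ?x = "nb z1 p"
  have auts: "a \<in> aut" "b \<in> aut" using a b by (auto simp: rist_UF UF_aut)
  have ax: "a ?x = nb z1 q" using aut_nb[of a z1 p] a w z1 auts by simp
  have ne: "nb z1 q \<noteq> ?x" using nb_inj[of z1 q p] w z1 by auto
  have "?x \<notin> half z1 j" using half_disjoint[of p j z1] nb_in_half[of z1 p] w z1 by blast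
  then have "?x \<in> half z p" using z1 w by auto
  then have "b ?x \<in> half z q" using aut_half[of b z p] b w z auts by auto
  then have "b ?x \<notin> half z p" using half_disjoint[of p q z] w by blast
  then have "b ?x \<notin> V - half z1 j" using z1 by blast
  then have "a (b ?x) = b ?x" using rist_off[OF a(1)] by blast
  moreover have "b (a ?x) \<noteq> b ?x" using ax ne auts by simp
  ultimately have "a \<circ> b \<noteq> b \<circ> a" by (metis comp_apply)
  moreover have "a \<in> rist UF D" "b \<in> rist UF D" using a b z z1 Hs rist_mono by blast+
  ultimately show ?thesis using that by blast
qed

lemma rist_UF_nontrivial:
  assumes "D \<in> halves"
  obtains a where "a \<in> rist UF D" "a \<noteq> id"
  using rist_UF_noncommuting[OF assms] by (metis comp_id id_comp)

text \<open>With at least three colours, some branch at a moved vertex \<open>v\<close> points away from \<open>n v\<close> while its image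
  points away from \<open>v\<close>.\<close>

lemma nontrivial_displaces_half:
  assumes "n \<in> aut" "n \<noteq> id"
  obtains D where "D \<in> halves" "n ` D \<inter> D = {}"
proof -
  obtain v where v: "n v \<noteq> v" using assms by (auto simp: fun_eq_iff)
  then have vV: "v \<in> V" using aut_off assms by blast
  have nvV: "n v \<in> V" using vV assms by simp
  obtain i where i: "i \<in> colours" "n v \<in> half v i" using halves_cover[OF vV nvV v] by blast
  obtain m where m: "m \<in> colours" "v \<in> half (n v) m" using halves_cover[OF nvV vV] v by metis
  have perm: "la n v permutes colours" using la_permutes assms vV by blast
  obtain k where k: "k \<in> colours" "k \<noteq> i" "k \<noteq> inv' (la n v) m" using third_colour by metis
  have lk: "la n v k \<noteq> m" using k(3) permutes_inverses(2)[OF perm] by metis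
  have "n v \<notin> half v k" using half_disjoint[of i k v] i k by blast
  moreover have "v \<notin> half (n v) (la n v k)" using half_disjoint[of m "la n v k" "n v"] m lk by blast
  ultimately have "half v k \<inter> half (n v) (la n v k) = {}"
    using half_separated[of v k "n v" "la n v k"] vV nvV k assms v by simp
  then show ?thesis using that half_in_halves[OF vV k(1)] aut_half[OF assms(1) vV k(1)] by (metis Int_commute)
qed

section \<open>Subgroups normalised by the movers\<close>

abbreviation RB :: "('v \<Rightarrow> 'v) monoid" where
  "RB \<equiv> restricted_BM_group d V E c F F'"

lemma RB_simps [simp]: "carrier RB = GG" "mult RB = (\<circ>)" "one RB = id"
  by (simp_all add: restricted_BM_group_def tree_aut_group_def)

lemma RB_group: "group RB"
proof (rule groupI)
  show "\<exists>y\<in>carrier RB. y \<otimes>\<^bsub>RB\<^esub> x = \<one>\<^bsub>RB\<^esub>" if "x \<in> carrier RB" for x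
    using that by (intro bexI[of _ "inv' x"]) (auto simp: GG_aut)
qed (auto simp: comp_assoc)

lemma RB_inv [simp]:
  assumes "g \<in> GG" shows "inv\<^bsub>RB\<^esub> g = inv' g"
  using group.inv_equality[OF RB_group, of "inv' g" g] assms by (simp add: GG_aut)

lemma subgroup_RB_iff:
  "subgroup N RB \<longleftrightarrow> N \<subseteq> GG \<and> id \<in> N \<and> (\<forall>g\<in>N. \<forall>h\<in>N. g \<circ> h \<in> N) \<and> (\<forall>g\<in>N. inv' g \<in> N)"
proof
  assume "subgroup N RB"
  then interpret subgroup N RB .
  have "N \<subseteq> GG" using subset by simp
  moreover have "inv' g \<in> N" if "g \<in> N" for g
    using m_inv_closed[OF that] RB_inv[OF subsetD[OF \<open>N \<subseteq> GG\<close> that]] by metis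
  ultimately show "N \<subseteq> GG \<and> id \<in> N \<and> (\<forall>g\<in>N. \<forall>h\<in>N. g \<circ> h \<in> N) \<and> (\<forall>g\<in>N. inv' g \<in> N)"
    using m_closed one_closed by simp
next
  assume a: "N \<subseteq> GG \<and> id \<in> N \<and> (\<forall>g\<in>N. \<forall>h\<in>N. g \<circ> h \<in> N) \<and> (\<forall>g\<in>N. inv' g \<in> N)"
  then have "inv\<^bsub>RB\<^esub> g \<in> N" if "g \<in> N" for g using that RB_inv[of g] by auto
  then show "subgroup N RB" using a by (intro subgroup.intro) auto
qed

lemma subgroup_RB_D:
  assumes "subgroup N RB"
  shows "N \<subseteq> GG" "id \<in> N" "\<And>g h. g \<in> N \<Longrightarrow> h \<in> N \<Longrightarrow> g \<circ> h \<in> N" "\<And>g. g \<in> N \<Longrightarrow> inv' g \<in> N"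
  using assms unfolding subgroup_RB_iff by blast+

lemma normal_RB_iff:
  "N \<lhd> RB \<longleftrightarrow> subgroup N RB \<and> (\<forall>g\<in>GG. \<forall>n\<in>N. g \<circ> n \<circ> inv' g \<in> N)"
  using group.normal_inv_iff[OF RB_group, of N] by auto

definition normalised :: "('v \<Rightarrow> 'v) set \<Rightarrow> bool" where
  "normalised N \<longleftrightarrow> (\<forall>a \<in> movers. \<forall>n \<in> N. a \<circ> n \<circ> inv' a \<in> N)"

text \<open>Membership in \<open>U(F)\<close> is a condition on balls of radius one, so \<open>U(F)\<close> contains infinite products of
  elements supported on disjoint half-trees.\<close>

lemma disjoint_product:
  fixes K :: "nat \<Rightarrow> 'v \<Rightarrow> 'v"
  assumes D: "\<And>n. D n \<in> halves" and disj: "\<And>m n. m \<noteq> n \<Longrightarrow> D m \<inter> D n = {}"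
    and K: "\<And>n. K n \<in> rist UF (D n)"
  obtains x where "x \<in> UF" "\<And>n u. u \<in> D n \<Longrightarrow> x u = K n u" "\<And>u. (\<And>n. u \<notin> D n) \<Longrightarrow> x u = u"
proof -
  define x where "x u = (if \<exists>n. u \<in> D n then K (THE n. u \<in> D n) u else u)" for u
  have x_in: "x u = K n u" if "u \<in> D n" for n u
  proof -
    have "(THE n. u \<in> D n) = n" using that disj by (intro the_equality) auto
    then show ?thesis using that by (auto simp: x_def)
  qed
  have x_out: "x u = u" if "\<And>n. u \<notin> D n" for u using that by (simp add: x_def)
  have Kaut: "K n \<in> aut" "K n \<in> rist aut (D n)" for n using K[of n] by (auto simp: rist_UF UF_aut)
  \<comment> \<open>Each factor fixes its half-tree's root, so neighbours outside its support are fixed too.\<close>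
  have border: "K n (nb u j) = nb u j" if "u \<in> V" "u \<notin> D n" "j \<in> colours" for n u j
    using aut_nb[of "K n" u j] rist_la_off[OF Kaut(2) D that(1,2)] rist_off[OF Kaut(2) that(2)] Kaut(1) that by simp
  have loc: "\<exists>g \<in> aut. la g u \<in> F \<and> x u = g u \<and> (\<forall>i \<in> colours. x (nb u i) = g (nb u i))" if u: "u \<in> V" for u
  proof (cases "\<exists>n. u \<in> D n")
    case True
    then obtain n where n: "u \<in> D n" by blast
    have "x (nb u i) = K n (nb u i)" if i: "i \<in> colours" for i
    proof (cases "nb u i \<in> D n")
      case False
      then have "K n (nb u i) = nb u i" using K[of n] by (simp add: rist_def)
      moreover have "x (nb u i) = nb u i"
      proof (cases "\<exists>m. nb u i \<in> D m")
        case True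
        then obtain m where m: "nb u i \<in> D m" by blast
        then have "m \<noteq> n" using False by blast
        then have "u \<notin> D m" using disj n by blast
        then show ?thesis using border u i x_in[OF m] by simp
      qed (use x_out in simp)
      ultimately show ?thesis by simp
    qed (use x_in in simp)
    then show ?thesis using x_in[OF n] K[of n] u Kaut by (intro bexI[of _ "K n"]) (auto simp: rist_def UF_iff)
  next
    case False
    have "x (nb u i) = nb u i" if i: "i \<in> colours" for i
    proof (cases "\<exists>m. nb u i \<in> D m")
      case True
      then show ?thesis using False border u i x_in by metis
    qed (use x_out in simp)
    then show ?thesis using x_out False u by (intro bexI[of _ id]) auto
  qed
  have off: "x u = u" if "u \<notin> V" for u using that D halves_subset x_out by blast
  have "x \<in> UF"
    using glue(1)[of x "\<lambda>_ \<sigma>. \<sigma> \<in> F", OF off loc] glue(2)[of x "\<lambda>_ \<sigma>. \<sigma> \<in> F", OF off loc] by (simp add: UF_iff)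
  then show ?thesis using that x_in x_out by blast
qed

text \<open>A translation \<open>t\<close> that moves a half-tree \<open>D\<close> strictly into itself, past the half-tree \<open>H\<close>,
  makes every \<open>k\<close> supported on \<open>H\<close> a commutator: if \<open>x\<close> is the product of all conjugates of \<open>k\<close> by
  \<open>t, t\<^sup>2, \<dots>\<close> and \<open>k\<close> itself, then \<open>x = k (t x t\<^sup>-\<^sup>1)\<close>. The infinite product exists in \<open>U(F)\<close>, which
  is why \<open>t\<close> has to be in \<open>U(F)\<close>.\<close>

lemma commutator_with_translation:
  assumes t: "t \<in> UF" and H: "H \<in> halves" and D: "D \<in> halves"
    and HD: "H \<subseteq> D" "t ` D \<subseteq> D" "t ` D \<inter> H = {}" and k: "k \<in> rist UF H"
  obtains x where "x \<in> rist UF D" "k = x \<circ> t \<circ> inv' x \<circ> inv' t"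
proof -
  define K where "K n = ((\<lambda>g. t \<circ> g \<circ> inv' t) ^^ n) k" for n
  define W where "W n = ((`) t ^^ n) H" for n
  have taut: "t \<in> aut" using t UF_aut by blast
  have K0: "K 0 = k" "K (Suc n) = t \<circ> K n \<circ> inv' t" for n by (simp_all add: K_def)
  have W0: "W 0 = H" "W (Suc n) = t ` W n" for n by (simp_all add: W_def)
  have KW: "K n \<in> rist UF (W n) \<and> W n \<in> halves \<and> W n \<subseteq> D" for n
  proof (induction n)
    case 0
    then show ?case using k H HD by (simp add: K0 W0)
  next
    case (Suc n)
    have "K n \<in> rist aut (W n)" using Suc rist_UF by blast
    then have "K (Suc n) \<in> rist aut (W (Suc n))" using rist_conj[OF _ taut] by (simp add: K0 W0)
    moreover have "K (Suc n) \<in> UF" using Suc t by (simp add: K0 rist_def)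
    moreover have "t ` W n \<subseteq> D" using Suc HD by blast
    ultimately show ?case using Suc aut_halves[OF taut] by (simp add: W0 rist_UF)
  qed
  have sub: "W (Suc n) \<subseteq> t ` D" for n using KW[of n] by (auto simp: W0)
  have inj_t: "inj t" using taut aut_bij bij_is_inj by blast
  have "W m \<inter> W n = {}" if "m < n" for m n
    using that
  proof (induction m arbitrary: n)
    case 0
    then obtain n' where "n = Suc n'" by (metis gr0_implies_Suc)
    then have "W n \<subseteq> t ` D" using sub by blast
    then show ?case using HD by (auto simp: W0(1))
  next
    case (Suc m)
    then obtain n' where n': "n = Suc n'" "m < n'" by (metis Suc_less_eq2)
    have "W (Suc m) \<inter> W n = t ` (W m \<inter> W n')" using image_Int[OF inj_t] by (simp add: W0 n')
    then show ?case using Suc.IH[OF n'(2)] by simp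
  qed
  then have disj: "W m \<inter> W n = {}" if "m \<noteq> n" for m n using that by (metis Int_commute linorder_neqE_nat)
  have KW1: "\<And>n. W n \<in> halves" and KW2: "\<And>n. K n \<in> rist UF (W n)" using KW by auto
  obtain x where x: "x \<in> UF" "\<And>n u. u \<in> W n \<Longrightarrow> x u = K n u" "\<And>u. (\<And>n. u \<notin> W n) \<Longrightarrow> x u = u"
    using disjoint_product[of W K, OF KW1 disj KW2] by blast
  have xaut: "x \<in> aut" using x UF_aut by blast
  have "x u = u" if "u \<notin> D" for u using x(3) KW that by blast
  then have xD: "x \<in> rist UF D" using x by (simp add: rist_def)
  have "x = k \<circ> t \<circ> x \<circ> inv' t"
  proof
    fix u
    show "x u = (k \<circ> t \<circ> x \<circ> inv' t) u"
    proof (cases "\<exists>n. u \<in> W n")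
      case True
      then obtain n where n: "u \<in> W n" by blast
      show ?thesis
      proof (cases n)
        case 0
        have "inv' t u \<notin> W m" for m
        proof
          assume "inv' t u \<in> W m"
          then have "u \<in> W (Suc m)" using taut by (metis W0(2) aut_image_inv)
          then show False using disj[of 0 "Suc m"] n 0 by blast
        qed
        then have "x (inv' t u) = inv' t u" using x(3) by blast
        then show ?thesis using x(2)[OF n] 0 taut by (simp add: K0)
      next
        case (Suc m)
        then have "inv' t u \<in> W m" using n taut by (metis W0(2) aut_image_inv)
        then have *: "t (x (inv' t u)) = K n u" using x(2) Suc by (simp add: K0)
        have "K n u \<in> W n" using n KW[of n] rist_preserves[of "K n" "W n" u] by (simp add: rist_UF)
        then have "K n u \<notin> H" using disj[of 0 n] Suc by (auto simp: W0(1))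
        then have "k (K n u) = K n u" using rist_off[OF k] by blast
        then show ?thesis using * x(2)[OF n] by simp
      qed
    next
      case False
      then have "inv' t u \<notin> W m" for m using taut by (metis W0(2) aut_image_inv)
      then have "x (inv' t u) = inv' t u" using x(3) by blast
      moreover have "u \<notin> H" using False W0(1) by blast
      then have "k u = u" using rist_off[OF k] by blast
      ultimately show ?thesis using x(3) False taut by simp
    qed
  qed
  then have "x \<circ> t \<circ> inv' x \<circ> inv' t = (k \<circ> t \<circ> x \<circ> inv' t) \<circ> t \<circ> inv' x \<circ> inv' t" by simp
  also have "\<dots> = k" using taut xaut by (simp add: fun_eq_iff)
  finally have "k = x \<circ> t \<circ> inv' x \<circ> inv' t" by simp
  then show ?thesis using that xD by blast
qed

text \<open>The double commutator trick: if \<open>n\<close> displaces the half-tree \<open>D\<close>, then \<open>[[n, a], b] = [a\<^sup>-\<^sup>1, b]\<close>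
  for \<open>a\<close>, \<open>b\<close> supported on \<open>D\<close>.\<close>

lemma double_commutator:
  assumes N: "N \<subseteq> aut" "\<And>g h. g \<in> N \<Longrightarrow> h \<in> N \<Longrightarrow> g \<circ> h \<in> N" "\<And>g. g \<in> N \<Longrightarrow> inv' g \<in> N"
    and norm: "\<And>k m. k \<in> {a, b} \<Longrightarrow> m \<in> N \<Longrightarrow> k \<circ> m \<circ> inv' k \<in> N"
    and n: "n \<in> N" "n ` D \<inter> D = {}" and ab: "a \<in> rist aut D" "b \<in> rist aut D"
  shows "inv' a \<circ> b \<circ> a \<circ> inv' b \<in> N"
proof -
  have auts: "n \<in> aut" "a \<in> aut" "b \<in> aut" using N n ab rist_in by auto
  define y where "y = n \<circ> a \<circ> inv' n"
  define m where "m = y \<circ> inv' a"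
  have y: "y \<in> rist aut (n ` D)" unfolding y_def by (rule rist_conj[OF ab(1) auts(1)])
  then have yaut: "y \<in> aut" by (rule rist_in)
  have "m = n \<circ> (a \<circ> inv' n \<circ> inv' a)" by (simp add: m_def y_def comp_assoc)
  then have mN: "m \<in> N" using N n norm[of a "inv' n"] by simp
  then have "m \<circ> (b \<circ> inv' m \<circ> inv' b) \<in> N" using N norm[of b "inv' m"] by simp
  moreover have "m \<circ> (b \<circ> inv' m \<circ> inv' b) = inv' a \<circ> b \<circ> a \<circ> inv' b"
  proof -
    have inv_m: "inv' m = a \<circ> inv' y" using auts yaut by (simp add: m_def aut_inv_comp)
    define e where "e = inv' a \<circ> b \<circ> a"
    have "e \<in> rist aut D" using ab rist_comp rist_inv by (simp add: e_def)
    then have comm: "y \<circ> e = e \<circ> y" using rist_commute[OF y _ n(2)] by blast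
    have "m \<circ> (b \<circ> inv' m \<circ> inv' b) = (y \<circ> e) \<circ> inv' y \<circ> inv' b"
      unfolding inv_m unfolding m_def e_def by (simp only: comp_assoc)
    also have "\<dots> = e \<circ> (y \<circ> inv' y) \<circ> inv' b" by (simp only: comm comp_assoc)
    also have "\<dots> = e \<circ> inv' b" using yaut by simp
    finally show ?thesis by (simp add: e_def comp_assoc)
  qed
  ultimately show ?thesis by simp
qed

text \<open>The double commutators with elements of \<open>U(F)\<close> supported on a displaced half-tree lie in \<open>U(F)\<close>, and are
  not all trivial since these elements do not all commute.\<close>

lemma normalised_subgroup_meets_UF:
  assumes N: "subgroup N RB" "N \<noteq> {id}" "normalised N"
  obtains l where "l \<in> N" "l \<in> UF" "l \<noteq> id"
proof -
  note NG = subgroup_RB_D[OF N(1)]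
  obtain n where n: "n \<in> N" "n \<noteq> id" using N NG by blast
  have Naut: "N \<subseteq> aut" using NG GG_aut by blast
  obtain D where D: "D \<in> halves" "n ` D \<inter> D = {}" using nontrivial_displaces_half n Naut by blast
  obtain a b where ab: "a \<in> rist UF D" "b \<in> rist UF D" "a \<circ> b \<noteq> b \<circ> a" using rist_UF_noncommuting D by blast
  have mov: "a \<in> movers" "b \<in> movers" using ab D by (auto simp: movers_def)
  have rab: "a \<in> rist aut D" "b \<in> rist aut D" and UFab: "a \<in> UF" "b \<in> UF" using ab rist_UF by auto
  have "inv' a \<circ> b \<circ> a \<circ> inv' b \<in> N"
    using double_commutator[OF Naut NG(3,4) _ n(1) D(2) rab] N(3) mov unfolding normalised_def by blast
  moreover have "inv' a \<circ> b \<circ> a \<circ> inv' b \<in> UF" using UFab by simp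
  moreover have "inv' a \<circ> b \<circ> a \<circ> inv' b \<noteq> id"
  proof
    assume "inv' a \<circ> b \<circ> a \<circ> inv' b = id"
    then have "a \<circ> (inv' a \<circ> b \<circ> a \<circ> inv' b) \<circ> b = a \<circ> b" by simp
    moreover have "a \<circ> (inv' a \<circ> b \<circ> a \<circ> inv' b) \<circ> b = b \<circ> a"
      using UFab UF_aut by (simp add: fun_eq_iff)
    ultimately show False using ab by simp
  qed
  ultimately show ?thesis using that by blast
qed

text \<open>Tits' simplicity argument inside \<open>U(F)\<close>: conjugating one non-trivial element by movers gives
  elements of the subgroup that push the complement of any half-tree into it, and two of them
  compose to a translation past a prescribed half-tree.\<close>

lemma movers_in_normalised_subgroup:
  assumes N: "subgroup N RB" "N \<noteq> {id}" "normalised N"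
  shows "movers \<subseteq> N"
proof
  note NG = subgroup_RB_D[OF N(1)]
  obtain l0 where l0: "l0 \<in> N" "l0 \<in> UF" "l0 \<noteq> id" using normalised_subgroup_meets_UF[OF N] by blast
  obtain D0 where D0: "D0 \<in> halves" "l0 ` D0 \<inter> D0 = {}" using nontrivial_displaces_half l0 UF_aut by blast
  have push: "\<exists>l \<in> N \<inter> UF. l ` (V - D) \<subseteq> D" if D: "D \<in> halves" for D
  proof -
    obtain u1 u2 where u: "u1 \<in> movers" "u2 \<in> movers" "(u1 \<circ> u2) ` (V - D0) \<subseteq> D"
      using movers_half_into_half[OF D0(1) D] by blast
    have auts: "u1 \<in> aut" "u2 \<in> aut" "l0 \<in> aut" using u l0 movers_UF UF_aut by blast+
    define u where "u = u1 \<circ> u2"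
    have uaut: "u \<in> aut" using auts by (simp add: u_def)
    let ?l = "u \<circ> l0 \<circ> inv' u"
    have "?l = u1 \<circ> (u2 \<circ> l0 \<circ> inv' u2) \<circ> inv' u1" using auts by (simp add: u_def aut_inv_comp comp_assoc)
    then have lN: "?l \<in> N" using u l0 N(3) by (simp add: normalised_def)
    have lU: "?l \<in> UF" using u l0 movers_UF by (simp add: u_def)
    have "?l ` (V - D) \<subseteq> D"
    proof
      fix y assume "y \<in> ?l ` (V - D)"
      then obtain x where x: "x \<in> V" "x \<notin> D" "y = ?l x" by blast
      have "inv' u x \<in> D0"
      proof (rule ccontr)
        assume "inv' u x \<notin> D0"
        moreover have "inv' u x \<in> V" using x uaut by simp
        ultimately have "u (inv' u x) \<in> D" using u(3) unfolding u_def[symmetric] by blast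
        then show False using x uaut by simp
      qed
      then have "l0 (inv' u x) \<in> V - D0" using D0 x uaut auts by auto
      then show "y \<in> D" using u(3) x unfolding u_def[symmetric] by auto
    qed
    then show ?thesis using lN lU by blast
  qed
  fix k assume "k \<in> movers"
  then obtain v i where v: "v \<in> V" "i \<in> colours" and k: "k \<in> rist UF (half v i)"
    by (auto simp: movers_def halves_def)
  \<comment> \<open>The translation will push everything outside the branch of colour \<open>j\<close> at \<open>v\<close> into the branch of
      colour \<open>m\<close>, and so past the support of \<open>k\<close>, the branch of colour \<open>i\<close>.\<close>
  obtain j where j: "j \<in> colours" "j \<noteq> i" using third_colour by blast
  obtain m where m: "m \<in> colours" "m \<noteq> i" "m \<noteq> j" using third_colour by blast
  have H: "half v i \<in> halves" "half v j \<in> halves" "half v m \<in> halves" using half_in_halves v j m by auto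
  obtain l2 where l2: "l2 \<in> N" "l2 \<in> UF" "l2 ` (V - half v j) \<subseteq> half v j" using push[OF H(2)] by blast
  obtain l1 where l1: "l1 \<in> N" "l1 \<in> UF" "l1 ` (V - half v m) \<subseteq> half v m" using push[OF H(3)] by blast
  define t where "t = l1 \<circ> l2"
  define D where "D = V - half v j"
  have "half v j \<subseteq> V - half v m" using half_disjoint[of j m v] half_subset m by blast
  then have tD: "t ` D \<subseteq> half v m" using l1 l2 unfolding t_def D_def by (auto simp: image_subset_iff)
  have mD: "half v m \<subseteq> D" using half_disjoint[of m j v] half_subset m unfolding D_def by blast
  have iD: "half v i \<subseteq> D" using half_disjoint[of i j v] half_subset j unfolding D_def by blast
  have "t ` D \<inter> half v i = {}" using tD half_disjoint[of m i v] m by blast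
  moreover have Dh: "D \<in> halves" using halves_complement H unfolding D_def by blast
  moreover have "t \<in> UF" "t \<in> N" using l1 l2 NG by (auto simp: t_def)
  ultimately obtain x where x: "x \<in> rist UF D" "k = x \<circ> t \<circ> inv' x \<circ> inv' t"
    using commutator_with_translation[of t "half v i" D k] H iD tD mD k by blast
  have "x \<in> movers" using x Dh by (auto simp: movers_def)
  then have "x \<circ> t \<circ> inv' x \<in> N" using N(3) \<open>t \<in> N\<close> by (simp add: normalised_def)
  then show "k \<in> N" using x NG \<open>t \<in> N\<close> by blast
qed

section \<open>The monolith\<close>

text \<open>The normal closure of the half-tree stabilisers of \<open>U(F)\<close>; it turns out to be the monolith
  of \<open>G(F, F')\<close>.\<close>

definition core :: "('v \<Rightarrow> 'v) set" where
  "core = generate RB {g \<circ> a \<circ> inv' g | g a. g \<in> GG \<and> a \<in> movers}"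

lemma movers_GG: "a \<in> movers \<Longrightarrow> a \<in> GG"
  using movers_UF UF_GG by blast

lemma core_generators_GG: "{g \<circ> a \<circ> inv' g | g a. g \<in> GG \<and> a \<in> movers} \<subseteq> carrier RB"
  by (auto simp: movers_GG)

lemma core_subgroup: "subgroup core RB"
  unfolding core_def by (rule group.generate_is_subgroup[OF RB_group core_generators_GG])

lemma core_GG: "g \<in> core \<Longrightarrow> g \<in> GG"
  using core_subgroup by (auto simp: subgroup_RB_iff)

lemma core_closed [simp]: "id \<in> core" "g \<in> core \<Longrightarrow> h \<in> core \<Longrightarrow> g \<circ> h \<in> core" "g \<in> core \<Longrightarrow> inv' g \<in> core"
  using core_subgroup by (auto simp: subgroup_RB_iff)

lemma movers_core: "a \<in> movers \<Longrightarrow> a \<in> core"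
  unfolding core_def by (rule generate.incl, intro CollectI exI[of _ id] exI[of _ a]) simp

lemma core_normal: "core \<lhd> RB"
  unfolding normal_RB_iff
proof (intro conjI core_subgroup ballI)
  fix g n assume g: "g \<in> GG" and n: "n \<in> core"
  let ?S = "{g \<circ> a \<circ> inv' g | g a. g \<in> GG \<and> a \<in> movers}"
  have gaut: "g \<in> aut" using g GG_aut by blast
  have S_GG: "h \<in> GG" if "h \<in> ?S" for h using that by (auto simp: movers_GG)
  have conj_S: "g \<circ> h \<circ> inv' g \<in> ?S" if h: "h \<in> ?S" for h
  proof -
    obtain k a where ka: "h = k \<circ> a \<circ> inv' k" "k \<in> GG" "a \<in> movers" using h by blast
    have "g \<circ> h \<circ> inv' g = (g \<circ> k) \<circ> a \<circ> inv' (g \<circ> k)"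
      using ka gaut GG_aut by (simp add: aut_inv_comp comp_assoc)
    then show ?thesis using ka g by (intro CollectI exI[of _ "g \<circ> k"] exI[of _ a]) simp
  qed
  show "g \<circ> n \<circ> inv' g \<in> core"
    using n unfolding core_def
  proof (induction n rule: generate.induct)
    case one
    have "g \<circ> \<one>\<^bsub>RB\<^esub> \<circ> inv' g = id" using gaut by simp
    then show ?case using core_closed(1) unfolding core_def by (simp only:)
  next
    case (incl h)
    then show ?case using conj_S generate.incl by meson
  next
    case (inv h)
    have "inv\<^bsub>RB\<^esub> (g \<circ> h \<circ> inv' g) \<in> generate RB ?S" by (rule generate.inv[OF conj_S[OF inv]])
    moreover have "inv\<^bsub>RB\<^esub> (g \<circ> h \<circ> inv' g) = g \<circ> inv\<^bsub>RB\<^esub> h \<circ> inv' g"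
      using g S_GG[OF inv] gaut GG_aut[OF S_GG[OF inv]] by (simp add: aut_inv_comp comp_assoc)
    ultimately show ?case by (simp only:)
  next
    case (eng h1 h2)
    have "(g \<circ> h1 \<circ> inv' g) \<circ> (g \<circ> h2 \<circ> inv' g) = g \<circ> (h1 \<otimes>\<^bsub>RB\<^esub> h2) \<circ> inv' g"
      using gaut by (simp add: fun_eq_iff)
    then show ?case using generate.eng[OF eng(3,4)] by (simp only: RB_simps)
  qed
qed

lemma core_nontrivial: "core \<noteq> {id}"
proof -
  obtain D where D: "D \<in> halves" using halves_avoid_finite[of "{}"] by blast
  then obtain a where "a \<in> rist UF D" "a \<noteq> id" using rist_UF_nontrivial by blast
  then show ?thesis using movers_core D unfolding movers_def by blast
qed

lemma conj_preimage_subgroup: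
  assumes N: "subgroup N RB" and g: "g \<in> GG"
  shows "subgroup {n \<in> GG. g \<circ> n \<circ> inv' g \<in> N} RB" (is "subgroup ?P RB")
  unfolding subgroup_RB_iff
proof (intro conjI ballI)
  note ND = subgroup_RB_D[OF N]
  have gaut: "g \<in> aut" by (rule GG_aut[OF g])
  show "?P \<subseteq> GG" by blast
  show "id \<in> ?P" using ND(2) gaut by simp
  fix h assume h: "h \<in> ?P"
  then have hG: "h \<in> GG" by simp
  have "g \<circ> inv' h \<circ> inv' g = inv' (g \<circ> h \<circ> inv' g)" using gaut GG_aut[OF hG] by (simp add: aut_inv_comp comp_assoc)
  then show "inv' h \<in> ?P" using ND(4) h by simp
  fix k assume k: "k \<in> ?P"
  have "g \<circ> (h \<circ> k) \<circ> inv' g = (g \<circ> h \<circ> inv' g) \<circ> (g \<circ> k \<circ> inv' g)" using gaut by (simp add: fun_eq_iff)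
  then show "h \<circ> k \<in> ?P" using ND(3) h k by simp
qed

text \<open>For a subgroup \<open>S\<close>, the largest part of \<open>N\<close> that is invariant under conjugation by \<open>S\<close>.\<close>

definition conj_core :: "('v \<Rightarrow> 'v) set \<Rightarrow> ('v \<Rightarrow> 'v) set \<Rightarrow> ('v \<Rightarrow> 'v) set" where
  "conj_core S N = {n \<in> GG. \<forall>g \<in> S. g \<circ> n \<circ> inv' g \<in> N}"

lemma conj_core:
  assumes S: "subgroup S RB" and N: "subgroup N RB"
  shows "subgroup (conj_core S N) RB" "conj_core S N \<subseteq> N"
    "\<And>a n. a \<in> S \<Longrightarrow> n \<in> conj_core S N \<Longrightarrow> a \<circ> n \<circ> inv' a \<in> conj_core S N"
proof -
  note SD = subgroup_RB_D[OF S]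
  have mem: "n \<in> conj_core S N \<longleftrightarrow> n \<in> GG \<and> (\<forall>g \<in> S. n \<in> {n \<in> GG. g \<circ> n \<circ> inv' g \<in> N})" for n
    unfolding conj_core_def by blast
  have sub: "subgroup {n \<in> GG. g \<circ> n \<circ> inv' g \<in> N} RB" if "g \<in> S" for g
    using conj_preimage_subgroup[OF N] SD(1) that by blast
  show "subgroup (conj_core S N) RB"
    unfolding subgroup_RB_iff
  proof (intro conjI ballI)
    show "conj_core S N \<subseteq> GG" unfolding conj_core_def by blast
    show "id \<in> conj_core S N" unfolding mem using subgroup_RB_D(2)[OF sub] by simp
    show "h \<circ> k \<in> conj_core S N" if "h \<in> conj_core S N" "k \<in> conj_core S N" for h k
      using that subgroup_RB_D(3)[OF sub] unfolding mem by simp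
    show "inv' h \<in> conj_core S N" if "h \<in> conj_core S N" for h
      using that subgroup_RB_D(4)[OF sub] unfolding mem by simp
  qed
  show "conj_core S N \<subseteq> N"
  proof
    fix n assume "n \<in> conj_core S N"
    then have "id \<circ> n \<circ> inv' id \<in> N" using SD(2) unfolding conj_core_def by blast
    then show "n \<in> N" by simp
  qed
  show "a \<circ> n \<circ> inv' a \<in> conj_core S N" if a: "a \<in> S" and n: "n \<in> conj_core S N" for a n
  proof -
    have aG: "a \<in> GG" and nG: "n \<in> GG" using a SD(1) n unfolding conj_core_def by blast+
    have "g \<circ> (a \<circ> n \<circ> inv' a) \<circ> inv' g \<in> N" if g: "g \<in> S" for g
    proof -
      have "g \<in> GG" using g SD(1) by blast
      then have "g \<circ> (a \<circ> n \<circ> inv' a) \<circ> inv' g = (g \<circ> a) \<circ> n \<circ> inv' (g \<circ> a)"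
        using aG GG_aut by (simp add: aut_inv_comp comp_assoc)
      moreover have "(g \<circ> a) \<circ> n \<circ> inv' (g \<circ> a) \<in> N" using n SD(3)[OF g a] unfolding conj_core_def by blast
      ultimately show ?thesis by simp
    qed
    then show ?thesis using aG nG unfolding conj_core_def by simp
  qed
qed

text \<open>Conjugates of a subgroup normalised by the core are again normalised by the core, so with the
  movers it contains all their conjugates.\<close>

lemma core_simple:
  assumes N: "subgroup N RB" "N \<noteq> {id}" and norm: "\<And>a n. a \<in> core \<Longrightarrow> n \<in> N \<Longrightarrow> a \<circ> n \<circ> inv' a \<in> N"
  shows "core \<subseteq> N"
proof -
  note NG = subgroup_RB_D[OF N(1)]
  have "g \<circ> a \<circ> inv' g \<in> N" if g: "g \<in> GG" and a: "a \<in> movers" for g a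
  proof -
    have gaut: "g \<in> aut" using g GG_aut by blast
    define N' where "N' = {n \<in> GG. g \<circ> n \<circ> inv' g \<in> N}"
    have "subgroup N' RB" unfolding N'_def by (rule conj_preimage_subgroup[OF N(1) g])
    moreover have "N' \<noteq> {id}"
    proof -
      obtain n where n: "n \<in> N" "n \<noteq> id" using N NG by blast
      let ?n = "inv' g \<circ> n \<circ> g"
      have eq: "g \<circ> ?n \<circ> inv' g = n" using gaut by (simp add: fun_eq_iff)
      then have "?n \<in> N'" using n NG g by (auto simp: N'_def)
      moreover have "?n \<noteq> id" using eq n gaut by auto
      ultimately show ?thesis by blast
    qed
    moreover have "normalised N'"
      unfolding normalised_def
    proof (intro ballI)
      fix b n assume b: "b \<in> movers" and n: "n \<in> N'"
      have baut: "b \<in> aut" using b movers_UF UF_aut by blast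
      have "g \<circ> b \<circ> inv' g \<in> core" using core_normal movers_core[OF b] g normal_RB_iff by blast
      then have "(g \<circ> b \<circ> inv' g) \<circ> (g \<circ> n \<circ> inv' g) \<circ> inv' (g \<circ> b \<circ> inv' g) \<in> N"
        using n norm unfolding N'_def by blast
      moreover have "(g \<circ> b \<circ> inv' g) \<circ> (g \<circ> n \<circ> inv' g) \<circ> inv' (g \<circ> b \<circ> inv' g) = g \<circ> (b \<circ> n \<circ> inv' b) \<circ> inv' g"
        using gaut baut by (simp add: aut_inv_comp fun_eq_iff)
      ultimately show "b \<circ> n \<circ> inv' b \<in> N'" using n movers_GG[OF b] by (simp add: N'_def)
    qed
    ultimately show ?thesis using movers_in_normalised_subgroup a by (auto simp: N'_def)
  qed
  then have "{g \<circ> a \<circ> inv' g | g a. g \<in> GG \<and> a \<in> movers} \<subseteq> N" by blast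
  then show ?thesis unfolding core_def by (rule group.generate_subgroup_incl[OF RB_group _ N(1)])
qed

section \<open>The topology of \<open>G(F, F')\<close>\<close>

text \<open>For finite \<open>A\<close> these are the basic neighbourhoods of the identity.\<close>

definition fixator :: "'v set \<Rightarrow> ('v \<Rightarrow> 'v) set" where
  "fixator A = {g \<in> UF. \<forall>a \<in> A. g a = a}"

definition RB_open :: "('v \<Rightarrow> 'v) set \<Rightarrow> bool" where
  "RB_open W \<longleftrightarrow> W \<subseteq> GG \<and> (\<forall>g \<in> W. \<exists>A. finite A \<and> A \<subseteq> V \<and> (\<forall>h \<in> fixator A. g \<circ> h \<in> W))"

lemma fixator_UF: "g \<in> fixator A \<Longrightarrow> g \<in> UF"
  and fixator_fix: "g \<in> fixator A \<Longrightarrow> a \<in> A \<Longrightarrow> g a = a"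
  by (auto simp: fixator_def)

lemma fixator_aut: "g \<in> fixator A \<Longrightarrow> g \<in> aut"
  using fixator_UF UF_aut by blast

lemma fixator_antimono: "A \<subseteq> B \<Longrightarrow> fixator B \<subseteq> fixator A"
  by (auto simp: fixator_def)

lemma fixator_closed [simp]: "id \<in> fixator A"
  "g \<in> fixator A \<Longrightarrow> h \<in> fixator A \<Longrightarrow> g \<circ> h \<in> fixator A"
  "g \<in> fixator A \<Longrightarrow> inv' g \<in> fixator A"
proof -
  show "id \<in> fixator A" by (simp add: fixator_def)
  show "g \<in> fixator A \<Longrightarrow> h \<in> fixator A \<Longrightarrow> g \<circ> h \<in> fixator A" by (simp add: fixator_def)
  assume g: "g \<in> fixator A"
  have "inv' g a = a" if "a \<in> A" for a
    using aut_inv_simps(2)[OF fixator_aut[OF g], of a] fixator_fix[OF g that] by simp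
  then show "inv' g \<in> fixator A" using g by (simp add: fixator_def)
qed

lemma istopology_RB_open: "istopology RB_open"
proof -
  have "RB_open (S \<inter> T)" if S: "RB_open S" and T: "RB_open T" for S T
    unfolding RB_open_def
  proof (intro conjI ballI)
    show "S \<inter> T \<subseteq> GG" using S by (auto simp: RB_open_def)
    fix g assume g: "g \<in> S \<inter> T"
    obtain A where A: "finite A" "A \<subseteq> V" "\<forall>h \<in> fixator A. g \<circ> h \<in> S" using S g unfolding RB_open_def by blast
    obtain B where B: "finite B" "B \<subseteq> V" "\<forall>h \<in> fixator B. g \<circ> h \<in> T" using T g unfolding RB_open_def by blast
    have "g \<circ> h \<in> S \<inter> T" if h: "h \<in> fixator (A \<union> B)" for h
    proof -
      have "h \<in> fixator A" "h \<in> fixator B" using h by (auto simp: fixator_def)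
      then show ?thesis using A(3) B(3) by simp
    qed
    then show "\<exists>A. finite A \<and> A \<subseteq> V \<and> (\<forall>h \<in> fixator A. g \<circ> h \<in> S \<inter> T)"
      using A(1,2) B(1,2) by (intro exI[of _ "A \<union> B"] conjI ballI) simp_all
  qed
  moreover have "RB_open (\<Union>\<K>)" if \<K>: "\<forall>K \<in> \<K>. RB_open K" for \<K>
    unfolding RB_open_def
  proof (intro conjI ballI)
    show "\<Union>\<K> \<subseteq> GG" using \<K> unfolding RB_open_def by blast
    fix g assume "g \<in> \<Union>\<K>"
    then obtain K where K: "K \<in> \<K>" "g \<in> K" by blast
    then have "RB_open K" using \<K> by blast
    then obtain A where A: "finite A" "A \<subseteq> V" "\<forall>h \<in> fixator A. g \<circ> h \<in> K"
      using K(2) unfolding RB_open_def by blast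
    then have "\<forall>h \<in> fixator A. g \<circ> h \<in> \<Union>\<K>" using K(1) by blast
    then show "\<exists>A. finite A \<and> A \<subseteq> V \<and> (\<forall>h \<in> fixator A. g \<circ> h \<in> \<Union>\<K>)" using A(1,2) by blast
  qed
  ultimately show ?thesis unfolding istopology_def by blast
qed

definition RT :: "('v \<Rightarrow> 'v) topology" where
  "RT = topology RB_open"

lemma openin_RT: "openin RT W \<longleftrightarrow> RB_open W"
  by (simp add: RT_def topology_inverse'[OF istopology_RB_open])

lemma openin_RT_subset:
  assumes "W \<subseteq> GG" "\<And>g. g \<in> W \<Longrightarrow> \<exists>A. finite A \<and> A \<subseteq> V \<and> (\<forall>h \<in> fixator A. g \<circ> h \<in> W)"
  shows "openin RT W"
  unfolding openin_RT RB_open_def using assms by (intro conjI ballI)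

lemma openin_RT_E:
  assumes "openin RT W" "g \<in> W"
  obtains A where "finite A" "A \<subseteq> V" "\<forall>h \<in> fixator A. g \<circ> h \<in> W"
proof -
  have "\<exists>A. finite A \<and> A \<subseteq> V \<and> (\<forall>h \<in> fixator A. g \<circ> h \<in> W)"
    using assms(1) unfolding openin_RT RB_open_def by (rule conjE) (rule bspec[OF _ assms(2)])
  then obtain A where A: "finite A" "A \<subseteq> V" "\<forall>h \<in> fixator A. g \<circ> h \<in> W" by (elim exE conjE)
  show ?thesis by (rule that[OF A])
qed

lemma topspace_RT [simp]: "topspace RT = GG"
proof -
  have "openin RT GG"
  proof (rule openin_RT_subset)
    fix g assume g: "g \<in> GG"
    then have "g \<circ> h \<in> GG" if "h \<in> fixator {}" for h using UF_GG[OF fixator_UF[OF that]] by simp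
    then show "\<exists>A. finite A \<and> A \<subseteq> V \<and> (\<forall>h \<in> fixator A. g \<circ> h \<in> GG)"
      by (intro exI[of _ "{}"] conjI ballI) simp_all
  qed (rule subset_refl)
  then have "GG \<subseteq> topspace RT" by (rule openin_subset)
  moreover have "RB_open (topspace RT)" using openin_topspace[of RT] openin_RT by blast
  then have "topspace RT \<subseteq> GG" unfolding RB_open_def by blast
  ultimately show ?thesis by blast
qed

lemma openin_coset:
  assumes "g \<in> GG" "finite A" "A \<subseteq> V"
  shows "openin RT ((\<circ>) g ` fixator A)"
proof (rule openin_RT_subset)
  show "(\<circ>) g ` fixator A \<subseteq> GG"
  proof (rule image_subsetI)
    show "g \<circ> h \<in> GG" if "h \<in> fixator A" for h using assms(1) UF_GG[OF fixator_UF[OF that]] by simp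
  qed
  fix k assume "k \<in> (\<circ>) g ` fixator A"
  then obtain h where h: "h \<in> fixator A" "k = g \<circ> h" by blast
  have "k \<circ> h' \<in> (\<circ>) g ` fixator A" if "h' \<in> fixator A" for h'
    by (rule image_eqI[of _ _ "h \<circ> h'"]) (simp_all add: h that comp_assoc)
  then show "\<exists>B. finite B \<and> B \<subseteq> V \<and> (\<forall>h' \<in> fixator B. k \<circ> h' \<in> (\<circ>) g ` fixator A)"
    using assms(2,3) by (intro exI[of _ A] conjI ballI) simp_all
qed

lemma fixator_subset_open:
  assumes "subgroup S RB" "finite A" "A \<subseteq> V" "fixator A \<subseteq> S"
  shows "openin RT S"
proof (rule openin_RT_subset)
  show "S \<subseteq> GG" using subgroup_RB_D(1)[OF assms(1)] .
  fix g assume "g \<in> S"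
  then have "g \<circ> h \<in> S" if "h \<in> fixator A" for h using that assms(4) subgroup_RB_D(3)[OF assms(1)] by blast
  then show "\<exists>A. finite A \<and> A \<subseteq> V \<and> (\<forall>h \<in> fixator A. g \<circ> h \<in> S)"
    using assms(2,3) by (intro exI[of _ A] conjI ballI) simp_all
qed

lemma fixator_subset_closed:
  assumes "subgroup S RB" "finite A" "A \<subseteq> V" "fixator A \<subseteq> S"
  shows "closedin RT S"
proof -
  note S = subgroup_RB_D[OF assms(1)]
  have "openin RT (GG - S)"
  proof (rule openin_RT_subset)
    fix g assume g: "g \<in> GG - S"
    have "g \<circ> h \<in> GG - S" if h: "h \<in> fixator A" for h
    proof -
      have "g = (g \<circ> h) \<circ> inv' h" using fixator_aut[OF h] by (simp add: comp_assoc)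
      moreover have "inv' h \<in> S" using S(4) h assms(4) by blast
      ultimately have "g \<circ> h \<notin> S" using S(3)[of "g \<circ> h" "inv' h"] g by auto
      then show ?thesis using g UF_GG[OF fixator_UF[OF h]] by simp
    qed
    then show "\<exists>A. finite A \<and> A \<subseteq> V \<and> (\<forall>h \<in> fixator A. g \<circ> h \<in> GG - S)"
      using assms(2,3) by (intro exI[of _ A] conjI ballI) simp_all
  qed simp
  then show ?thesis using S by (simp add: closedin_def)
qed

text \<open>Elements of \<open>G(F, F')\<close> commensurate the fixators because they have finitely many
  singularities: fixing the balls around those is enough for a conjugate to stay in \<open>U(F)\<close>.\<close>

lemma conjugate_fixator:
  assumes g: "g \<in> GG" and A: "finite A" "A \<subseteq> V"
  obtains B where "finite B" "B \<subseteq> V" "\<forall>h \<in> fixator B. inv' g \<circ> h \<circ> g \<in> fixator A"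
proof -
  have gaut: "g \<in> aut" using g GG_aut by blast
  define B where "B = g ` A \<union> g ` sing g \<union> (\<Union>s \<in> sing g. nb (g s) ` colours)"
  have sg: "sing g \<subseteq> V" "finite (sing g)" using g by (auto simp: sing_def GG_iff)
  have B: "finite B" "B \<subseteq> V" unfolding B_def using sg A gaut by auto
  have "inv' g \<circ> h \<circ> g \<in> fixator A" if h: "h \<in> fixator B" for h
  proof -
    have haut: "h \<in> aut" using h fixator_aut by blast
    have hfix: "h b = b" if "b \<in> B" for b using h that fixator_fix by blast
    have caut: "inv' g \<circ> h \<circ> g \<in> aut" using gaut haut by simp
    have la: "la (inv' g \<circ> h \<circ> g) u = inv' (la g (inv' g (h (g u)))) \<circ> la h (g u) \<circ> la g u" if "u \<in> V" for u
      using that gaut haut by (simp add: la_comp la_inv comp_assoc)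
    have "la (inv' g \<circ> h \<circ> g) u \<in> F" if u: "u \<in> V" for u
    proof (cases "inv' g (h (g u)) \<in> sing g \<or> u \<in> sing g")
      case True
      have "u \<in> sing g \<and> inv' g (h (g u)) = u"
      proof (cases "u \<in> sing g")
        case True
        then have "h (g u) = g u" using hfix by (auto simp: B_def)
        then show ?thesis using gaut True by simp
      next
        case False
        then have s: "inv' g (h (g u)) \<in> sing g" using True by blast
        then have "g (inv' g (h (g u))) \<in> B" by (auto simp: B_def)
        then have "h (h (g u)) = h (g u)" using hfix gaut by simp
        then have "h (g u) = g u" using haut by simp
        then show ?thesis using s False gaut by simp
      qed
      then have u': "u \<in> sing g" "inv' g (h (g u)) = u" by auto
      have "la h (g u) = id"
      proof (rule la_unique)
        show "h (nb (g u) i) = nb (h (g u)) (id i)" if "i \<in> colours" for i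
          using hfix[of "nb (g u) i"] hfix[of "g u"] u' that by (auto simp: B_def)
      qed (use u gaut haut permutes_id in auto)
      then have "la (inv' g \<circ> h \<circ> g) u = inv' (la g u) \<circ> la g u" using la[OF u] u' by simp
      also have "\<dots> = id" using permutes_inv_o(2) la_permutes[OF gaut u] by blast
      finally show ?thesis by simp
    next
      case False
      then have "la g (inv' g (h (g u))) \<in> F" "la g u \<in> F" using u gaut haut by (auto simp: sing_def)
      moreover have "la h (g u) \<in> F" using fixator_UF[OF h] u gaut by (simp add: UF_iff)
      ultimately show ?thesis using la[OF u] by simp
    qed
    then have "inv' g \<circ> h \<circ> g \<in> UF" using caut by (simp add: UF_iff)
    moreover have "(inv' g \<circ> h \<circ> g) a = a" if "a \<in> A" for a
      using hfix[of "g a"] that gaut by (simp add: B_def)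
    ultimately show ?thesis by (simp add: fixator_def)
  qed
  then show ?thesis using that[OF B] by blast
qed

lemma RT_topological_group: "topological_group RB RT"
  unfolding topological_group_def
proof (intro conjI)
  show "group RB" by (rule RB_group)
  show "topspace RT = carrier RB" by simp
  show "continuous_map (prod_topology RT RT) RT (\<lambda>(x, y). x \<otimes>\<^bsub>RB\<^esub> y)"
    unfolding continuous_map_def
  proof (intro conjI allI impI)
    show "(\<lambda>(x, y). x \<otimes>\<^bsub>RB\<^esub> y) \<in> topspace (prod_topology RT RT) \<rightarrow> topspace RT" by auto
    fix W assume W: "openin RT W"
    show "openin (prod_topology RT RT) {p \<in> topspace (prod_topology RT RT). (case p of (x, y) \<Rightarrow> x \<otimes>\<^bsub>RB\<^esub> y) \<in> W}"
      unfolding openin_prod_topology_alt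
    proof (intro allI impI)
      fix x y
      assume "(x, y) \<in> {p \<in> topspace (prod_topology RT RT). (case p of (x, y) \<Rightarrow> x \<otimes>\<^bsub>RB\<^esub> y) \<in> W}"
      then have xy: "x \<in> GG" "y \<in> GG" "x \<circ> y \<in> W" by auto
      obtain A where A: "finite A" "A \<subseteq> V" "\<forall>h \<in> fixator A. (x \<circ> y) \<circ> h \<in> W"
        using openin_RT_E[OF W xy(3)] by blast
      obtain B where B: "finite B" "B \<subseteq> V" "\<forall>h \<in> fixator B. inv' y \<circ> h \<circ> y \<in> fixator A"
        using conjugate_fixator[OF xy(2) A(1,2)] by blast
      have "(x \<circ> h) \<circ> (y \<circ> k) \<in> W" if hk: "h \<in> fixator B" "k \<in> fixator A" for h k
      proof -
        have "(x \<circ> h) \<circ> (y \<circ> k) = (x \<circ> y) \<circ> ((inv' y \<circ> h \<circ> y) \<circ> k)" using xy GG_aut by (simp add: fun_eq_iff)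
        then show ?thesis using A(3) bspec[OF B(3) hk(1)] hk(2) by simp
      qed
      moreover have "(\<circ>) x ` fixator B \<subseteq> GG" "(\<circ>) y ` fixator A \<subseteq> GG" using xy fixator_UF UF_GG by auto
      ultimately have "((\<circ>) x ` fixator B) \<times> ((\<circ>) y ` fixator A) \<subseteq>
          {p \<in> topspace (prod_topology RT RT). (case p of (x, y) \<Rightarrow> x \<otimes>\<^bsub>RB\<^esub> y) \<in> W}" by auto
      moreover have "x \<in> (\<circ>) x ` fixator B" "y \<in> (\<circ>) y ` fixator A" by (auto intro!: image_eqI[of _ _ id])
      ultimately show "\<exists>U U'. openin RT U \<and> openin RT U' \<and> x \<in> U \<and> y \<in> U' \<and> U \<times> U' \<subseteq>
          {p \<in> topspace (prod_topology RT RT). (case p of (x, y) \<Rightarrow> x \<otimes>\<^bsub>RB\<^esub> y) \<in> W}"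
        using openin_coset[OF xy(1) B(1,2)] openin_coset[OF xy(2) A(1,2)] by blast
    qed
  qed
  show "continuous_map RT RT (\<lambda>x. inv\<^bsub>RB\<^esub> x)"
    unfolding continuous_map_def
  proof (intro conjI allI impI)
    show "(\<lambda>x. inv\<^bsub>RB\<^esub> x) \<in> topspace RT \<rightarrow> topspace RT" by auto
    fix W assume W: "openin RT W"
    show "openin RT {x \<in> topspace RT. inv\<^bsub>RB\<^esub> x \<in> W}"
    proof (rule openin_RT_subset)
      fix x assume "x \<in> {x \<in> topspace RT. inv\<^bsub>RB\<^esub> x \<in> W}"
      then have x: "x \<in> GG" "inv' x \<in> W" by auto
      have xaut: "x \<in> aut" using x GG_aut by blast
      obtain A where A: "finite A" "A \<subseteq> V" "\<forall>h \<in> fixator A. inv' x \<circ> h \<in> W"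
        using openin_RT_E[OF W x(2)] by blast
      obtain B where B: "finite B" "B \<subseteq> V" "\<forall>h \<in> fixator B. inv' (inv' x) \<circ> h \<circ> inv' x \<in> fixator A"
        using conjugate_fixator[OF GG_inv[OF x(1)] A(1,2)] by blast
      have "x \<circ> h \<in> {x \<in> topspace RT. inv\<^bsub>RB\<^esub> x \<in> W}" if h: "h \<in> fixator B" for h
      proof -
        have "inv' (x \<circ> h) = inv' x \<circ> (x \<circ> inv' h \<circ> inv' x)"
          using xaut fixator_aut[OF h] by (simp add: aut_inv_comp fun_eq_iff)
        moreover have "x \<circ> inv' h \<circ> inv' x \<in> fixator A" using bspec[OF B(3) fixator_closed(3)[OF h]] xaut by simp
        ultimately have "inv' (x \<circ> h) \<in> W" using A(3) by simp
        then show ?thesis using x fixator_UF[OF h] UF_GG by simp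
      qed
      then have "\<forall>h \<in> fixator B. x \<circ> h \<in> {x \<in> topspace RT. inv\<^bsub>RB\<^esub> x \<in> W}" by blast
      then show "\<exists>A. finite A \<and> A \<subseteq> V \<and> (\<forall>h \<in> fixator A. x \<circ> h \<in> {x \<in> topspace RT. inv\<^bsub>RB\<^esub> x \<in> W})"
        using B(1,2) by blast
    qed auto
  qed
qed

lemma RT_clopen_value:
  assumes "a \<in> V"
  shows "openin RT {k \<in> GG. P (k a)}"
proof (rule openin_RT_subset)
  fix g assume g: "g \<in> {k \<in> GG. P (k a)}"
  have "g \<circ> h \<in> {k \<in> GG. P (k a)}" if "h \<in> fixator {a}" for h
    using g that fixator_fix[of h "{a}" a] fixator_UF[of h] UF_GG by simp
  then show "\<exists>A. finite A \<and> A \<subseteq> V \<and> (\<forall>h \<in> fixator A. g \<circ> h \<in> {k \<in> GG. P (k a)})"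
    using assms by (intro exI[of _ "{a}"] conjI ballI) simp_all
qed auto

lemma GG_separate:
  assumes "g \<in> GG" "h \<in> GG" "g \<noteq> h"
  obtains a where "a \<in> V" "g a \<noteq> h a"
proof -
  obtain a where a: "g a \<noteq> h a" using assms(3) by (auto simp: fun_eq_iff)
  then have "a \<in> V" using assms(1,2) GG_aut aut_off by metis
  then show ?thesis using that a by blast
qed

lemma RT_Hausdorff: "Hausdorff_space RT"
  unfolding Hausdorff_space_def
proof (intro allI impI)
  fix g h assume "g \<in> topspace RT \<and> h \<in> topspace RT \<and> g \<noteq> h"
  then have gh: "g \<in> GG" "h \<in> GG" "g \<noteq> h" by auto
  then obtain a where a: "a \<in> V" "g a \<noteq> h a" using GG_separate by blast
  show "\<exists>U U'. openin RT U \<and> openin RT U' \<and> g \<in> U \<and> h \<in> U' \<and> disjnt U U'"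
    using RT_clopen_value[OF a(1), of "\<lambda>y. y = g a"] RT_clopen_value[OF a(1), of "\<lambda>y. y \<noteq> g a"] gh a
    by (intro exI[of _ "{k \<in> GG. k a = g a}"] exI[of _ "{k \<in> GG. k a \<noteq> g a}"]) (auto simp: disjnt_def)
qed

lemma RT_totally_disconnected: "totally_disconnected_space RT"
  unfolding totally_disconnected_space_def
proof
  fix g assume "g \<in> topspace RT"
  then have g: "g \<in> GG" by simp
  have "h = g" if h: "connected_component_of RT g h" for h
  proof (rule ccontr)
    assume ne: "h \<noteq> g"
    obtain C where C: "connectedin RT C" "g \<in> C" "h \<in> C" using h by (auto simp: connected_component_of_def)
    then have "h \<in> GG" using connectedin_subset_topspace by fastforce
    then obtain a where a: "a \<in> V" "g a \<noteq> h a" using GG_separate g ne by metis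
    let ?T = "{k \<in> GG. k a = g a}"
    have "GG - ?T = {k \<in> GG. k a \<noteq> g a}" by auto
    then have "closedin RT ?T" using RT_clopen_value[OF a(1), of "\<lambda>y. y \<noteq> g a"] by (simp add: closedin_def)
    moreover have "openin RT ?T" using RT_clopen_value[OF a(1), of "\<lambda>y. y = g a"] by simp
    ultimately have "C \<subseteq> ?T \<or> disjnt C ?T" using connectedin_clopen_cases C by blast
    then show False using C g a by (auto simp: disjnt_iff)
  qed
  then show "connected_component_of_set RT g = {g}"
    using g connected_component_of_refl[of RT g] by auto
qed

subsection \<open>Comparison with the permutation topology on \<open>U(F)\<close>\<close>

abbreviation perm_top :: "('v \<Rightarrow> 'v) topology" where
  "perm_top \<equiv> product_topology (\<lambda>_. discrete_topology UNIV) UNIV"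

lemma BM_topology_eq: "BM_topology d V E c F = subtopology perm_top UF"
proof -
  have "aut \<inter> UF = UF" using UF_aut by blast
  then show ?thesis by (simp add: BM_topology_def tree_aut_topology_def subtopology_subtopology)
qed

lemma openin_perm_top_local:
  assumes "finite J" "\<And>f g. (\<forall>u\<in>J. f u = g u) \<Longrightarrow> Q f = Q g"
  shows "openin perm_top {f. Q f}"
  unfolding openin_product_topology_alt
proof (intro conjI ballI)
  fix x assume x: "x \<in> {f. Q f}"
  let ?U = "\<lambda>i. if i \<in> J then {x i} else UNIV"
  have "finite {i \<in> UNIV. ?U i \<noteq> topspace (discrete_topology UNIV)}"
    by (rule finite_subset[OF _ assms(1)]) (auto split: if_splits)
  moreover have "Pi\<^sub>E UNIV ?U \<subseteq> {f. Q f}"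
  proof
    fix f assume "f \<in> Pi\<^sub>E UNIV ?U"
    then have "f u \<in> ?U u" for u by blast
    then have "\<forall>u\<in>J. f u = x u" by (metis singletonD)
    then show "f \<in> {f. Q f}" using assms(2) x by blast
  qed
  ultimately show "\<exists>U. finite {i \<in> UNIV. U i \<noteq> topspace (discrete_topology UNIV)} \<and>
      (\<forall>i\<in>UNIV. openin (discrete_topology UNIV) (U i)) \<and> x \<in> Pi\<^sub>E UNIV U \<and> Pi\<^sub>E UNIV U \<subseteq> {f. Q f}"
    by (intro exI[of _ ?U]) auto
qed

lemma closedin_perm_top_local:
  assumes "finite J" "\<And>f g. (\<forall>u\<in>J. f u = g u) \<Longrightarrow> Q f = Q g"
  shows "closedin perm_top {f. Q f}"
proof -
  have "topspace perm_top - {f. Q f} = {f. \<not> Q f}" by auto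
  moreover have "openin perm_top {f. \<not> Q f}" using assms(2) by (intro openin_perm_top_local[OF assms(1)]) blast
  ultimately show ?thesis by (simp add: closedin_def)
qed

lemma openin_UF_iff:
  "openin (subtopology perm_top UF) W \<longleftrightarrow> W \<subseteq> UF \<and> RB_open W"
proof
  assume "openin (subtopology perm_top UF) W"
  then obtain T where T: "openin perm_top T" "W = T \<inter> UF" by (auto simp: openin_subtopology)
  show "W \<subseteq> UF \<and> RB_open W"
    unfolding RB_open_def
  proof (intro conjI ballI)
    show "W \<subseteq> UF" "W \<subseteq> GG" using T UF_GG by auto
    fix g assume g: "g \<in> W"
    then obtain U where U: "finite {i. U i \<noteq> UNIV}" "g \<in> Pi\<^sub>E UNIV U" "Pi\<^sub>E UNIV U \<subseteq> T"
      using T unfolding openin_product_topology_alt by auto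
    let ?A = "{i. U i \<noteq> UNIV} \<inter> V"
    have "g \<circ> h \<in> W" if h: "h \<in> fixator ?A" for h
    proof -
      have "(g \<circ> h) i \<in> U i" for i
      proof (cases "U i = UNIV")
        case False
        have "h i = i" using fixator_fix[OF h] aut_off[OF fixator_aut[OF h]] False by blast
        then show ?thesis using U(2) by auto
      qed simp
      then have "g \<circ> h \<in> T" using U by auto
      then show ?thesis using T g fixator_UF[OF h] by auto
    qed
    then show "\<exists>A. finite A \<and> A \<subseteq> V \<and> (\<forall>h \<in> fixator A. g \<circ> h \<in> W)"
      using U(1) by (intro exI[of _ ?A] conjI ballI) auto
  qed
next
  assume W: "W \<subseteq> UF \<and> RB_open W"
  show "openin (subtopology perm_top UF) W"
  proof (subst openin_subopen, intro ballI)
    fix g assume g: "g \<in> W"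
    then obtain A where A: "finite A" "A \<subseteq> V" "\<forall>h \<in> fixator A. g \<circ> h \<in> W" using W by (auto simp: RB_open_def)
    have gaut: "g \<in> aut" using g W UF_aut by blast
    let ?T = "{f. \<forall>a\<in>A. f a = g a}"
    have "openin perm_top ?T" by (rule openin_perm_top_local[OF A(1)]) auto
    then have "openin (subtopology perm_top UF) (?T \<inter> UF)" by (auto simp: openin_subtopology)
    moreover have "?T \<inter> UF \<subseteq> W"
    proof
      fix f assume f: "f \<in> ?T \<inter> UF"
      have "inv' g \<circ> f \<in> fixator A" using f g W gaut by (auto simp: fixator_def)
      then have "g \<circ> (inv' g \<circ> f) \<in> W" using A by blast
      moreover have "g \<circ> (inv' g \<circ> f) = f" using gaut by (simp add: fun_eq_iff)
      ultimately show "f \<in> W" by simp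
    qed
    moreover have "g \<in> ?T \<inter> UF" using g W by auto
    ultimately show "\<exists>T. openin (subtopology perm_top UF) T \<and> g \<in> T \<and> T \<subseteq> W" by blast
  qed
qed

lemma continuous_UF_RT: "continuous_map (BM_topology d V E c F) RT (\<lambda>g. g)"
  unfolding continuous_map_def BM_topology_eq
proof (intro conjI allI impI)
  show "(\<lambda>g. g) \<in> topspace (subtopology perm_top UF) \<rightarrow> topspace RT" using UF_GG by auto
  fix W assume W: "openin RT W"
  have "openin RT UF"
  proof (rule openin_RT_subset)
    show "UF \<subseteq> GG" using UF_GG by blast
    fix g assume g: "g \<in> UF"
    then have "g \<circ> h \<in> UF" if "h \<in> fixator {}" for h using fixator_UF[OF that] by simp
    then show "\<exists>A. finite A \<and> A \<subseteq> V \<and> (\<forall>h \<in> fixator A. g \<circ> h \<in> UF)"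
      by (intro exI[of _ "{}"] conjI ballI) simp_all
  qed
  then have "RB_open (UF \<inter> W)" using W openin_RT by blast
  then have "openin (subtopology perm_top UF) (UF \<inter> W)" by (simp add: openin_UF_iff)
  moreover have "{x \<in> topspace (subtopology perm_top UF). x \<in> W} = UF \<inter> W" by auto
  ultimately show "openin (subtopology perm_top UF) {x \<in> topspace (subtopology perm_top UF). x \<in> W}" by simp
qed

lemma open_UF_RT: "open_map (BM_topology d V E c F) RT (\<lambda>g. g)"
  unfolding open_map_def BM_topology_eq openin_UF_iff openin_RT by simp

text \<open>Vertex stabilisers in \<open>U(F)\<close> are compact: their elements preserve spheres, and membership is
  a condition on each ball of radius one separately.\<close>

lemma compact_vertex_fixator:
  assumes v: "v \<in> V"
  shows "compactin perm_top (fixator {v})"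
proof -
  define B where "B u = (if u \<in> V then walk v ` {w. set w \<subseteq> colours \<and> length w = length (word v u)} else {u})" for u
  have "compactin perm_top (Pi\<^sub>E UNIV B)"
  proof -
    have "finite (B u)" for u
      using finite_lists_length_eq[OF finite_colours, of "length (word v u)"] by (simp add: B_def)
    then show ?thesis by (simp add: compactin_PiE finite_imp_compactin)
  qed
  moreover have "fixator {v} \<subseteq> Pi\<^sub>E UNIV B"
  proof
    fix g assume g: "g \<in> fixator {v}"
    have gaut: "g \<in> aut" and gv: "g v = v" using g fixator_aut fixator_fix by auto
    have "g u \<in> B u" for u
    proof (cases "u \<in> V")
      case True
      obtain w' where w': "reduced w'" "length w' = length (word v u)" "g (walk v (word v u)) = walk (g v) w'"
        using locally_bijective_walk[of g "la g" v "word v u", OF _ la_permutes aut_nb v reduced_word[OF v True]] gaut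
        by auto
      then show ?thesis using True v gv reduced_colours by (auto simp: B_def)
    next
      case False
      then show ?thesis using aut_off gaut by (simp add: B_def)
    qed
    then show "g \<in> Pi\<^sub>E UNIV B" by auto
  qed
  moreover have "closedin perm_top (fixator {v})"
  proof -
    define Q where "Q u g \<longleftrightarrow> (if u \<in> V then g u \<in> V \<and> (\<exists>\<sigma> \<in> F. \<forall>i \<in> colours. g (nb u i) = nb (g u) (\<sigma> i)) else g u = u)
        \<and> (u = v \<longrightarrow> g u = u)" for u and g :: "'v \<Rightarrow> 'v"
    have closed: "closedin perm_top {g. Q u g}" for u
    proof (rule closedin_perm_top_local[of "insert u (nb u ` colours)"])
      fix f g :: "'v \<Rightarrow> 'v" assume eq: "\<forall>x \<in> insert u (nb u ` colours). f x = g x"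
      then have "f u = g u" "\<And>i. i \<in> colours \<Longrightarrow> f (nb u i) = g (nb u i)" by blast+
      then show "Q u f = Q u g" by (cases "u = v") (simp_all add: Q_def)
    qed simp
    have "fixator {v} = \<Inter> (range (\<lambda>u. {g. Q u g}))"
    proof (intro equalityI subsetI)
      fix g assume g: "g \<in> fixator {v}"
      then have "g \<in> aut" "\<forall>u \<in> V. la g u \<in> F" "g v = v"
        using fixator_aut fixator_fix fixator_UF by (auto simp: UF_iff)
      then have "Q u g" for u
        using aut_off[of g u] aut_nb[of g u] by (cases "u \<in> V") (auto simp: Q_def intro!: bexI[of _ "la g u"])
      then show "g \<in> \<Inter> (range (\<lambda>u. {g. Q u g}))" by blast
    next
      fix g assume "g \<in> \<Inter> (range (\<lambda>u. {g. Q u g}))"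
      then have Q: "\<And>u. Q u g" by auto
      obtain \<sigma> where \<sigma>: "\<And>u. u \<in> V \<Longrightarrow> \<sigma> u \<in> F \<and> (\<forall>i \<in> colours. g (nb u i) = nb (g u) (\<sigma> u i))"
        using Q unfolding Q_def by metis
      have off: "g u = u" if "u \<notin> V" for u using Q[of u] that by (simp add: Q_def)
      have gV: "g u \<in> V" if "u \<in> V" for u using Q[of u] that by (simp add: Q_def)
      have perm: "\<sigma> u permutes colours" if "u \<in> V" for u using \<sigma>[OF that] F_permutes by blast
      have loc: "g (nb u i) = nb (g u) (\<sigma> u i)" if "u \<in> V" "i \<in> colours" for u i using \<sigma>[OF that(1)] that by blast
      have "g \<in> aut" and "\<And>u. u \<in> V \<Longrightarrow> la g u = \<sigma> u"
        using aut_of_locally_bijective[of g \<sigma>, OF off gV perm loc] by blast+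
      then show "g \<in> fixator {v}" using \<sigma> Q[of v] by (simp add: fixator_def UF_iff Q_def)
    qed
    then show ?thesis using closed by (auto intro!: closedin_Inter)
  qed
  ultimately show ?thesis using closed_compactin by blast
qed

lemma fixator_vertex_compact:
  assumes "v \<in> V"
  shows "compactin RT (fixator {v})"
proof -
  have "compactin (BM_topology d V E c F) (fixator {v})"
    using compact_vertex_fixator[OF assms] fixator_UF by (auto simp: BM_topology_eq compactin_subtopology)
  from image_compactin[OF this continuous_UF_RT] show ?thesis by simp
qed

lemma fixator_subgroup: "subgroup (fixator A) RB"
  using fixator_UF UF_GG by (auto simp: subgroup_RB_iff)

lemma fixator_compact:
  assumes "finite A" "A \<subseteq> V" "A \<noteq> {}"
  shows "compactin RT (fixator A)"
proof -
  obtain v where v: "v \<in> A" using assms by blast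
  have "closedin RT (fixator A)" using fixator_subset_closed[OF fixator_subgroup assms(1,2)] by blast
  then show ?thesis
    using closed_compactin[OF fixator_vertex_compact[of v]] fixator_antimono[of "{v}" A] v assms by blast
qed

lemma RT_locally_compact: "locally_compact_space RT"
  unfolding locally_compact_space_def
proof
  fix g assume "g \<in> topspace RT"
  then have g: "g \<in> GG" by simp
  obtain v where v: "v \<in> V" using vertices_nonempty by blast
  have "compactin RT ((\<circ>) g ` fixator {v})"
    using image_compactin[OF fixator_vertex_compact[OF v] continuous_left_translation[OF RT_topological_group, of g]] g
    by simp
  moreover have "openin RT ((\<circ>) g ` fixator {v})" using openin_coset[OF g] v by simp
  moreover have "g \<in> (\<circ>) g ` fixator {v}" by (auto intro!: image_eqI[of _ _ id])
  ultimately show "\<exists>U K. openin RT U \<and> compactin RT K \<and> g \<in> U \<and> U \<subseteq> K" by blast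
qed

lemma RT_tdlc: "tdlc_group RB RT"
  by (simp add: tdlc_group_def RT_topological_group RT_Hausdorff RT_locally_compact RT_totally_disconnected)

lemma restricted_BM_topology_eq: "restricted_BM_topology d V E c F F' = RT"
  unfolding restricted_BM_topology_def
proof (rule the_equality)
  show "tdlc_group RB RT \<and> continuous_map (BM_topology d V E c F) RT (\<lambda>g. g) \<and> open_map (BM_topology d V E c F) RT (\<lambda>g. g)"
    using RT_tdlc continuous_UF_RT open_UF_RT by blast
next
  fix \<tau> assume "tdlc_group RB \<tau> \<and> continuous_map (BM_topology d V E c F) \<tau> (\<lambda>g. g) \<and> open_map (BM_topology d V E c F) \<tau> (\<lambda>g. g)"
  then show "\<tau> = RT"
    using group_topology_unique[of RB \<tau> "BM_topology d V E c F" RT] RT_topological_group continuous_UF_RT open_UF_RT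
    by (simp add: tdlc_group_def BM_topology_eq)
qed

section \<open>The core is the monolith\<close>

lemma edge_split:
  assumes "g \<in> GG" "v \<in> V" "i \<in> colours" "g v = v" "g (nb v i) = nb v i"
  obtains x y where "x \<in> rist GG (half v i)" "y \<in> rist GG (V - half v i)" "sing x \<subseteq> sing g" "sing y \<subseteq> sing g"
    "g = x \<circ> y"
proof -
  define x where "x = (\<lambda>u. if u \<in> half v i then g u else u)"
  define y where "y = (\<lambda>u. if u \<in> half (nb v i) i then g u else u)"
  have x: "x \<in> rist GG (half v i)" "sing x \<subseteq> sing g"
    using restrict_to_half_GG[OF assms] by (simp_all add: x_def)
  have "y \<in> rist GG (half (nb v i) i)" "sing y \<subseteq> sing g"
    using restrict_to_half_GG[of g "nb v i" i] assms by (simp_all add: y_def)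
  then have y: "y \<in> rist GG (V - half v i)" "sing y \<subseteq> sing g" using half_complement[of v i] assms by simp_all
  have yaut: "y \<in> rist aut (V - half v i)" using y rist_GG by blast
  have "g u = x (y u)" for u
  proof (cases "u \<in> half v i")
    case True
    then show ?thesis using rist_off[OF yaut] by (simp add: x_def)
  next
    case False
    then have "x (y u) = y u"
      using rist_preserves[OF yaut, of u] rist_off[OF yaut, of u] by (cases "u \<in> V") (auto simp: x_def)
    moreover have "y u = g u"
      using half_complement[of v i] assms False aut_off[OF GG_aut[OF assms(1)], of u] by (auto simp: y_def)
    ultimately show ?thesis by simp
  qed
  then show ?thesis using that[OF x(1) y(1) x(2) y(2)] by (simp add: fun_eq_iff)
qed

lemma edge_fixator_core:
  assumes "v \<in> V" "i \<in> colours"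
  shows "fixator {v, nb v i} \<subseteq> core"
proof
  fix g assume g: "g \<in> fixator {v, nb v i}"
  have gU: "g \<in> UF" using g fixator_UF by blast
  then have sg: "sing g = {}" "g \<in> GG" using UF_iff_sing by blast+
  obtain x y where xy: "x \<in> rist GG (half v i)" "y \<in> rist GG (V - half v i)" "sing x \<subseteq> sing g" "sing y \<subseteq> sing g" "g = x \<circ> y"
    using edge_split[OF sg(2) assms] fixator_fix[OF g] by blast
  have "x \<in> rist UF (half v i)" "y \<in> rist UF (V - half v i)" using xy sg by (auto simp: rist_def UF_iff_sing)
  then have "x \<in> movers" "y \<in> movers"
    using half_in_halves[OF assms] halves_complement unfolding movers_def by blast+
  then show "g \<in> core" using xy(5) movers_core by simp
qed

lemma core_openin: "openin RT core" and core_closedin: "closedin RT core"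
proof -
  obtain v where v: "v \<in> V" using vertices_nonempty by blast
  obtain i where i: "i \<in> colours" using third_colour by blast
  have A: "finite {v, nb v i}" "{v, nb v i} \<subseteq> V" using v i by auto
  show "openin RT core" "closedin RT core"
    using fixator_subset_open[OF core_subgroup A edge_fixator_core[OF v i]]
      fixator_subset_closed[OF core_subgroup A edge_fixator_core[OF v i]] by blast+
qed

lemma core_le_normal:
  assumes "N \<lhd> RB" "N \<noteq> {id}"
  shows "core \<subseteq> N"
proof (rule core_simple[OF _ assms(2)])
  show "subgroup N RB" using assms(1) unfolding normal_RB_iff by blast
  show "a \<circ> n \<circ> inv' a \<in> N" if "a \<in> core" "n \<in> N" for a n
    using assms(1) core_GG[OF that(1)] that(2) unfolding normal_RB_iff by blast
qed

lemma monolith_eq_core: "monolith RB RT = core"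
proof
  have "core \<in> {N. N \<lhd> RB \<and> closedin RT N \<and> N \<noteq> {\<one>\<^bsub>RB\<^esub>}}"
    using core_normal core_closedin core_nontrivial by simp
  then show "monolith RB RT \<subseteq> core" unfolding monolith_def by blast
  show "core \<subseteq> monolith RB RT"
    unfolding monolith_def using core_le_normal core_GG by auto
qed

abbreviation CB :: "('v \<Rightarrow> 'v) monoid" where
  "CB \<equiv> RB\<lparr>carrier := core\<rparr>"

abbreviation CT :: "('v \<Rightarrow> 'v) topology" where
  "CT \<equiv> subtopology RT core"

text \<open>Some half-tree avoids \<open>A\<close>, and \<open>U(F)\<close> has non-trivial elements supported on it.\<close>

lemma fixator_nontrivial:
  assumes "finite A"
  obtains a where "a \<in> fixator A" "a \<in> movers" "a \<noteq> id"
proof -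
  obtain D where D: "D \<in> halves" "D \<inter> A = {}" using halves_avoid_finite[OF assms] by blast
  obtain a where a: "a \<in> rist UF D" "a \<noteq> id" using rist_UF_nontrivial[OF D(1)] by blast
  have "a \<in> fixator A" using a D unfolding fixator_def rist_def by blast
  then show ?thesis using that a D by (auto simp: movers_def)
qed

lemma core_not_discrete: "\<not> discrete_space CT"
proof
  assume "discrete_space CT"
  moreover have "openin (discrete_topology (topspace CT)) {id}"
    by (simp add: openin_discrete_topology)
  ultimately have "openin CT {id}" unfolding discrete_space_def by metis
  then have "openin RT {id}" using core_openin openin_trans_full by blast
  then obtain A where A: "finite A" "A \<subseteq> V" "\<forall>h \<in> fixator A. id \<circ> h \<in> {id}" using openin_RT_E[of "{id}" id] by blast
  obtain a where "a \<in> fixator A" "a \<noteq> id" using fixator_nontrivial[OF A(1)] by blast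
  then show False using A(3) by auto
qed

lemma normal_core_D:
  assumes "N \<lhd> CB"
  shows "subgroup N RB" "N \<subseteq> core" "\<And>a n. a \<in> core \<Longrightarrow> n \<in> N \<Longrightarrow> a \<circ> n \<circ> inv' a \<in> N"
proof -
  have CB: "group CB" by (rule subgroup.subgroup_is_group[OF core_subgroup RB_group])
  have sub: "subgroup N CB" and conj: "\<forall>x\<in>core. \<forall>h\<in>N. x \<circ> h \<circ> inv\<^bsub>CB\<^esub> x \<in> N"
    using assms group.normal_inv_iff[OF CB, of N] by simp_all
  show "subgroup N RB" by (rule group.incl_subgroup[OF RB_group core_subgroup sub])
  show "N \<subseteq> core" using subgroup.subset[OF sub] by simp
  show "a \<circ> n \<circ> inv' a \<in> N" if "a \<in> core" "n \<in> N" for a n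
    using conj that group.m_inv_consistent[OF RB_group core_subgroup that(1)] RB_inv[OF core_GG[OF that(1)]] by auto
qed

lemma core_topologically_simple: "topologically_simple CB CT"
  unfolding topologically_simple_def
proof (intro conjI allI impI)
  show "carrier CB \<noteq> {\<one>\<^bsub>CB\<^esub>}" using core_nontrivial by simp
  fix N assume N: "N \<lhd> CB \<and> closedin CT N"
  show "N = {\<one>\<^bsub>CB\<^esub>} \<or> N = carrier CB"
  proof (cases "N = {id}")
    case False
    have NN: "N \<lhd> CB" using N by blast
    have "core \<subseteq> N" by (rule core_simple[OF normal_core_D(1)[OF NN] False normal_core_D(3)[OF NN]])
    then show ?thesis using normal_core_D(2)[of N] N by simp
  qed simp
qed

lemma conjugate_set:
  assumes "subgroup S RB" "g \<in> S"
  shows "g <#\<^bsub>RB\<lparr>carrier := S\<rparr>\<^esub> U #>\<^bsub>RB\<lparr>carrier := S\<rparr>\<^esub> inv\<^bsub>RB\<lparr>carrier := S\<rparr>\<^esub> g = (\<lambda>u. g \<circ> u \<circ> inv' g) ` U"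
proof -
  have "inv\<^bsub>RB\<lparr>carrier := S\<rparr>\<^esub> g = inv' g"
    using group.m_inv_consistent[OF RB_group assms] RB_inv subgroup_RB_D(1)[OF assms(1)] assms(2) by auto
  then show ?thesis by (auto simp: l_coset_def r_coset_def)
qed

lemma conjugate_mem_iff:
  assumes "g \<in> aut"
  shows "n \<in> (\<lambda>u. g \<circ> u \<circ> inv' g) ` U \<longleftrightarrow> inv' g \<circ> n \<circ> g \<in> U"
proof
  assume "n \<in> (\<lambda>u. g \<circ> u \<circ> inv' g) ` U"
  then obtain u where u: "u \<in> U" "n = g \<circ> u \<circ> inv' g" by blast
  then have "inv' g \<circ> n \<circ> g = u" using assms by (simp add: fun_eq_iff)
  then show "inv' g \<circ> n \<circ> g \<in> U" using u by simp
next
  assume a: "inv' g \<circ> n \<circ> g \<in> U"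
  have "n = g \<circ> (inv' g \<circ> n \<circ> g) \<circ> inv' g" using assms by (simp add: fun_eq_iff)
  then show "n \<in> (\<lambda>u. g \<circ> u \<circ> inv' g) ` U" using a by blast
qed

text \<open>The conjugates of an edge fixator by the core intersect in a subgroup normalised by the core. If it
  were non-trivial, it would contain the core, which does not fix the edge.\<close>

lemma core_regionally_expansive:
  assumes "compactly_generated CB CT"
  shows "regionally_expansive CB CT"
proof -
  obtain v where v: "v \<in> V" using vertices_nonempty by blast
  obtain i where i: "i \<in> colours" using third_colour by blast
  define U where "U = fixator {v, nb v i}"
  have A: "finite {v, nb v i}" "{v, nb v i} \<subseteq> V" "{v, nb v i} \<noteq> {}" using v i by auto
  have Uc: "U \<subseteq> core" unfolding U_def by (rule edge_fixator_core[OF v i])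
  have "group CB" by (rule subgroup.subgroup_is_group[OF core_subgroup RB_group])
  then have "subgroup core CB" using group.subgroup_self[of CB] by simp
  moreover have "subgroup U CB"
    using group.subgroup_incl[OF RB_group _ core_subgroup Uc] fixator_subgroup by (simp add: U_def)
  moreover have "openin CT U"
  proof -
    have "openin RT U" unfolding U_def by (rule fixator_subset_open[OF fixator_subgroup A(1,2)]) simp
    then show ?thesis using Uc by (auto simp: openin_subtopology)
  qed
  moreover have "compactin CT U" using fixator_compact[OF A] Uc by (simp add: compactin_subtopology U_def)
  moreover have "openin CT core" by (simp add: core_openin openin_open_subtopology)
  moreover have "(\<Inter>g \<in> core. g <#\<^bsub>CB\<^esub> U #>\<^bsub>CB\<^esub> inv\<^bsub>CB\<^esub> g) = {\<one>\<^bsub>CB\<^esub>}"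
  proof -
    have caut: "g \<in> aut" if "g \<in> core" for g using that core_GG GG_aut by blast
    have U_sub: "subgroup U RB" unfolding U_def by (rule fixator_subgroup)
    define N where "N = conj_core core U"
    note N = conj_core[OF core_subgroup U_sub, folded N_def]
    have "N = {id}"
    proof (rule ccontr)
      assume "N \<noteq> {id}"
      from core_simple[OF N(1) this N(3)] have "core \<subseteq> U" using N(2) by (rule subset_trans)
      moreover obtain u where u: "u \<in> movers" "u ` (V - half v i) \<subseteq> half v i"
        using movers_complement_into[OF half_in_halves[OF v i]] by blast
      ultimately have "u \<in> fixator {v, nb v i}" using movers_core unfolding U_def by blast
      then have "u v = v" using fixator_fix by simp
      moreover have "u v \<in> half v i" using u(2) v by (simp add: image_subset_iff)
      ultimately show False using v by simp
    qed
    moreover have "n \<in> (\<Inter>g \<in> core. g <#\<^bsub>CB\<^esub> U #>\<^bsub>CB\<^esub> inv\<^bsub>CB\<^esub> g) \<longleftrightarrow> n \<in> N" for n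
    proof
      assume "n \<in> (\<Inter>g \<in> core. g <#\<^bsub>CB\<^esub> U #>\<^bsub>CB\<^esub> inv\<^bsub>CB\<^esub> g)"
      then have n: "inv' g \<circ> n \<circ> g \<in> U" if "g \<in> core" for g
        using conjugate_set[OF core_subgroup that] conjugate_mem_iff[OF caut[OF that]] that by blast
      have nG: "n \<in> GG" using n[of id] Uc core_GG by auto
      have "g \<circ> n \<circ> inv' g \<in> U" if g: "g \<in> core" for g
        using n[OF core_closed(3)[OF g]] caut[OF g] by simp
      then show "n \<in> N" using nG by (simp add: N_def conj_core_def)
    next
      assume n: "n \<in> N"
      show "n \<in> (\<Inter>g \<in> core. g <#\<^bsub>CB\<^esub> U #>\<^bsub>CB\<^esub> inv\<^bsub>CB\<^esub> g)"
      proof (rule INT_I)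
        fix g assume g: "g \<in> core"
        have "inv' g \<circ> n \<circ> inv' (inv' g) \<in> U" using n core_closed(3)[OF g] unfolding N_def conj_core_def by blast
        then show "n \<in> g <#\<^bsub>CB\<^esub> U #>\<^bsub>CB\<^esub> inv\<^bsub>CB\<^esub> g"
          unfolding conjugate_set[OF core_subgroup g] conjugate_mem_iff[OF caut[OF g]] using caut[OF g] by simp
      qed
    qed
    ultimately show ?thesis by auto
  qed
  moreover have "tdlc_group CB CT" by (rule tdlc_closed_subgroup[OF RT_tdlc core_subgroup core_closedin])
  ultimately show ?thesis
    unfolding regionally_expansive_def using assms
    by (intro conjI exI[of _ core] exI[of _ U]) (simp_all add: subtopology_subtopology)
qed

lemma class_S_core_iff: "class_S CB CT \<longleftrightarrow> compactly_generated CB CT"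
  using tdlc_closed_subgroup[OF RT_tdlc core_subgroup core_closedin] core_not_discrete core_topologically_simple
  by (simp add: class_S_def)

lemma class_R_iff: "class_R RB RT \<longleftrightarrow> regionally_expansive CB CT"
  using RT_tdlc core_nontrivial core_not_discrete core_topologically_simple
  by (simp add: class_R_def monolithic_def monolith_eq_core Let_def)

section \<open>Finite index subgroups\<close>

lemma GG_infinite: "infinite GG"
proof
  assume fin: "finite GG"
  define m where "m g = (SOME a. g a \<noteq> a)" for g :: "'v \<Rightarrow> 'v"
  have m: "g (m g) \<noteq> m g" if "g \<noteq> id" for g
  proof -
    have "\<exists>a. g a \<noteq> a" using that by (auto simp: fun_eq_iff)
    then show ?thesis unfolding m_def by (rule someI_ex)
  qed
  have "finite (m ` GG)" using fin by simp
  then obtain a where a: "a \<in> fixator (m ` GG)" "a \<noteq> id" using fixator_nontrivial by blast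
  have "a \<in> GG" by (rule UF_GG[OF fixator_UF[OF a(1)]])
  then have "a (m a) = m a" using fixator_fix[OF a(1), of "m a"] by simp
  then show False using m[OF a(2)] by simp
qed

text \<open>The intersection of all conjugates of a finite index subgroup is non-trivial, since otherwise the
  infinite group \<open>G(F, F')\<close> would embed in the symmetric group on the cosets.\<close>

lemma core_le_finite_index:
  assumes H: "subgroup H RB" and fin: "finite (rcosets\<^bsub>RB\<^esub> H)"
  shows "core \<subseteq> H"
proof -
  note HD = subgroup_RB_D[OF H]
  have GG_sub: "subgroup GG RB" using group.subgroup_self[OF RB_group] by simp
  define N where "N = conj_core GG H"
  note ND = conj_core[OF GG_sub H, folded N_def]
  have "N \<lhd> RB" unfolding normal_RB_iff using ND(1,3) by blast
  moreover have "N \<noteq> {id}"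
  proof
    assume N: "N = {id}"
    define \<phi> where "\<phi> g = (\<lambda>R \<in> rcosets\<^bsub>RB\<^esub> H. R #>\<^bsub>RB\<^esub> g)" for g
    interpret group RB by (rule RB_group)
    have Hc: "H \<subseteq> carrier RB" using HD by simp
    have "\<phi> ` GG \<subseteq> rcosets\<^bsub>RB\<^esub> H \<rightarrow>\<^sub>E rcosets\<^bsub>RB\<^esub> H"
    proof (intro image_subsetI PiE_I)
      fix g R assume g: "g \<in> GG" and R: "R \<in> rcosets\<^bsub>RB\<^esub> H"
      then obtain x where x: "x \<in> carrier RB" "R = H #>\<^bsub>RB\<^esub> x" by (auto simp: RCOSETS_def)
      then have "R #>\<^bsub>RB\<^esub> g = H #>\<^bsub>RB\<^esub> (x \<otimes>\<^bsub>RB\<^esub> g)" using coset_mult_assoc[OF Hc, of x g] g by simp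
      then show "\<phi> g R \<in> rcosets\<^bsub>RB\<^esub> H" using R g x rcosetsI[OF Hc, of "x \<otimes>\<^bsub>RB\<^esub> g"] by (simp add: \<phi>_def)
    qed (simp add: \<phi>_def)
    moreover have "inj_on \<phi> GG"
    proof (rule inj_onI)
      fix g g' assume g: "g \<in> GG" "g' \<in> GG" and eq: "\<phi> g = \<phi> g'"
      have "x \<circ> (g \<circ> inv' g') \<circ> inv' x \<in> H" if x: "x \<in> GG" for x
      proof -
        have "H #>\<^bsub>RB\<^esub> x \<in> rcosets\<^bsub>RB\<^esub> H" using rcosetsI[OF Hc] x by simp
        then have "(H #>\<^bsub>RB\<^esub> x) #>\<^bsub>RB\<^esub> g = (H #>\<^bsub>RB\<^esub> x) #>\<^bsub>RB\<^esub> g'" using fun_cong[OF eq, of "H #>\<^bsub>RB\<^esub> x"] by (simp add: \<phi>_def)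
        then have "H #>\<^bsub>RB\<^esub> (x \<circ> g) = H #>\<^bsub>RB\<^esub> (x \<circ> g')" using coset_mult_assoc[OF Hc, of x] g x by simp
        moreover have "x \<circ> g \<in> H #>\<^bsub>RB\<^esub> (x \<circ> g)" using HD(2) by (auto simp: r_coset_def intro!: bexI[of _ id])
        ultimately obtain h where h: "h \<in> H" "x \<circ> g = h \<circ> (x \<circ> g')" by (auto simp: r_coset_def)
        have "x \<circ> (g \<circ> inv' g') \<circ> inv' x = (x \<circ> g) \<circ> inv' g' \<circ> inv' x" by (simp add: comp_assoc)
        also have "\<dots> = h" unfolding h(2) using GG_aut[OF g(2)] GG_aut[OF x] by (simp add: fun_eq_iff)
        finally show ?thesis using h by simp
      qed
      then have "g \<circ> inv' g' \<in> N" using g by (simp add: N_def conj_core_def)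
      then have "(g \<circ> inv' g') \<circ> g' = g'" using N by simp
      then show "g = g'" using GG_aut[OF g(2)] by (simp add: comp_assoc)
    qed
    moreover have "finite (rcosets\<^bsub>RB\<^esub> H \<rightarrow>\<^sub>E rcosets\<^bsub>RB\<^esub> H)" by (rule finite_PiE[OF fin]) (rule fin)
    ultimately have "finite GG" using inj_on_finite[of \<phi> GG] by blast
    then show False using GG_infinite by blast
  qed
  ultimately have "core \<subseteq> N" by (rule core_le_normal)
  then show ?thesis using ND(2) by (rule subset_trans)
qed

lemma virtually_class_S_imp_class_S_core:
  assumes "virtually_class_S RB RT"
  shows "class_S CB CT"
proof -
  obtain H where H: "subgroup H RB" "closedin RT H" "finite (rcosets\<^bsub>RB\<^esub> H)"
      "class_S (RB\<lparr>carrier := H\<rparr>) (subtopology RT H)"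
    using assms by (auto simp: virtually_class_S_def)
  have cH: "core \<subseteq> H" by (rule core_le_finite_index[OF H(1,3)])
  have gH: "group (RB\<lparr>carrier := H\<rparr>)" by (rule subgroup.subgroup_is_group[OF H(1) RB_group])
  have "core \<lhd> RB\<lparr>carrier := H\<rparr>"
    unfolding group.normal_inv_iff[OF gH]
  proof (intro conjI ballI)
    show "subgroup core (RB\<lparr>carrier := H\<rparr>)" by (rule group.subgroup_incl[OF RB_group core_subgroup H(1) cH])
    fix x h assume x: "x \<in> carrier (RB\<lparr>carrier := H\<rparr>)" and h: "h \<in> core"
    then have xG: "x \<in> GG" "x \<in> H" using subgroup_RB_D(1)[OF H(1)] by auto
    have "x \<circ> h \<circ> inv' x \<in> core" using core_normal h xG normal_RB_iff by blast
    then show "x \<otimes>\<^bsub>RB\<lparr>carrier := H\<rparr>\<^esub> h \<otimes>\<^bsub>RB\<lparr>carrier := H\<rparr>\<^esub> inv\<^bsub>RB\<lparr>carrier := H\<rparr>\<^esub> x \<in> core"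
      using group.m_inv_consistent[OF RB_group H(1) xG(2)] xG by simp
  qed
  moreover have "closedin (subtopology RT H) core" using core_closedin cH by (auto simp: closedin_subtopology)
  moreover have "core \<noteq> {\<one>\<^bsub>RB\<lparr>carrier := H\<rparr>\<^esub>}" using core_nontrivial by simp
  ultimately have "core = H" using H(4) unfolding class_S_def topologically_simple_def by auto
  then show ?thesis using H by simp
qed

lemma virtually_class_S_imp_class_R: "virtually_class_S RB RT \<Longrightarrow> class_R RB RT"
  using virtually_class_S_imp_class_S_core class_S_core_iff core_regionally_expansive class_R_iff by blast

lemma virtually_class_S_I:
  assumes "compactly_generated CB CT" "finite (rcosets\<^bsub>RB\<^esub> core)"
  shows "virtually_class_S RB RT"
  unfolding virtually_class_S_def using assms class_S_core_iff core_subgroup core_closedin by blast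

section \<open>The subgroup generated by point stabilisers\<close>

definition stab_gen :: "(nat \<Rightarrow> nat) set" where
  "stab_gen = generate (sym_group d) (\<Union>x \<in> {1..d}. point_stabilizer d F' x)"

lemma point_stabilizer_eq: "point_stabilizer d S x = {\<sigma> \<in> S. \<sigma> x = x}"
  by (simp add: point_stabilizer_def stabilizer_def)

lemma stab_gen_subgroup: "subgroup stab_gen (sym_group d)"
  unfolding stab_gen_def
proof (rule group.generate_is_subgroup[OF sym_group_is_group])
  show "(\<Union>x \<in> {1..d}. point_stabilizer d F' x) \<subseteq> carrier (sym_group d)"
    using subgroup.subset[OF F'_subgroup] by (auto simp: point_stabilizer_eq)
qed

lemmas stab_gen_closed [simp] = sym_subgroup_closed(1-3)[OF stab_gen_subgroup]

lemma stab_gen_le: "stab_gen \<subseteq> F'"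
  unfolding stab_gen_def
  by (rule group.generate_subgroup_incl[OF sym_group_is_group _ F'_subgroup]) (auto simp: point_stabilizer_eq)

lemma stab_in_stab_gen: "\<sigma> \<in> F' \<Longrightarrow> x \<in> colours \<Longrightarrow> \<sigma> x = x \<Longrightarrow> \<sigma> \<in> stab_gen"
  unfolding stab_gen_def by (rule generate.incl) (auto simp: point_stabilizer_eq colours_def)

text \<open>A subgroup containing a point stabiliser is the whole group once it is transitive.\<close>

lemma transitive_stab_gen:
  assumes "\<And>x y. x \<in> colours \<Longrightarrow> y \<in> colours \<Longrightarrow> \<exists>\<sigma> \<in> stab_gen. \<sigma> x = y"
  shows "acts_transitively d F' \<and> generated_by_point_stabilizers d F'"
proof
  show "acts_transitively d F'"
    unfolding acts_transitively_def using assms stab_gen_le unfolding colours_def by blast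
  have "\<tau> \<in> stab_gen" if \<tau>: "\<tau> \<in> F'" for \<tau>
  proof -
    obtain x where x: "x \<in> colours" using third_colour by blast
    have "\<tau> x \<in> colours" using permutes_in_image[OF F'_permutes[OF \<tau>]] x by simp
    then obtain \<sigma> where \<sigma>: "\<sigma> \<in> stab_gen" "\<sigma> x = \<tau> x" using assms x by blast
    have perm: "\<sigma> permutes colours" using \<sigma> stab_gen_le F'_permutes by blast
    have "inv' \<sigma> \<circ> \<tau> \<in> F'" using \<sigma>(1) stab_gen_le \<tau> by auto
    moreover have "(inv' \<sigma> \<circ> \<tau>) x = x" using \<sigma>(2) permutes_inverses(2)[OF perm] by (metis comp_apply)
    ultimately have "inv' \<sigma> \<circ> \<tau> \<in> stab_gen" using stab_in_stab_gen x by blast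
    then have "\<sigma> \<circ> (inv' \<sigma> \<circ> \<tau>) \<in> stab_gen" using \<sigma> by simp
    moreover have "\<sigma> \<circ> (inv' \<sigma> \<circ> \<tau>) = \<tau>" using permutes_inverses(1)[OF perm] by (simp add: fun_eq_iff)
    ultimately show ?thesis by simp
  qed
  then show "generated_by_point_stabilizers d F'"
    unfolding generated_by_point_stabilizers_def using stab_gen_le stab_gen_def by blast
qed

text \<open>Along an edge the local actions of \<open>g\<close> agree on one colour, so they lie in the same coset of
  the subgroup generated by point stabilisers; it is the trivial coset if \<open>g\<close> fixes an edge.\<close>

lemma edge_stabiliser_local:
  assumes g: "g \<in> GG" and v: "v \<in> V" and i: "i \<in> colours" and "g v = v" "g (nb v i) = nb v i" and "u \<in> V"
  shows "la g u \<in> stab_gen"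
  using \<open>u \<in> V\<close> v
proof (induction u rule: vertex_induct)
  case base
  have gaut: "g \<in> aut" using g GG_aut by blast
  have "nb v (la g v i) = nb v i" using aut_nb[OF gaut v i] assms by simp
  then have "la g v i = i" using nb_inj[OF v] gaut v i by simp
  moreover have "la g v \<in> F'" using g v by (simp add: GG_iff)
  ultimately show ?case using stab_in_stab_gen i by blast
next
  case (step x k)
  have gaut: "g \<in> aut" using g GG_aut by blast
  have perm: "la g x permutes colours" using la_permutes gaut step by blast
  have F': "la g x \<in> F'" "la g (nb x k) \<in> F'" using g step by (simp_all add: GG_iff)
  let ?\<tau> = "inv' (la g x) \<circ> la g (nb x k)"
  have "?\<tau> k = k" using la_nb_same[OF gaut step(1,2)] permutes_inverses(2)[OF perm] by simp
  then have "?\<tau> \<in> stab_gen" using stab_in_stab_gen[of ?\<tau> k] F' step by simp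
  then have "la g x \<circ> ?\<tau> \<in> stab_gen" using step by simp
  moreover have "la g x \<circ> ?\<tau> = la g (nb x k)" using permutes_inverses(1)[OF perm] by (simp add: fun_eq_iff)
  ultimately show ?case by simp
qed

section \<open>An invariant height function\<close>

text \<open>If the colours split into two classes, crossing edges moves along the Cayley graph of the
  infinite dihedral group, which is a line: from an even integer the colours of the first class
  lead up and the others down, from an odd one the other way round.\<close>

definition zigzag :: "nat set \<Rightarrow> int \<Rightarrow> nat \<Rightarrow> int" where
  "zigzag A z i = (if (i \<in> A) = even z then z + 1 else z - 1)"

definition height :: "nat set \<Rightarrow> 'v \<Rightarrow> 'v \<Rightarrow> int" where
  "height A v u = foldl (zigzag A) 0 (word v u)"

lemma zigzag_zigzag: "zigzag A (zigzag A z i) i = z"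
  by (simp add: zigzag_def)

lemma zigzag_abs: "\<bar>zigzag A z i\<bar> \<le> \<bar>z\<bar> + 1"
  by (auto simp: zigzag_def)

lemma height_self: "v \<in> V \<Longrightarrow> height A v v = 0"
  by (simp add: height_def)

lemma height_nb:
  assumes "v \<in> V" "u \<in> V" "i \<in> colours"
  shows "height A v (nb u i) = zigzag A (height A v u) i"
  using word_nb[OF assms] zigzag_zigzag by (auto simp: height_def)

lemma height_unbounded:
  assumes "v \<in> V" "x \<in> colours" "x \<in> A" "y \<in> colours" "y \<notin> A"
  shows "\<exists>u \<in> V. height A v u = int n"
proof (induction n)
  case 0
  then show ?case using assms height_self by force
next
  case (Suc n)
  then obtain u where u: "u \<in> V" "height A v u = int n" by blast
  define k where "k = (if even n then x else y)"
  have k: "k \<in> colours" "zigzag A (int n) k = int (Suc n)" using assms by (auto simp: k_def zigzag_def)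
  then show ?case using height_nb[OF assms(1) u(1) k(1), of A] u by (intro bexI[of _ "nb u k"]) auto
qed

definition stab_invariant :: "nat set \<Rightarrow> bool" where
  "stab_invariant A \<longleftrightarrow> (\<forall>\<sigma> \<in> stab_gen. \<forall>k. \<sigma> k \<in> A \<longleftrightarrow> k \<in> A)"

lemma edge_stabiliser_height:
  assumes A: "stab_invariant A"
    and v0: "v0 \<in> V" and g: "g \<in> GG" and v: "v \<in> V" and i: "i \<in> colours" and fixes_edge: "g v = v" "g (nb v i) = nb v i"
    and "u \<in> V"
  shows "height A v0 (g u) = height A v0 u"
  using \<open>u \<in> V\<close> v
proof (induction u rule: vertex_induct)
  case base
  then show ?case using fixes_edge by simp
next
  case (step x k)
  have gaut: "g \<in> aut" using g GG_aut by blast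
  have s: "la g x \<in> stab_gen" by (rule edge_stabiliser_local[OF g v i fixes_edge step(1)])
  have "height A v0 (g (nb x k)) = zigzag A (height A v0 (g x)) (la g x k)"
    using height_nb[OF v0, of "g x" "la g x k" A] aut_nb[OF gaut step(1,2)] gaut step by simp
  also have "\<dots> = zigzag A (height A v0 x) k" using step(3) A s by (simp add: zigzag_def stab_invariant_def)
  also have "\<dots> = height A v0 (nb x k)" using height_nb[OF v0 step(1,2)] by simp
  finally show ?case .
qed

lemma core_height:
  assumes A: "stab_invariant A"
    and v0: "v0 \<in> V" and g: "g \<in> core" and u: "u \<in> V"
  shows "height A v0 (g u) = height A v0 u"
proof -
  define P where "P = {g \<in> GG. \<forall>u \<in> V. height A v0 (g u) = height A v0 u}"
  have "subgroup P RB"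
    unfolding subgroup_RB_iff
  proof (intro conjI ballI)
    show "P \<subseteq> GG" "id \<in> P" by (auto simp: P_def)
    show "h \<circ> k \<in> P" if "h \<in> P" "k \<in> P" for h k using that GG_aut by (simp add: P_def)
    show "inv' h \<in> P" if h: "h \<in> P" for h
    proof -
      have hG: "h \<in> GG" and haut: "h \<in> aut" using h GG_aut by (auto simp: P_def)
      have "height A v0 (inv' h w) = height A v0 w" if w: "w \<in> V" for w
      proof -
        have "inv' h w \<in> V" using haut w by simp
        then have "height A v0 (h (inv' h w)) = height A v0 (inv' h w)" using h unfolding P_def by blast
        then show ?thesis using haut by simp
      qed
      then show ?thesis using hG by (simp add: P_def)
    qed
  qed
  moreover have "{g \<circ> a \<circ> inv' g | g a. g \<in> GG \<and> a \<in> movers} \<subseteq> P"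
  proof
    fix h assume "h \<in> {g \<circ> a \<circ> inv' g | g a. g \<in> GG \<and> a \<in> movers}"
    then obtain g a where ga: "h = g \<circ> a \<circ> inv' g" "g \<in> GG" "a \<in> movers" by blast
    obtain v i where v: "v \<in> V" "i \<in> colours" and a: "a \<in> rist UF (half v i)"
      using ga(3) by (auto simp: movers_def halves_def)
    have gaut: "g \<in> aut" using ga GG_aut by blast
    have "a v = v" using rist_off[OF a] v by simp
    moreover have "a (nb v i) = nb v i" using rist_fixes_root[of a v i] a v rist_UF by blast
    ultimately have "h (g v) = g v" "h (g (nb v i)) = g (nb v i)" using ga(1) gaut by simp_all
    then have fixed: "h (g v) = g v" "h (nb (g v) (la g v i)) = nb (g v) (la g v i)"
      using aut_nb[OF gaut v] by simp_all
    have h: "h \<in> GG" using ga movers_GG by simp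
    have "height A v0 (h u) = height A v0 u" if "u \<in> V" for u
      by (rule edge_stabiliser_height[OF A v0 h _ _ fixed that]) (simp_all add: gaut v)
    then show "h \<in> P" using h by (simp add: P_def)
  qed
  ultimately have "core \<subseteq> P" unfolding core_def using group.generate_subgroup_incl[OF RB_group] by blast
  then show ?thesis using g u by (auto simp: P_def)
qed

subsection \<open>Components of bounded height\<close>

definition band :: "nat set \<Rightarrow> 'v \<Rightarrow> nat \<Rightarrow> ('v \<times> 'v) set" where
  "band A v n = {(u, u'). u \<in> V \<and> \<bar>height A v u\<bar> \<le> int n \<and> \<bar>height A v u'\<bar> \<le> int n \<and> (\<exists>k \<in> colours. u' = nb u k)}"

text \<open>The vertices that can be reached from \<open>v\<close> while the height stays between \<open>- n\<close> and \<open>n\<close>.\<close>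

definition component :: "nat set \<Rightarrow> 'v \<Rightarrow> nat \<Rightarrow> 'v set" where
  "component A v n = {u. (v, u) \<in> (band A v n)\<^sup>*}"

lemma component_in_V:
  assumes v: "v \<in> V" and u: "u \<in> component A v n"
  shows "u \<in> V \<and> \<bar>height A v u\<bar> \<le> int n"
proof -
  have "(v, u) \<in> (band A v n)\<^sup>*" using u by (simp add: component_def)
  then show ?thesis
    by (induction rule: rtrancl_induct) (use v height_self in \<open>auto simp: band_def\<close>)
qed

lemma component_mono:
  assumes "m \<le> n" shows "component A v m \<subseteq> component A v n"
proof -
  have "band A v m \<subseteq> band A v n" using assms by (auto simp: band_def)
  then have "(band A v m)\<^sup>* \<subseteq> (band A v n)\<^sup>*" by (rule rtrancl_mono)
  then show ?thesis unfolding component_def by blast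
qed

lemma band_sym: "sym (band A v n)"
  by (rule symI) (auto simp: band_def intro!: bexI)

lemma components_exhaust:
  assumes v: "v \<in> V" and B: "finite B" "B \<subseteq> V"
  shows "\<exists>n. B \<subseteq> component A v n"
proof -
  have one: "\<exists>n. u \<in> component A v n" if "u \<in> V" for u
    using that v
  proof (induction u rule: vertex_induct)
    case base
    then show ?case by (auto simp: component_def)
  next
    case (step x k)
    then obtain n where n: "x \<in> component A v n" by blast
    have x: "x \<in> V" "\<bar>height A v x\<bar> \<le> int n" using component_in_V[OF v n] by auto
    have "(v, x) \<in> (band A v (Suc n))\<^sup>*" using n component_mono[of n "Suc n" A v] by (auto simp: component_def)
    moreover have "(x, nb x k) \<in> band A v (Suc n)"
      using x step zigzag_abs[of A "height A v x" k] height_nb[OF v, of x k A] by (auto simp: band_def)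
    ultimately show ?case unfolding component_def by (blast intro: rtrancl_into_rtrancl)
  qed
  show ?thesis
    using B
  proof (induction B)
    case empty
    then show ?case by simp
  next
    case (insert b B)
    then obtain m where m: "B \<subseteq> component A v m" by blast
    obtain k where k: "b \<in> component A v k" using one insert by blast
    have "component A v m \<subseteq> component A v (max m k)" "component A v k \<subseteq> component A v (max m k)"
      by (simp_all add: component_mono)
    then show ?case using m k by (intro exI[of _ "max m k"]) blast
  qed
qed

text \<open>Beyond a vertex of height \<open>n + 1\<close>, seen from \<open>v\<close>, the component has no points, although that half-tree
  contains further vertices of small height.\<close>

lemma component_avoids_half:
  assumes "v \<in> V" "x \<in> colours" "x \<in> A" "y \<in> colours" "y \<notin> A"
  obtains D where "D \<in> halves" "D \<inter> component A v n = {}"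
proof -
  obtain u where u: "u \<in> V" "height A v u = int (Suc n)" using height_unbounded[OF assms, of "Suc n"] by blast
  have "v \<noteq> u" using u height_self[OF assms(1), of A] by auto
  then obtain i where i: "i \<in> colours" "v \<in> half u i" using halves_cover[OF u(1) assms(1)] by blast
  have "component A v n \<subseteq> half u i"
  proof
    fix z assume "z \<in> component A v n"
    then have "(v, z) \<in> (band A v n)\<^sup>*" by (simp add: component_def)
    then show "z \<in> half u i"
    proof (induction rule: rtrancl_induct)
      case base
      show ?case by (rule i)
    next
      case (step y z)
      then obtain k where k: "k \<in> colours" "z = nb y k" "\<bar>height A v z\<bar> \<le> int n" by (auto simp: band_def)
      show ?case
      proof (rule ccontr)
        assume "z \<notin> half u i"
        then have "z = u" using half_exit[OF u(1) i(1) step.IH k(1)] k(2) by blast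
        then show False using k u by simp
      qed
    qed
  qed
  then have "(V - half u i) \<inter> component A v n = {}" by blast
  then show ?thesis using that halves_complement[OF half_in_halves[OF u(1) i(1)]] by blast
qed

text \<open>A compactly generated subgroup \<open>O\<close> of the core involves only boundedly many heights: it preserves
  one of the components, and all singularities of its elements lie there. An element of \<open>U(F)\<close>
  supported on a half-tree away from that component keeps all its \<open>O\<close>-conjugates in \<open>U(F)\<close> and
  close to the identity.\<close>

lemma core_not_regionally_expansive:
  assumes A: "stab_invariant A"
    and xy: "x \<in> colours" "x \<in> A" "y \<in> colours" "y \<notin> A"
  shows "\<not> regionally_expansive CB CT"
proof
  assume "regionally_expansive CB CT"
  then obtain H U where H: "subgroup H CB" "openin CT H" "compactly_generated (CB\<lparr>carrier := H\<rparr>) (subtopology CT H)"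
    and U: "subgroup U (CB\<lparr>carrier := H\<rparr>)" "openin (subtopology CT H) U"
      "(\<Inter>g \<in> H. g <#\<^bsub>CB\<^esub> U #>\<^bsub>CB\<^esub> inv\<^bsub>CB\<^esub> g) = {\<one>\<^bsub>CB\<^esub>}"
    unfolding regionally_expansive_def by (elim conjE exE) (rule that)
  have Hc: "H \<subseteq> core" using subgroup.subset[OF H(1)] by simp
  have HRB: "subgroup H RB" by (rule group.incl_subgroup[OF RB_group core_subgroup H(1)])
  obtain K where K: "compactin (subtopology CT H) K" "generate (CB\<lparr>carrier := H\<rparr>) K = H"
    using H(3) by (auto simp: compactly_generated_def)
  have KR: "compactin RT K" and KH: "K \<subseteq> H" using K(1) by (auto simp: compactin_subtopology)
  have gen: "generate RB K = H" using group.generate_consistent[OF RB_group KH HRB] K(2) by simp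
  have "openin CT U" by (rule openin_trans_full[OF U(2) H(2)])
  then have UR: "openin RT U" by (rule openin_trans_full[OF _ core_openin])
  have "id \<in> U" using subgroup.one_closed[OF U(1)] by simp
  then obtain A0 where A0: "finite A0" "A0 \<subseteq> V" "\<forall>h \<in> fixator A0. id \<circ> h \<in> U" using openin_RT_E[OF UR] by blast
  obtain v where v: "v \<in> V" using vertices_nonempty by blast
  have KG: "k \<in> GG" if "k \<in> K" for k by (rule core_GG[OF subsetD[OF Hc subsetD[OF KH that]]])
  \<comment> \<open>On such a coset the image of \<open>v\<close> and the singularities are those of \<open>k\<close>, so finitely many heights
      suffice for all of \<open>K\<close>.\<close>
  define N where "N k = (\<circ>) k ` fixator (insert v (sing k))" for k
  have sing_fin: "finite (insert v (sing k))" "insert v (sing k) \<subseteq> V" if "k \<in> K" for k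
    using KG[OF that] v by (auto simp: GG_iff sing_def)
  have N_open: "openin RT W" if W: "W \<in> N ` K" for W
  proof -
    obtain k where k: "k \<in> K" "W = N k" using W by blast
    show ?thesis unfolding k(2) N_def by (rule openin_coset[OF KG[OF k(1)] sing_fin[OF k(1)]])
  qed
  have cover: "K \<subseteq> \<Union>(N ` K)"
  proof
    fix k assume "k \<in> K"
    moreover have "k \<in> N k" unfolding N_def by (rule image_eqI[of _ _ id]) simp_all
    ultimately show "k \<in> \<Union>(N ` K)" by (rule UN_I[of k K k N])
  qed
  have "\<exists>\<F>. finite \<F> \<and> \<F> \<subseteq> N ` K \<and> K \<subseteq> \<Union>\<F>" by (rule compactinD[OF KR N_open cover])
  then obtain \<F> where \<F>: "finite \<F>" "\<F> \<subseteq> N ` K" "K \<subseteq> \<Union>\<F>" by (elim exE conjE) (rule that)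
  obtain K0 where K0: "K0 \<subseteq> K" "finite K0" "\<F> = N ` K0" using finite_subset_image[OF \<F>(1,2)] by blast
  define B where "B = A0 \<union> (\<Union>k \<in> K0. insert (k v) (sing k))"
  have fin_k: "finite (insert (k v) (sing k)) \<and> insert (k v) (sing k) \<subseteq> V" if "k \<in> K0" for k
  proof -
    have kK: "k \<in> K" using that K0(1) by blast
    then have "k v \<in> V" using GG_aut[OF KG[OF kK]] v by simp
    then show ?thesis using sing_fin[OF kK] by (simp only: finite_insert insert_subset simp_thms)
  qed
  have "finite (\<Union>k \<in> K0. insert (k v) (sing k))" by (rule finite_UN_I[OF K0(2)]) (rule conjunct1[OF fin_k])
  then have Bf: "finite B" unfolding B_def using A0(1) by (rule finite_UnI[rotated])
  have "(\<Union>k \<in> K0. insert (k v) (sing k)) \<subseteq> V" by (rule UN_least) (rule conjunct2[OF fin_k])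
  then have BV: "B \<subseteq> V" unfolding B_def using A0(2) by (rule Un_least[rotated])
  obtain n where n: "B \<subseteq> component A v n" using components_exhaust[OF v Bf BV, of A] by (rule exE)
  define Y where "Y = component A v n"
  have YV: "Y \<subseteq> V" unfolding Y_def using component_in_V[OF v] by blast
  have step: "(g u, g u') \<in> (band A v n)\<^sup>*" if g: "g \<in> core" and uu: "(u, u') \<in> (band A v n)\<^sup>*" for g u u'
    using uu
  proof (induction rule: rtrancl_induct)
    case (step w z)
    then obtain k where k: "w \<in> V" "k \<in> colours" "z = nb w k" "\<bar>height A v w\<bar> \<le> int n" "\<bar>height A v z\<bar> \<le> int n"
      by (auto simp: band_def)
    have gaut: "g \<in> aut" using g core_GG GG_aut by blast
    have "height A v (g w) = height A v w" "height A v (g z) = height A v z"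
      using core_height[OF A v g] k by simp_all
    moreover have "g z = nb (g w) (la g w k)" "la g w k \<in> colours" "g w \<in> V"
      using aut_nb[OF gaut k(1,2)] gaut k by simp_all
    ultimately have "(g w, g z) \<in> band A v n" using k(4,5) unfolding band_def by auto
    with step.IH show ?case by (rule rtrancl_into_rtrancl)
  qed simp
  have Y_inv: "g u \<in> Y" if "g \<in> core" "g v \<in> Y" "u \<in> Y" for g u
  proof -
    have "(v, g v) \<in> (band A v n)\<^sup>*" "(v, u) \<in> (band A v n)\<^sup>*"
      using that(2,3) by (simp_all add: Y_def component_def)
    then have "(v, g u) \<in> (band A v n)\<^sup>*" using rtrancl_trans[OF _ step[OF that(1)]] by blast
    then show ?thesis by (simp add: Y_def component_def)
  qed
  define Z where "Z = {g \<in> core. g v \<in> Y \<and> sing g \<subseteq> Y}"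
  have Z_aut: "g \<in> aut" if "g \<in> Z" for g using that core_GG GG_aut unfolding Z_def by blast
  have Z_Y: "g u \<in> Y" if "g \<in> Z" "u \<in> Y" for g u using that Y_inv unfolding Z_def by blast
  have Z_inv: "inv' g v \<in> Y" if g: "g \<in> Z" for g
  proof -
    have "(inv' g v, inv' g (g v)) \<in> (band A v n)\<^sup>*"
      using step[of "inv' g" v "g v"] g by (simp add: Z_def Y_def component_def)
    then have "(inv' g v, v) \<in> (band A v n)\<^sup>*" using Z_aut[OF g] by simp
    then show ?thesis using sym_rtrancl[OF band_sym] by (auto simp: Y_def component_def dest: symD)
  qed
  have Z_sub: "subgroup Z RB"
    unfolding subgroup_RB_iff
  proof (intro conjI ballI)
    show "Z \<subseteq> GG" using core_GG by (auto simp: Z_def)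
    have "sing id = {}" using UF_id UF_iff_sing by blast
    then show "id \<in> Z" using v by (simp add: Z_def Y_def component_def)
    show inv_Z: "inv' g \<in> Z" if g: "g \<in> Z" for g
    proof -
      have "sing (inv' g) \<subseteq> Y" using sing_inv[OF Z_aut[OF g]] Z_Y[OF g] g unfolding Z_def by blast
      then show ?thesis using g Z_inv[OF g] by (simp add: Z_def)
    qed
    show "g \<circ> h \<in> Z" if g: "g \<in> Z" and h: "h \<in> Z" for g h
    proof -
      have "inv' h ` sing g \<subseteq> Y" using g Z_Y[OF inv_Z[OF h]] by (auto simp: Z_def)
      moreover have "sing h \<subseteq> Y" using h by (simp add: Z_def)
      ultimately have "sing (g \<circ> h) \<subseteq> Y" using sing_comp[OF Z_aut[OF g] Z_aut[OF h]] by blast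
      moreover have "g (h v) \<in> Y" using Z_Y[OF g] h by (simp add: Z_def)
      ultimately show ?thesis using g h by (simp add: Z_def)
    qed
  qed
  have "K \<subseteq> Z"
  proof
    fix k' assume k': "k' \<in> K"
    then obtain k where k: "k \<in> K0" "k' \<in> N k" using \<F>(3) K0(3) by blast
    then obtain h where h: "h \<in> fixator (insert v (sing k))" "k' = k \<circ> h" unfolding N_def by blast
    have kaut: "k \<in> aut" using k K0 KG GG_aut by blast
    have "sing h = {}" using fixator_UF[OF h(1)] UF_iff_sing by blast
    moreover have "inv' h ` sing k = sing k"
      using fixator_fix[OF fixator_closed(3)[OF h(1)]] by (auto simp: image_iff)
    ultimately have "sing k' \<subseteq> sing k" using sing_comp[OF kaut fixator_aut[OF h(1)]] h(2) by simp
    moreover have "k' v = k v" using fixator_fix[OF h(1), of v] h(2) by simp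
    moreover have "insert (k v) (sing k) \<subseteq> Y" using n k unfolding B_def Y_def by blast
    ultimately show "k' \<in> Z" using k' KH Hc unfolding Z_def by auto
  qed
  then have "generate RB K \<subseteq> Z" using group.generate_subgroup_incl[OF RB_group _ Z_sub] by blast
  then have HZ: "H \<subseteq> Z" using gen by simp
  obtain D where D: "D \<in> halves" "D \<inter> Y = {}" unfolding Y_def using component_avoids_half[OF v xy] by blast
  obtain h where h: "h \<in> rist UF D" "h \<noteq> id" using rist_UF_nontrivial[OF D(1)] by blast
  have haut: "h \<in> aut" and hU: "h \<in> UF" and hr: "h \<in> rist aut D" using h(1) rist_UF UF_aut by auto
  \<comment> \<open>At vertices of \<open>Y\<close> the conjugate has trivial local action because \<open>h\<close> does nothing there; elsewhere
      \<open>g\<close> has no singularities.\<close>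
  have "h \<in> (\<Inter>g \<in> H. g <#\<^bsub>CB\<^esub> U #>\<^bsub>CB\<^esub> inv\<^bsub>CB\<^esub> g)"
  proof (rule INT_I)
    fix g assume g: "g \<in> H"
    have gZ: "g \<in> Z" and gaut: "g \<in> aut" and gc: "g \<in> core" using g HZ Z_aut Hc by auto
    have gY: "g u \<in> Y \<longleftrightarrow> u \<in> Y" for u
      using Z_Y[OF gZ, of u] Z_Y[OF subgroup_RB_D(4)[OF Z_sub gZ], of "g u"] gaut by auto
    have hY: "h u = u" if "u \<in> Y" for u using rist_off[OF hr] D that by blast
    have "la (inv' g \<circ> h \<circ> g) u \<in> F" if u: "u \<in> V" for u
    proof -
      have la: "la (inv' g \<circ> h \<circ> g) u = inv' (la g (inv' g (h (g u)))) \<circ> la h (g u) \<circ> la g u"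
        using u gaut haut by (simp add: la_comp la_inv comp_assoc)
      show ?thesis
      proof (cases "u \<in> Y")
        case True
        then have "g u \<in> Y" by (simp add: gY)
        then have "h (g u) = g u" "la h (g u) = id" using hY rist_la_off[OF hr D(1), of "g u"] u gaut D(2) by auto
        then have "la (inv' g \<circ> h \<circ> g) u = inv' (la g u) \<circ> la g u" using la gaut by simp
        also have "\<dots> = id" using permutes_inv_o(2) la_permutes[OF gaut u] by blast
        finally show ?thesis by simp
      next
        case False
        have "h (g u) \<notin> Y"
        proof
          assume a: "h (g u) \<in> Y"
          then have "h (h (g u)) = h (g u)" by (rule hY)
          then have "h (g u) = g u" using haut by simp
          then show False using a False gY by simp
        qed
        then have "inv' g (h (g u)) \<notin> Y" using gY[of "inv' g (h (g u))"] gaut by simp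
        moreover have sg: "sing g \<subseteq> Y" using gZ by (simp add: Z_def)
        ultimately have "inv' g (h (g u)) \<notin> sing g" "u \<notin> sing g" using False by auto
        then have "la g (inv' g (h (g u))) \<in> F" "la g u \<in> F" using u gaut haut by (auto simp: sing_def)
        moreover have "la h (g u) \<in> F" using hU u gaut by (simp add: UF_iff)
        ultimately show ?thesis using la by simp
      qed
    qed
    then have "inv' g \<circ> h \<circ> g \<in> UF" using gaut haut by (simp add: UF_iff)
    moreover have "(inv' g \<circ> h \<circ> g) a = a" if "a \<in> A0" for a
    proof -
      have "a \<in> Y" using that n by (auto simp: B_def Y_def)
      then show ?thesis using hY[of "g a"] gY gaut by simp
    qed
    ultimately have "inv' g \<circ> h \<circ> g \<in> fixator A0" by (simp add: fixator_def)
    then have "id \<circ> (inv' g \<circ> h \<circ> g) \<in> U" using A0(3) by blast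
    then have "inv' g \<circ> h \<circ> g \<in> U" by simp
    then show "h \<in> g <#\<^bsub>CB\<^esub> U #>\<^bsub>CB\<^esub> inv\<^bsub>CB\<^esub> g"
      using conjugate_set[OF core_subgroup gc] conjugate_mem_iff[OF gaut] by simp
  qed
  then have "h \<in> {\<one>\<^bsub>CB\<^esub>}" unfolding U(3) .
  then show False using h(2) by simp
qed

text \<open>If no element of the subgroup generated by point stabilisers maps \<open>x\<close> to \<open>y\<close>, its orbit of \<open>x\<close> is an
  invariant class of colours that separates them.\<close>

lemma class_R_imp_local:
  assumes "class_R RB RT"
  shows "acts_transitively d F' \<and> generated_by_point_stabilizers d F'"
proof (rule transitive_stab_gen, rule ccontr)
  fix x y assume xy: "x \<in> colours" "y \<in> colours" and no: "\<not> (\<exists>\<sigma> \<in> stab_gen. \<sigma> x = y)"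
  define A where "A = {\<sigma> x | \<sigma>. \<sigma> \<in> stab_gen}"
  have "\<sigma> k \<in> A \<longleftrightarrow> k \<in> A" if \<sigma>: "\<sigma> \<in> stab_gen" for \<sigma> k
  proof
    assume "k \<in> A"
    then obtain \<tau> where "\<tau> \<in> stab_gen" "k = \<tau> x" by (auto simp: A_def)
    then have "\<sigma> \<circ> \<tau> \<in> stab_gen" "\<sigma> k = (\<sigma> \<circ> \<tau>) x" using \<sigma> by simp_all
    then show "\<sigma> k \<in> A" unfolding A_def by blast
  next
    assume "\<sigma> k \<in> A"
    then obtain \<tau> where \<tau>: "\<tau> \<in> stab_gen" "\<sigma> k = \<tau> x" by (auto simp: A_def)
    have "\<sigma> permutes colours" using \<sigma> stab_gen_le F'_permutes by blast
    then have "k = (inv' \<sigma> \<circ> \<tau>) x" using \<tau>(2) permutes_inverses(2) by (metis comp_apply)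
    moreover have "inv' \<sigma> \<circ> \<tau> \<in> stab_gen" using \<sigma> \<tau> by simp
    ultimately show "k \<in> A" unfolding A_def by blast
  qed
  moreover have "x \<in> A" unfolding A_def using stab_gen_closed(1) by (metis (mono_tags, lifting) id_apply mem_Collect_eq)
  moreover have "y \<notin> A" using no by (auto simp: A_def)
  ultimately have "\<not> regionally_expansive CB CT"
    using core_not_regionally_expansive[of A x y] xy by (simp add: stab_invariant_def)
  then show False using assms class_R_iff by simp
qed

section \<open>The core has finite index\<close>

definition coset :: "('v \<Rightarrow> 'v) \<Rightarrow> ('v \<Rightarrow> 'v) set" where
  "coset g = core #>\<^bsub>RB\<^esub> g"

lemma coset_eq_iff:
  assumes "g \<in> GG" "h \<in> GG"
  shows "coset g = coset h \<longleftrightarrow> g \<circ> inv' h \<in> core"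
proof
  assume "coset g = coset h"
  moreover have "g \<in> coset g" using group.rcos_self[OF RB_group _ core_subgroup, of g] assms by (simp add: coset_def)
  ultimately obtain m where "m \<in> core" "g = m \<circ> h" by (auto simp: coset_def r_coset_def)
  moreover have "(m \<circ> h) \<circ> inv' h = m" using GG_aut[OF assms(2)] by (simp add: comp_assoc)
  ultimately show "g \<circ> inv' h \<in> core" by simp
next
  assume m: "g \<circ> inv' h \<in> core"
  have "g = (g \<circ> inv' h) \<circ> h" using GG_aut[OF assms(2)] by (simp add: comp_assoc)
  then have "g \<in> coset h" unfolding coset_def r_coset_def using m by auto
  then show "coset g = coset h"
    unfolding coset_def using group.repr_independence[OF RB_group, of g core h] assms core_subgroup by simp
qed

lemma coset_comp:
  assumes "g \<in> GG" "h \<in> GG"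
  shows "coset (g \<circ> h) = coset g <#>\<^bsub>RB\<^esub> coset h"
  using normal.rcos_sum[OF core_normal, of g h] assms by (simp add: coset_def)

definition centralised :: "('v \<Rightarrow> 'v) set \<Rightarrow> ('v \<Rightarrow> 'v) set" where
  "centralised S = {g \<in> GG. \<forall>s \<in> S. coset (g \<circ> s) = coset (s \<circ> g)}"

lemma centralised_subgroup:
  assumes S: "S \<subseteq> GG"
  shows "subgroup (centralised S) RB"
  unfolding subgroup_RB_iff
proof (intro conjI ballI)
  show "centralised S \<subseteq> GG" "id \<in> centralised S" by (auto simp: centralised_def)
next
  fix g h assume gh: "g \<in> centralised S" "h \<in> centralised S"
  then have G: "g \<in> GG" "h \<in> GG" by (auto simp: centralised_def)
  have "coset ((g \<circ> h) \<circ> s) = coset (s \<circ> (g \<circ> h))" if s: "s \<in> S" for s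
  proof -
    have sG: "s \<in> GG" using S s by blast
    have e: "coset (h \<circ> s) = coset (s \<circ> h)" "coset (g \<circ> s) = coset (s \<circ> g)" using gh s by (auto simp: centralised_def)
    have "coset ((g \<circ> h) \<circ> s) = coset (g \<circ> (h \<circ> s))" by (simp add: comp_assoc)
    also have "\<dots> = coset g <#>\<^bsub>RB\<^esub> coset (s \<circ> h)" using coset_comp[of g "h \<circ> s"] G sG e by simp
    also have "\<dots> = coset ((g \<circ> s) \<circ> h)" using coset_comp[of g "s \<circ> h"] G sG by (simp add: comp_assoc)
    also have "\<dots> = coset (s \<circ> g) <#>\<^bsub>RB\<^esub> coset h" using coset_comp[of "g \<circ> s" h] G sG e by simp
    also have "\<dots> = coset (s \<circ> (g \<circ> h))" using coset_comp[of "s \<circ> g" h] G sG by (simp add: comp_assoc)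
    finally show ?thesis .
  qed
  then show "g \<circ> h \<in> centralised S" using G by (simp add: centralised_def)
next
  fix g assume g: "g \<in> centralised S"
  then have G: "g \<in> GG" "inv' g \<in> GG" by (auto simp: centralised_def)
  have gaut: "g \<in> aut" by (rule GG_aut[OF G(1)])
  have "coset (inv' g \<circ> s) = coset (s \<circ> inv' g)" if s: "s \<in> S" for s
  proof -
    have sG: "s \<in> GG" using S s by blast
    have e: "coset (g \<circ> s) = coset (s \<circ> g)" using g s by (auto simp: centralised_def)
    have "coset (inv' g \<circ> s) = coset (inv' g \<circ> ((s \<circ> g) \<circ> inv' g))" using gaut by (simp add: comp_assoc)
    also have "\<dots> = coset (inv' g) <#>\<^bsub>RB\<^esub> (coset (s \<circ> g) <#>\<^bsub>RB\<^esub> coset (inv' g))"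
      using coset_comp[of "inv' g" "(s \<circ> g) \<circ> inv' g"] coset_comp[of "s \<circ> g" "inv' g"] G sG by simp
    also have "\<dots> = coset (inv' g) <#>\<^bsub>RB\<^esub> (coset (g \<circ> s) <#>\<^bsub>RB\<^esub> coset (inv' g))" by (simp add: e)
    also have "\<dots> = coset (inv' g \<circ> ((g \<circ> s) \<circ> inv' g))"
      using coset_comp[of "inv' g" "(g \<circ> s) \<circ> inv' g"] coset_comp[of "g \<circ> s" "inv' g"] G sG by simp
    also have "inv' g \<circ> ((g \<circ> s) \<circ> inv' g) = s \<circ> inv' g" using gaut by (simp add: fun_eq_iff)
    finally show ?thesis .
  qed
  then show "inv' g \<in> centralised S" using G by (simp add: centralised_def)
qed

text \<open>Modulo the core, an element supported on a half-tree can be moved into any other half-tree, in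
  particular away from the support of another such element.\<close>

lemma rist_commute_mod_core:
  assumes D: "D \<in> halves" "D' \<in> halves" and a: "a \<in> rist GG D" and b: "b \<in> rist GG D'"
  shows "coset (a \<circ> b) = coset (b \<circ> a)"
proof -
  obtain u1 u2 where u12: "u1 \<in> movers" "u2 \<in> movers" "(u1 \<circ> u2) ` (V - (V - D)) \<subseteq> V - D'"
    using movers_half_into_half[OF halves_complement[OF D(1)] halves_complement[OF D(2)]] by blast
  define u where "u = u1 \<circ> u2"
  have uD: "u ` D \<subseteq> V - D'" using u12(3) halves_subset[OF D(1)] by (simp add: u_def double_diff)
  have uc: "u \<in> core" using movers_core u12 by (simp add: u_def)
  then have uG: "u \<in> GG" by (rule core_GG)
  have G: "a \<in> GG" "b \<in> GG" and r: "a \<in> rist aut D" "b \<in> rist aut D'" using a b rist_GG by auto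
  note auts = GG_aut[OF uG] GG_aut[OF G(1)] GG_aut[OF G(2)]
  define a' where "a' = u \<circ> a \<circ> inv' u"
  have a'G: "a' \<in> GG" using uG G by (simp add: a'_def)
  have "a' \<in> rist aut (u ` D)" unfolding a'_def by (rule rist_conj[OF r(1) auts(1)])
  then have comm: "a' \<circ> b = b \<circ> a'" using rist_commute[OF _ r(2)] uD by blast
  have "a' \<circ> inv' a = u \<circ> (a \<circ> inv' u \<circ> inv' a)" by (simp add: a'_def comp_assoc)
  moreover have "a \<circ> inv' u \<circ> inv' a \<in> core" using core_normal G uc core_closed(3) unfolding normal_RB_iff by blast
  ultimately have "a' \<circ> inv' a \<in> core" using uc core_closed(2) by simp
  then have e: "coset a' = coset a" using coset_eq_iff[OF a'G G(1)] by simp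
  have "coset (a \<circ> b) = coset (a' \<circ> b)" using coset_comp a'G G e by simp
  also have "\<dots> = coset (b \<circ> a)" unfolding comm using coset_comp a'G G e by simp
  finally show ?thesis .
qed

text \<open>The group generated by all elements that fix both ends of some edge; by independence it is enough to
  take those that are supported on one side of it.\<close>

definition edge_group :: "('v \<Rightarrow> 'v) set" where
  "edge_group = generate RB (\<Union>D \<in> halves. rist GG D)"

lemma edge_group_generators: "(\<Union>D \<in> halves. rist GG D) \<subseteq> carrier RB"
  by (auto simp: rist_GG)

lemma edge_group_subgroup: "subgroup edge_group RB"
  unfolding edge_group_def by (rule group.generate_is_subgroup[OF RB_group edge_group_generators])

lemma rist_edge_group: "D \<in> halves \<Longrightarrow> a \<in> rist GG D \<Longrightarrow> a \<in> edge_group"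
  unfolding edge_group_def by (rule generate.incl) blast

lemma edge_group_commute_mod_core:
  assumes "g \<in> edge_group" "h \<in> edge_group"
  shows "coset (g \<circ> h) = coset (h \<circ> g)"
proof -
  let ?S = "\<Union>D \<in> halves. rist GG D"
  have S: "?S \<subseteq> GG" using edge_group_generators by simp
  have "?S \<subseteq> centralised ?S" using rist_commute_mod_core S unfolding centralised_def by blast
  then have one: "edge_group \<subseteq> centralised ?S"
    unfolding edge_group_def by (rule group.generate_subgroup_incl[OF RB_group _ centralised_subgroup[OF S]])
  have EG: "edge_group \<subseteq> GG" by (rule subgroup_RB_D(1)[OF edge_group_subgroup])
  have "?S \<subseteq> centralised edge_group"
  proof
    fix s assume s: "s \<in> ?S"
    have "coset (s \<circ> x) = coset (x \<circ> s)" if x: "x \<in> edge_group" for x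
    proof -
      have "\<forall>s \<in> ?S. coset (x \<circ> s) = coset (s \<circ> x)"
        using subsetD[OF one x] unfolding centralised_def mem_Collect_eq by (rule conjunct2)
      from bspec[OF this s] show ?thesis by (rule sym)
    qed
    moreover have "s \<in> GG" by (rule subsetD[OF S s])
    ultimately show "s \<in> centralised edge_group" unfolding centralised_def by simp
  qed
  then have "edge_group \<subseteq> centralised edge_group"
    using group.generate_subgroup_incl[OF RB_group _ centralised_subgroup[OF EG]] unfolding edge_group_def by blast
  then show ?thesis using assms unfolding centralised_def by blast
qed

lemma fixes_edge_edge_group:
  assumes "g \<in> GG" "v \<in> V" "i \<in> colours" "g v = v" "g (nb v i) = nb v i"
  shows "g \<in> edge_group"
proof -
  obtain x y where xy: "x \<in> rist GG (half v i)" "y \<in> rist GG (V - half v i)" "sing x \<subseteq> sing g"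
      "sing y \<subseteq> sing g" "g = x \<circ> y"
    by (rule edge_split[OF assms]) (rule that)
  have h: "half v i \<in> halves" "V - half v i \<in> halves" using half_in_halves[OF assms(2,3)] halves_complement by auto
  show ?thesis
    unfolding xy(5) by (rule subgroup_RB_D(3)[OF edge_group_subgroup rist_edge_group[OF h(1) xy(1)] rist_edge_group[OF h(2) xy(2)]])
qed

lemma edge_group_local_action:
  assumes v: "v \<in> V" and "\<sigma> \<in> stab_gen"
  shows "\<exists>h \<in> edge_group. h v = v \<and> la h v = \<sigma>"
proof -
  have EG: "h \<in> aut" if "h \<in> edge_group" for h using that subgroup_RB_D(1)[OF edge_group_subgroup] GG_aut by blast
  have stab: "\<exists>h \<in> edge_group. h v = v \<and> la h v = \<sigma>" if s: "\<sigma> \<in> (\<Union>x \<in> {1..d}. point_stabilizer d F' x)" for \<sigma>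
  proof -
    obtain x where x: "x \<in> colours" "\<sigma> \<in> F'" "\<sigma> x = x" using s by (auto simp: point_stabilizer_eq colours_def)
    obtain h where h: "h \<in> rist GG (V - half v x)" "h v = v" "la h v = \<sigma>" using half_extension[OF v x] by blast
    have "h \<in> edge_group" by (rule rist_edge_group[OF halves_complement[OF half_in_halves[OF v x(1)]] h(1)])
    then show ?thesis using h(2,3) by (intro bexI conjI)
  qed
  show ?thesis
    using assms(2) unfolding stab_gen_def
  proof (induction \<sigma> rule: generate.induct)
    case one
    have "la id v = \<one>\<^bsub>sym_group d\<^esub>" using la_id[OF v] by (simp only: sym_group_one)
    then show ?case using subgroup_RB_D(2)[OF edge_group_subgroup] by (intro bexI[of _ id] conjI id_apply)
  next
    case (incl \<sigma>)
    then show ?case by (rule stab)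
  next
    case (inv \<sigma>)
    obtain h where h: "h \<in> edge_group" "h v = v" "la h v = \<sigma>" using stab[OF inv] by (elim bexE conjE) (rule that)
    have iv: "inv' h v = v" using aut_inv_simps(2)[OF EG[OF h(1)], of v] h(2) by simp
    have "\<sigma> \<in> carrier (sym_group d)" using h(3) la_permutes[OF EG[OF h(1)] v] by (simp add: sym_group_carrier colours_def)
    then have "la (inv' h) v = inv\<^bsub>sym_group d\<^esub> \<sigma>" using la_inv[OF EG[OF h(1)] v] iv h(3) by simp
    then show ?case using subgroup_RB_D(4)[OF edge_group_subgroup h(1)] iv by (intro bexI conjI)
  next
    case (eng \<sigma> \<tau>)
    obtain h where h: "h \<in> edge_group" "h v = v" "la h v = \<sigma>" using eng(3) by (elim bexE conjE) (rule that)
    obtain k where k: "k \<in> edge_group" "k v = v" "la k v = \<tau>" using eng(4) by (elim bexE conjE) (rule that)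
    have "la (h \<circ> k) v = \<sigma> \<otimes>\<^bsub>sym_group d\<^esub> \<tau>" using la_comp[OF EG[OF h(1)] EG[OF k(1)] v] h k by (simp add: sym_group_mult)
    moreover have "(h \<circ> k) v = v" using h k by simp
    ultimately show ?case using subgroup_RB_D(3)[OF edge_group_subgroup h(1) k(1)] by (intro bexI conjI)
  qed
qed

text \<open>This group is compact, as it contains the vertex stabiliser of \<open>U(F)\<close> with finite index. If \<open>F'\<close> is
  transitive, it generates \<open>G(F, F')\<close> together with an inversion of an edge at \<open>v\<close>.\<close>

definition local_stab :: "'v \<Rightarrow> ('v \<Rightarrow> 'v) set" where
  "local_stab v = {g \<in> GG. g v = v \<and> sing g \<subseteq> {v}}"

lemma local_stab_D:
  assumes "g \<in> local_stab v"
  shows "g \<in> GG" "g \<in> aut" "g v = v" "sing g \<subseteq> {v}" "inv' g v = v"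
proof -
  show g: "g \<in> GG" "g v = v" "sing g \<subseteq> {v}" using assms by (auto simp: local_stab_def)
  show "g \<in> aut" by (rule GG_aut[OF g(1)])
  from aut_inv_simps(2)[OF this, of v] show "inv' g v = v" using g by simp
qed

lemma local_stab_subgroup: "subgroup (local_stab v) RB"
  unfolding subgroup_RB_iff
proof (intro conjI ballI)
  show "local_stab v \<subseteq> GG" by (auto simp: local_stab_def)
  have "sing id = {}" using UF_id UF_iff_sing by blast
  then show "id \<in> local_stab v" by (simp add: local_stab_def)
next
  fix g h assume g: "g \<in> local_stab v" and h: "h \<in> local_stab v"
  note gD = local_stab_D[OF g] and hD = local_stab_D[OF h]
  have "inv' h ` sing g \<subseteq> {v}" using gD(4) hD(5) by auto
  then have "sing (g \<circ> h) \<subseteq> {v}" using sing_comp[OF gD(2) hD(2)] hD(4) by blast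
  then show "g \<circ> h \<in> local_stab v" using gD hD by (simp add: local_stab_def)
next
  fix g assume g: "g \<in> local_stab v"
  note gD = local_stab_D[OF g]
  have "g ` sing g \<subseteq> {v}" using gD(3,4) by auto
  then have "sing (inv' g) \<subseteq> {v}" using sing_inv[OF gD(2)] by blast
  then show "inv' g \<in> local_stab v" using gD by (simp add: local_stab_def)
qed

lemma fixator_local_stab: "fixator {v} \<subseteq> local_stab v"
  using UF_iff_sing by (auto simp: fixator_def local_stab_def)

lemma local_stab_same_local_action:
  assumes v: "v \<in> V" and g: "g \<in> local_stab v" and h: "h \<in> local_stab v" and eq: "la g v = la h v"
  shows "inv' g \<circ> h \<in> fixator (insert v (nb v ` colours))"
proof -
  let ?k = "inv' g \<circ> h"
  note gD = local_stab_D[OF g] and hD = local_stab_D[OF h]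
  have k: "?k \<in> local_stab v" by (rule subgroup_RB_D(3)[OF local_stab_subgroup subgroup_RB_D(4)[OF local_stab_subgroup g] h])
  note kD = local_stab_D[OF k]
  have "la ?k v = inv' (la g v) \<circ> la g v"
    using la_comp[of "inv' g" h v] la_inv[of g v] gD hD v eq by simp
  also have "\<dots> = id" using permutes_inv_o(2) la_permutes[OF gD(2) v] by blast
  finally have la: "la ?k v = id" .
  then have "sing ?k = {}" using kD(4) by (auto simp: sing_def)
  then have "?k \<in> UF" using kD(1) UF_iff_sing by blast
  moreover have "?k (nb v i) = nb v i" if "i \<in> colours" for i using aut_nb[OF kD(2) v that] kD(3) la by simp
  ultimately show ?thesis using kD(3) unfolding fixator_def by blast
qed

text \<open>Up to the fixator of a ball, an element is determined by its local action at the centre.\<close>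

lemma local_stab_transversal:
  assumes v: "v \<in> V"
  obtains T where "finite T" "T \<subseteq> local_stab v"
    "\<forall>g \<in> local_stab v. \<exists>t \<in> T. inv' t \<circ> g \<in> fixator (insert v (nb v ` colours))"
proof -
  define pick where "pick \<sigma> = (SOME g. g \<in> local_stab v \<and> la g v = \<sigma>)" for \<sigma>
  define T where "T = (\<lambda>g. pick (la g v)) ` local_stab v"
  have pick: "pick (la g v) \<in> local_stab v \<and> la (pick (la g v)) v = la g v" if "g \<in> local_stab v" for g
    unfolding pick_def by (rule someI[of _ g]) (simp add: that)
  have "(\<lambda>g. la g v) ` local_stab v \<subseteq> F'" using v by (auto simp: local_stab_def GG_iff)
  then have "finite ((\<lambda>g. la g v) ` local_stab v)" using finite_F' by (rule finite_subset)
  then have "finite (pick ` ((\<lambda>g. la g v) ` local_stab v))" by (rule finite_imageI)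
  then have "finite T" by (simp add: T_def image_image)
  moreover have "T \<subseteq> local_stab v" using pick by (auto simp: T_def)
  moreover have "\<exists>t \<in> T. inv' t \<circ> g \<in> fixator (insert v (nb v ` colours))" if g: "g \<in> local_stab v" for g
  proof
    show "pick (la g v) \<in> T" using g by (simp add: T_def)
    show "inv' (pick (la g v)) \<circ> g \<in> fixator (insert v (nb v ` colours))"
      using local_stab_same_local_action[OF v] pick[OF g] g by simp
  qed
  ultimately show ?thesis using that by simp
qed

lemma local_stab_compact:
  assumes v: "v \<in> V"
  shows "compactin RT (local_stab v)"
proof -
  obtain T where T: "finite T" "T \<subseteq> local_stab v"
    "\<forall>g \<in> local_stab v. \<exists>t \<in> T. inv' t \<circ> g \<in> fixator (insert v (nb v ` colours))"
    using local_stab_transversal[OF v] by blast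
  have "compactin RT ((\<circ>) t ` fixator {v})" if "t \<in> T" for t
  proof -
    have "t \<in> GG" using that T(2) local_stab_D(1) by blast
    then show ?thesis
      using image_compactin[OF fixator_vertex_compact[OF v] continuous_left_translation[OF RT_topological_group, of t]] by simp
  qed
  then have "compactin RT (\<Union>t \<in> T. (\<circ>) t ` fixator {v})" using T(1) by (intro compactin_Union) auto
  moreover have "local_stab v \<subseteq> (\<Union>t \<in> T. (\<circ>) t ` fixator {v})"
  proof
    fix g assume g: "g \<in> local_stab v"
    obtain t where t: "t \<in> T" "inv' t \<circ> g \<in> fixator (insert v (nb v ` colours))" using T(3) g by blast
    have "inv' t \<circ> g \<in> fixator {v}" using t(2) fixator_antimono[of "{v}" "insert v (nb v ` colours)"] by blast
    moreover have "t \<in> aut" using t(1) T(2) local_stab_D(2) by blast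
    then have "g = t \<circ> (inv' t \<circ> g)" by (simp add: fun_eq_iff)
    ultimately show "g \<in> (\<Union>t \<in> T. (\<circ>) t ` fixator {v})" using t(1) by blast
  qed
  moreover have "closedin RT (local_stab v)"
    by (rule fixator_subset_closed[OF local_stab_subgroup _ _ fixator_local_stab]) (use v in auto)
  ultimately show ?thesis by (rule closed_compactin)
qed

lemma local_stab_finite_cosets:
  assumes v: "v \<in> V"
  shows "finite (coset ` local_stab v)"
proof -
  obtain T where T: "finite T" "T \<subseteq> local_stab v"
    "\<forall>g \<in> local_stab v. \<exists>t \<in> T. inv' t \<circ> g \<in> fixator (insert v (nb v ` colours))"
    using local_stab_transversal[OF v] by blast
  obtain i where i: "i \<in> colours" using third_colour by blast
  have "coset ` local_stab v \<subseteq> coset ` T"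
  proof (rule image_subsetI)
    fix g assume g: "g \<in> local_stab v"
    obtain t where t: "t \<in> T" "inv' t \<circ> g \<in> fixator (insert v (nb v ` colours))" using T(3) g by blast
    have "{v, nb v i} \<subseteq> insert v (nb v ` colours)" using i by blast
    then have k: "inv' t \<circ> g \<in> core" using t(2) fixator_antimono edge_fixator_core[OF v i] by blast
    have tl: "t \<in> local_stab v" using t T by blast
    note tD = local_stab_D[OF tl] and gD = local_stab_D[OF g]
    have "t \<circ> (inv' t \<circ> g) \<circ> inv' t \<in> core" using core_normal k tD(1) unfolding normal_RB_iff by blast
    moreover have "t \<circ> (inv' t \<circ> g) \<circ> inv' t = g \<circ> inv' t" using tD(2) by (simp add: fun_eq_iff)
    ultimately have "coset g = coset t" using coset_eq_iff[OF gD(1) tD(1)] by simp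
    then show "coset g \<in> coset ` T" using t(1) by simp
  qed
  then show ?thesis using T(1) finite_subset by blast
qed

lemma local_stab_conj:
  assumes r: "r \<in> UF" and k: "k \<in> local_stab v"
  shows "r \<circ> k \<circ> inv' r \<in> local_stab (r v)"
proof -
  note kD = local_stab_D[OF k]
  have raut: "r \<in> aut" and rG: "r \<in> GG" and sr: "sing r = {}" "sing (inv' r) = {}"
    using r UF_aut UF_GG UF_inv UF_iff_sing by blast+
  have "sing (k \<circ> inv' r) \<subseteq> sing (inv' r) \<union> inv' (inv' r) ` sing k"
    by (rule sing_comp) (simp_all add: kD raut)
  then have "sing (k \<circ> inv' r) \<subseteq> {r v}" using sr kD(4) raut by auto
  moreover have "sing (r \<circ> (k \<circ> inv' r)) \<subseteq> sing (k \<circ> inv' r) \<union> inv' (k \<circ> inv' r) ` sing r"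
    by (rule sing_comp) (simp_all add: kD raut)
  ultimately have "sing (r \<circ> k \<circ> inv' r) \<subseteq> {r v}" using sr by (simp add: comp_assoc)
  then show ?thesis using kD rG raut by (simp add: local_stab_def)
qed

text \<open>The local action at the fixed vertex can be corrected to the identity by a product of elements
  fixing an edge there, and the corrected element fixes all edges at this vertex.\<close>

lemma vertex_stabiliser_edge_group:
  assumes gen: "stab_gen = F'" and v: "v \<in> V" and g: "g \<in> GG" "g v = v"
  shows "g \<in> edge_group"
proof -
  have gaut: "g \<in> aut" by (rule GG_aut[OF g(1)])
  have "la g v \<in> stab_gen" using g(1) v gen by (simp add: GG_iff)
  from edge_group_local_action[OF v this] obtain h where h: "h \<in> edge_group" "h v = v" "la h v = la g v"
    by (elim bexE conjE) (rule that)
  have hG: "h \<in> GG" using subgroup_RB_D(1)[OF edge_group_subgroup] h(1) by (rule subsetD)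
  have haut: "h \<in> aut" by (rule GG_aut[OF hG])
  have iv: "inv' h v = v" using aut_inv_simps(2)[OF haut, of v] h(2) by simp
  let ?x = "inv' h \<circ> g"
  have xaut: "?x \<in> aut" using haut gaut by simp
  have "la ?x v = inv' (la h v) \<circ> la h v"
    using la_comp[of "inv' h" g v] la_inv[OF haut v] gaut haut v g(2) iv h(3) by simp
  also have "\<dots> = id" using permutes_inv_o(2) la_permutes[OF haut v] by blast
  finally have la: "la ?x v = id" .
  obtain i where i: "i \<in> colours" using third_colour by blast
  have xv: "?x v = v" using g(2) iv by simp
  then have "?x (nb v i) = nb v i" using aut_nb[OF xaut v i] la by simp
  then have "?x \<in> edge_group" using fixes_edge_edge_group[of ?x v i] xv hG g(1) v i by simp
  then have "h \<circ> ?x \<in> edge_group" by (rule subgroup_RB_D(3)[OF edge_group_subgroup h(1)])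
  moreover have "h \<circ> ?x = g" using haut by (simp add: fun_eq_iff)
  ultimately show ?thesis by simp
qed

lemma edge_inversion:
  assumes v: "v \<in> V" and i: "i \<in> colours"
  obtains s where "s \<in> UF" "s v = nb v i" "s (nb v i) = v"
proof -
  obtain s where s: "s \<in> UF" "s v = nb v i" "la s v = id"
    using UF_transitive[OF v nb_in_V[OF v i] F_closed(1)] by blast
  have "s (nb v i) = v" using aut_nb[OF UF_aut[OF s(1)] v i] s v i by simp
  then show ?thesis using that s by blast
qed

text \<open>Singularities can be removed one at a time by elements with a single singularity, and these are
  conjugate under \<open>U(F)\<close> to elements with their singularity at \<open>v\<close>.\<close>

lemma generated_by_local_stab_and_inversion:
  assumes trans: "acts_transitively d F'" and v: "v \<in> V" and i: "i \<in> colours"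
    and s: "s \<in> UF" "s v = nb v i"
    and T: "subgroup T RB" "local_stab v \<subseteq> T" "s \<in> T"
  shows "GG \<subseteq> T"
proof -
  note TD = subgroup_RB_D[OF T(1)]
  have UF_move: "\<exists>r \<in> T \<inter> UF. r v = u" if u: "u \<in> V" for u
    using u v
  proof (induction u rule: vertex_induct)
    case base
    then show ?case using TD(2) by (intro bexI[of _ id]) simp_all
  next
    case (step u k)
    then obtain r where r: "r \<in> T" "r \<in> UF" "r v = u" by blast
    have raut: "r \<in> aut" by (rule UF_aut[OF r(2)])
    have perm: "la r v permutes colours" by (rule la_permutes[OF raut v])
    let ?k = "inv' (la r v) k"
    have kc: "?k \<in> colours" using permutes_in_image[OF permutes_inv[OF perm]] step(2) by simp
    obtain \<tau> where \<tau>: "\<tau> \<in> F'" "\<tau> i = ?k" using trans i kc unfolding acts_transitively_def colours_def by blast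
    obtain \<phi> where \<phi>: "\<phi> \<in> F" "\<phi> i = ?k" using F_interpolates[OF \<tau>(1) i] \<tau>(2) by auto
    obtain x where x: "x \<in> UF" "x v = v" "la x v = \<phi>" using UF_transitive[OF v v \<phi>(1)] by blast
    have "x \<in> fixator {v}" using x by (simp add: fixator_def)
    then have xT: "x \<in> T" using fixator_local_stab T(2) by blast
    have "(r \<circ> (x \<circ> s)) v = r (nb v ?k)" using s(2) aut_nb[OF UF_aut[OF x(1)] v i] x \<phi> by simp
    also have "\<dots> = nb u k" using aut_nb[OF raut v kc] r(3) permutes_inverses(1)[OF perm] by simp
    finally have "(r \<circ> (x \<circ> s)) v = nb u k" .
    moreover have "r \<circ> (x \<circ> s) \<in> T" by (intro TD(3) r(1) xT T(3))
    moreover have "r \<circ> (x \<circ> s) \<in> UF" using r x s by simp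
    ultimately show ?case by blast
  qed
  have UF_T: "g \<in> T" if g: "g \<in> UF" for g
  proof -
    have gaut: "g \<in> aut" by (rule UF_aut[OF g])
    obtain r where r: "r \<in> T" "r \<in> UF" "r v = g v" using UF_move[of "g v"] gaut v by auto
    have raut: "r \<in> aut" by (rule UF_aut[OF r(2)])
    have "inv' r (g v) = v" using aut_inv_simps(2)[OF raut, of v] r(3) by simp
    then have "inv' r \<circ> g \<in> fixator {v}" using r g by (simp add: fixator_def)
    then have "inv' r \<circ> g \<in> T" using fixator_local_stab T(2) by blast
    then have "r \<circ> (inv' r \<circ> g) \<in> T" by (rule TD(3)[OF r(1)])
    moreover have "r \<circ> (inv' r \<circ> g) = g" using raut by (simp add: fun_eq_iff)
    ultimately show ?thesis by simp
  qed
  have "g \<in> T" if "g \<in> GG" for g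
    using that
  proof (induction "card (sing g)" arbitrary: g rule: less_induct)
    case less
    have gaut: "g \<in> aut" by (rule GG_aut[OF less.prems])
    have fin: "finite (sing g)" using less.prems by (simp add: GG_iff)
    show ?case
    proof (cases "sing g = {}")
      case True
      then have "g \<in> UF" using less.prems UF_iff_sing by blast
      then show ?thesis by (rule UF_T)
    next
      case False
      then obtain u where u: "u \<in> sing g" by blast
      then have uV: "u \<in> V" by (simp add: sing_def)
      have "la g u \<in> F'" using less.prems uV by (simp add: GG_iff)
      then obtain h where h: "h \<in> GG" "h u = u" "la h u = la g u" "sing h \<subseteq> {u}" using extension[OF uV uV] by blast
      have haut: "h \<in> aut" by (rule GG_aut[OF h(1)])
      obtain r where r: "r \<in> T" "r \<in> UF" "r v = u" using UF_move[OF uV] by blast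
      have raut: "r \<in> aut" by (rule UF_aut[OF r(2)])
      have "h \<in> local_stab u" using h by (simp add: local_stab_def)
      moreover have "inv' r u = v" using aut_inv_simps(2)[OF raut, of v] r(3) by simp
      ultimately have "inv' r \<circ> h \<circ> inv' (inv' r) \<in> local_stab v"
        using local_stab_conj[of "inv' r" h u] r(2) by simp
      then have "inv' r \<circ> h \<circ> r \<in> T" using T(2) raut by auto
      then have "r \<circ> ((inv' r \<circ> h \<circ> r) \<circ> inv' r) \<in> T" using TD(3)[OF r(1) TD(3)[OF _ TD(4)[OF r(1)]]] by blast
      moreover have "r \<circ> ((inv' r \<circ> h \<circ> r) \<circ> inv' r) = h" using raut by (simp add: fun_eq_iff)
      ultimately have hT: "h \<in> T" by simp
      define g' where "g' = g \<circ> inv' h"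
      have "sing g' \<subseteq> h ` (sing g - {u})"
      proof
        fix x assume x: "x \<in> sing g'"
        then have xV: "x \<in> V" by (simp add: sing_def)
        define y where "y = inv' h x"
        have y: "y \<in> V" "x = h y" using xV haut by (simp_all add: y_def)
        have "la g' x = la g y \<circ> inv' (la h y)"
          using la_comp[of g "inv' h" x] la_inv[OF haut xV] gaut haut xV by (simp add: g'_def y_def)
        then have notF: "la g y \<circ> inv' (la h y) \<notin> F" using x by (simp add: sing_def)
        have "y \<noteq> u"
        proof
          assume yu: "y = u"
          have "la g y \<circ> inv' (la h y) = id" using permutes_inv_o(1)[OF la_permutes[OF haut uV]] h(3) yu by simp
          then show False using notF by simp
        qed
        moreover from this have "la h y \<in> F" using h(4) y(1) by (auto simp: sing_def)
        then have "la g y \<notin> F" using notF by auto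
        then have "y \<in> sing g" using y(1) by (simp add: sing_def)
        ultimately show "x \<in> h ` (sing g - {u})" using y(2) by blast
      qed
      then have "card (sing g') \<le> card (sing g - {u})" using fin by (intro surj_card_le) simp_all
      also have "\<dots> < card (sing g)" using fin u by (rule card_Diff1_less)
      finally have "g' \<in> T" using less.hyps less.prems h(1) by (simp add: g'_def)
      then have "g' \<circ> h \<in> T" using hT by (rule TD(3))
      moreover have "g' \<circ> h = g" using haut by (simp add: g'_def fun_eq_iff)
      ultimately show ?thesis by simp
    qed
  qed
  then show ?thesis by blast
qed

text \<open>If \<open>F'\<close> is generated by point stabilisers, the local stabilisers of the two ends of an edge lie in the
  edge group and hence commute modulo the core. The inversion of that edge interchanges them, so every
  coset is a product of three factors from finite sets.\<close>

lemma core_finite_index: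
  assumes trans: "acts_transitively d F'" and gen: "stab_gen = F'"
    and v: "v \<in> V" and i: "i \<in> colours" and s: "s \<in> UF" "s v = nb v i" "s (nb v i) = v"
  shows "finite (rcosets\<^bsub>RB\<^esub> core)"
proof -
  let ?J = "local_stab v" and ?J' = "local_stab (nb v i)"
  have v': "nb v i \<in> V" using v i by simp
  have saut: "s \<in> aut" and sG: "s \<in> GG" using s UF_aut UF_GG by blast+
  note Jm = subgroup_RB_D(3)[OF local_stab_subgroup]
  define W where "W = {g \<in> GG. \<exists>x \<in> ?J. \<exists>y \<in> ?J'. \<exists>z \<in> {id, s}. coset g = coset (x \<circ> y \<circ> z)}"
  have W_I: "g \<in> W" if "g \<in> GG" "x \<in> ?J" "y \<in> ?J'" "z \<in> {id, s}" "coset g = coset (x \<circ> y \<circ> z)" for g x y z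
    unfolding W_def using that by (intro CollectI conjI bexI)
  have JE: "x \<in> edge_group" if "x \<in> ?J" for x
    using vertex_stabiliser_edge_group[OF gen v] local_stab_D[OF that] by simp
  have JE': "x \<in> edge_group" if "x \<in> ?J'" for x
    using vertex_stabiliser_edge_group[OF gen v'] local_stab_D[OF that] by simp
  have swap: "coset (x \<circ> y \<circ> k) = coset ((x \<circ> k) \<circ> y \<circ> id)" if "x \<in> ?J" "y \<in> ?J'" "k \<in> ?J" for x y k
  proof -
    note G = local_stab_D(1)[OF that(1)] local_stab_D(1)[OF that(2)] local_stab_D(1)[OF that(3)]
    have "coset (x \<circ> y \<circ> k) = coset x <#>\<^bsub>RB\<^esub> coset (y \<circ> k)" using coset_comp[of x "y \<circ> k"] G by (simp add: comp_assoc)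
    also have "coset (y \<circ> k) = coset (k \<circ> y)" by (rule edge_group_commute_mod_core[OF JE'[OF that(2)] JE[OF that(3)]])
    also have "coset x <#>\<^bsub>RB\<^esub> coset (k \<circ> y) = coset ((x \<circ> k) \<circ> y \<circ> id)" using coset_comp[of x "k \<circ> y"] G by (simp add: comp_assoc)
    finally show ?thesis .
  qed
  have ss: "s \<circ> s \<in> ?J" "inv' s \<circ> inv' s \<in> ?J"
  proof -
    have "s \<circ> s \<in> fixator {v}" using s by (simp add: fixator_def)
    then show "s \<circ> s \<in> ?J" using fixator_local_stab by blast
    then have "inv' (s \<circ> s) \<in> ?J" by (rule subgroup_RB_D(4)[OF local_stab_subgroup])
    then show "inv' s \<circ> inv' s \<in> ?J" using saut by (simp add: aut_inv_comp)
  qed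
  have WJ: "w \<circ> k \<in> W" if w: "w \<in> W" and k: "k \<in> ?J" for w k
  proof -
    obtain x y z where xyz: "x \<in> ?J" "y \<in> ?J'" "z \<in> {id, s}" "coset w = coset (x \<circ> y \<circ> z)" and wG: "w \<in> GG"
      using w unfolding W_def by (elim CollectE conjE bexE) (rule that)
    note G = local_stab_D(1)[OF xyz(1)] local_stab_D(1)[OF xyz(2)] local_stab_D(1)[OF k]
    have zG: "z \<in> GG" using xyz(3) sG by auto
    have wk: "coset (w \<circ> k) = coset (x \<circ> y \<circ> z \<circ> k)" using coset_comp wG G zG xyz(4) by simp
    show ?thesis
    proof (cases "z = id")
      case True
      then have "coset (w \<circ> k) = coset ((x \<circ> k) \<circ> y \<circ> id)" using wk swap[OF xyz(1,2) k] by simp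
      moreover have "w \<circ> k \<in> GG" using wG G by simp
      ultimately show ?thesis using W_I[OF _ Jm[OF xyz(1) k] xyz(2), of "w \<circ> k" id] by simp
    next
      case False
      then have z: "z = s" using xyz(3) by simp
      let ?k = "s \<circ> k \<circ> inv' s"
      have k': "?k \<in> ?J'" using local_stab_conj[OF s(1) k] s(2) by simp
      have "x \<circ> y \<circ> z \<circ> k = x \<circ> (y \<circ> ?k) \<circ> s" using saut z by (simp add: fun_eq_iff)
      then have "coset (w \<circ> k) = coset (x \<circ> (y \<circ> ?k) \<circ> s)" using wk by simp
      moreover have "w \<circ> k \<in> GG" using wG G by simp
      ultimately show ?thesis using W_I[OF _ xyz(1) Jm[OF xyz(2) k'], of "w \<circ> k" s] by simp
    qed
  qed
  have Ws: "w \<circ> s \<in> W" if w: "w \<in> W" for w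
  proof -
    obtain x y z where xyz: "x \<in> ?J" "y \<in> ?J'" "z \<in> {id, s}" "coset w = coset (x \<circ> y \<circ> z)" and wG: "w \<in> GG"
      using w unfolding W_def by (elim CollectE conjE bexE) (rule that)
    note G = local_stab_D(1)[OF xyz(1)] local_stab_D(1)[OF xyz(2)]
    have zG: "z \<in> GG" using xyz(3) sG by auto
    have ws: "coset (w \<circ> s) = coset (x \<circ> y \<circ> z \<circ> s)" using coset_comp wG G zG sG xyz(4) by simp
    have wsG: "w \<circ> s \<in> GG" using wG sG by simp
    show ?thesis
    proof (cases "z = id")
      case True
      then show ?thesis using ws W_I[OF wsG xyz(1,2), of s] by simp
    next
      case False
      then have "x \<circ> y \<circ> z \<circ> s = x \<circ> y \<circ> (s \<circ> s)" using xyz(3) by (simp add: comp_assoc)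
      then have "coset (w \<circ> s) = coset ((x \<circ> (s \<circ> s)) \<circ> y \<circ> id)" using ws swap[OF xyz(1,2) ss(1)] by simp
      then show ?thesis using W_I[OF wsG Jm[OF xyz(1) ss(1)] xyz(2), of id] by simp
    qed
  qed
  have Wsi: "w \<circ> inv' s \<in> W" if w: "w \<in> W" for w
  proof -
    have "(w \<circ> s) \<circ> (inv' s \<circ> inv' s) \<in> W" by (rule WJ[OF Ws[OF w] ss(2)])
    moreover have "(w \<circ> s) \<circ> (inv' s \<circ> inv' s) = w \<circ> inv' s" using saut by (simp add: fun_eq_iff)
    ultimately show ?thesis by simp
  qed
  have KG: "?J \<union> {s} \<subseteq> carrier RB" using sG local_stab_D(1) by auto
  have "generate RB (?J \<union> {s}) \<subseteq> W"
  proof (rule group.generate_subset_of_right_invariant[OF RB_group])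
    show "W \<subseteq> carrier RB" by (auto simp: W_def)
    show "\<one>\<^bsub>RB\<^esub> \<in> W"
      using W_I[of id id id id] subgroup_RB_D(2)[OF local_stab_subgroup] by simp
    show "?J \<union> {s} \<subseteq> carrier RB" by (rule KG)
    fix w k assume w: "w \<in> W" and k: "k \<in> ?J \<union> {s}"
    show "w \<otimes>\<^bsub>RB\<^esub> k \<in> W"
    proof (cases "k = s")
      case True
      then show ?thesis using Ws[OF w] by simp
    next
      case False
      then show ?thesis using WJ[OF w] k by simp
    qed
    show "w \<otimes>\<^bsub>RB\<^esub> inv\<^bsub>RB\<^esub> k \<in> W"
    proof (cases "k = s")
      case True
      then show ?thesis using Wsi[OF w] sG by simp
    next
      case False
      then have kJ: "k \<in> ?J" using k by simp
      show ?thesis using WJ[OF w subgroup_RB_D(4)[OF local_stab_subgroup kJ]] local_stab_D(1)[OF kJ] by simp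
    qed
  qed
  moreover have "GG \<subseteq> generate RB (?J \<union> {s})"
    by (rule generated_by_local_stab_and_inversion[OF trans v i s(1,2) group.generate_is_subgroup[OF RB_group KG]])
      (auto intro: generate.incl)
  ultimately have GW: "GG \<subseteq> W" by blast
  define P where "P = (\<lambda>(p, q, r). (p <#>\<^bsub>RB\<^esub> q) <#>\<^bsub>RB\<^esub> r) ` ((coset ` ?J) \<times> (coset ` ?J') \<times> {coset id, coset s})"
  have "finite P" unfolding P_def
    by (intro finite_imageI finite_cartesian_product local_stab_finite_cosets[OF v] local_stab_finite_cosets[OF v']) simp
  moreover have "rcosets\<^bsub>RB\<^esub> core \<subseteq> P"
  proof
    fix R assume "R \<in> rcosets\<^bsub>RB\<^esub> core"
    then obtain g where g: "g \<in> GG" "R = coset g" by (auto simp: RCOSETS_def coset_def)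
    have "g \<in> W" using GW g(1) by (rule subsetD)
    then obtain x y z where xyz: "x \<in> ?J" "y \<in> ?J'" "z \<in> {id, s}" "coset g = coset (x \<circ> y \<circ> z)"
      unfolding W_def by (elim CollectE conjE bexE) (rule that)
    note G = local_stab_D(1)[OF xyz(1)] local_stab_D(1)[OF xyz(2)]
    have zG: "z \<in> GG" using xyz(3) sG by auto
    have "R = (coset x <#>\<^bsub>RB\<^esub> coset y) <#>\<^bsub>RB\<^esub> coset z" using g(2) xyz(4) coset_comp G zG by simp
    moreover have "(coset x, coset y, coset z) \<in> (coset ` ?J) \<times> (coset ` ?J') \<times> {coset id, coset s}"
      using xyz by auto
    ultimately show "R \<in> P" unfolding P_def by (intro image_eqI[of _ _ "(coset x, coset y, coset z)"]) simp_all
  qed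
  ultimately show ?thesis by (rule finite_subset[rotated])
qed

lemma local_imp_virtually_class_S:
  assumes "acts_transitively d F'" "generated_by_point_stabilizers d F'"
  shows "virtually_class_S RB RT"
proof -
  have gen: "stab_gen = F'" using assms(2) by (simp add: generated_by_point_stabilizers_def stab_gen_def)
  obtain v where v: "v \<in> V" using vertices_nonempty by blast
  obtain i where i: "i \<in> colours" using third_colour by blast
  obtain s where s: "s \<in> UF" "s v = nb v i" "s (nb v i) = v" using edge_inversion[OF v i] by blast
  have sG: "s \<in> GG" by (rule UF_GG[OF s(1)])
  have KG: "local_stab v \<union> {s} \<subseteq> carrier RB" using sG local_stab_D(1) by auto
  have fin: "finite (rcosets\<^bsub>RB\<^esub> core)" by (rule core_finite_index[OF assms(1) gen v i s])
  have "GG \<subseteq> generate RB (local_stab v \<union> {s})"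
    by (rule generated_by_local_stab_and_inversion[OF assms(1) v i s(1,2) group.generate_is_subgroup[OF RB_group KG]])
      (auto intro: generate.incl)
  then have "generate RB (local_stab v \<union> {s}) = carrier RB"
    using group.generate_incl[OF RB_group KG] by auto
  moreover have "compactin RT (local_stab v \<union> {s})"
    by (rule compactin_Un[OF local_stab_compact[OF v]]) (simp add: sG finite_imp_compactin)
  ultimately have "compactly_generated RB RT" unfolding compactly_generated_def by blast
  then have "compactly_generated CB CT"
    by (rule compactly_generated_finite_index[OF RT_topological_group _ core_subgroup core_closedin fin])
  then show ?thesis using fin by (rule virtually_class_S_I)
qed

end

theorem theorem9p2p14:
  fixes d :: nat
    and V :: "'v set" and E :: "('v \<times> 'v) set" and c :: "'v \<times> 'v \<Rightarrow> nat"
    and F F' :: "(nat \<Rightarrow> nat) set"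
  assumes "d > 2"
    and "regular_tree d V E"
    and "legal_coloring d V E c"
    and "subgroup F (sym_group d)"
    and "subgroup F' (sym_group d)"
    and "F \<subseteq> F'"
    and "F' \<subseteq> orbit_preserving d F"
    and "\<not> acts_freely d F"
  shows "((acts_transitively d F' \<and> generated_by_point_stabilizers d F') \<longleftrightarrow>
          virtually_class_S (restricted_BM_group d V E c F F') (restricted_BM_topology d V E c F F'))
       \<and> (virtually_class_S (restricted_BM_group d V E c F F') (restricted_BM_topology d V E c F F') \<longleftrightarrow>
          class_R (restricted_BM_group d V E c F F') (restricted_BM_topology d V E c F F'))"
proof -
  interpret BM_pair d V E c F F'
    by (intro BM_pair.intro coloured_tree.intro BM_pair_axioms.intro) (fact assms)+
  show ?thesis
    unfolding restricted_BM_topology_eq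
    using local_imp_virtually_class_S virtually_class_S_imp_class_R class_R_imp_local by blast
qed

end
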